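(* Let $q$ be a prime power and $M\geq 2$ an integer with $(M,q)=1$. For $m\geq1$ let $s^M_{\mathrm{Sp}}(m,q)$ be the proportion of elements of $\mathrm{Sp}(2m,q)$ that are separable and are $M$-th powers in $\mathrm{Sp}(2m,q)$, and let $S^M_{\mathrm{Sp}}(q,u)=1+\sum_{m\geq1}s^M_{\mathrm{Sp}}(m,q)u^m$. Then, as formal power series in $u$, $$S^M_{\mathrm{Sp}}(q,u)=\prod_{d=1}^{\infty}\left(1+\frac{u^d}{q^d+1}\right)^{N^*_M(q,2d)}\prod_{d=1}^{\infty}\left(1+\frac{u^d}{q^d-1}\right)^{R^*_M(q,2d)}.$$
   Context: $\mathrm{Sp}(2m,q)$ is the symplectic group of a non-degenerate alternating form on $\mathbb{F}_q^{2m}$. An element $X$ of a group $G$ is an $M$-th power in $G$ if $Y^M=X$ for some $Y\in G$. A matrix is separable if its characteristic polynomial has no repeated roots. For monic $f$ of degree $r$ with $f(0)\ne0$, $f^*(x)=f(0)^{-1}x^rf(x^{-1})$; SRIM means irreducible monic with $f=f^*$. A monic irreducible $g\neq x$ of degree $k$ is an $M$-power polynomial if $g(x^M)$ has a monic irreducible factor of degree $k$. A SRIM $f$ of degree $2k$ is an $M^*$-power SRIM polynomial if $f(x^M)$ has a SRIM factor of degree $2k$. $N^*_M(q,2d)$ is the number of $M^*$-power SRIM polynomials of degree $2d$ over $\mathbb{F}_q$. $R^*_M(q,2d)$ is the number of unordered pairs $\{\varphi,\varphi^*\}$ where $\varphi\in\mathbb{F}_q[x]$ is a monic irreducible $M$-power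 polynomial of degree $d$ with $\varphi\neq\varphi^*$. *)

theory Defs
  imports "Jordan_Normal_Form.Char_Poly"
    "HOL-Computational_Algebra.Formal_Power_Series"
    "HOL-Computational_Algebra.Polynomial_Factorial"
begin

definition sympl_J :: "nat \<Rightarrow> 'a :: comm_ring_1 mat" where
  "sympl_J m = mat (2*m) (2*m) (\<lambda>(i,j).
      if i < m \<and> j = i + m then 1
      else if m \<le> i \<and> j + m = i then - 1 else 0)"

definition Sp :: "nat \<Rightarrow> 'a :: comm_ring_1 mat set" where
  "Sp m = {A \<in> carrier_mat (2*m) (2*m). transpose_mat A * sympl_J m * A = sympl_J m}"

text \<open>A polynomial has no repeated roots (in an algebraic closure) iff it is coprime to its derivative.\<close>
definition separable_mat :: "'a :: field mat \<Rightarrow> bool" where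
  "separable_mat A \<longleftrightarrow> coprime (char_poly A) (pderiv (char_poly A))"

definition is_Mth_power_Sp :: "nat \<Rightarrow> nat \<Rightarrow> 'a :: comm_ring_1 mat \<Rightarrow> bool" where
  "is_Mth_power_Sp M m X \<longleftrightarrow> (\<exists>Y \<in> Sp m. Y ^\<^sub>m M = X)"

definition s_Sp :: "'a :: {finite, field} itself \<Rightarrow> nat \<Rightarrow> nat \<Rightarrow> real" where
  "s_Sp TYPE('a) M m =
     real (card {X \<in> (Sp m :: 'a mat set). separable_mat X \<and> is_Mth_power_Sp M m X})
     / real (card (Sp m :: 'a mat set))"

definition S_Sp :: "'a :: {finite, field} itself \<Rightarrow> nat \<Rightarrow> real fps" where
  "S_Sp T M = Abs_fps (\<lambda>m. if m = 0 then 1 else s_Sp T M m)"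

definition recip_poly :: "'a :: field poly \<Rightarrow> 'a poly" where
  "recip_poly f = Polynomial.smult (inverse (coeff f 0)) (reflect_poly f)"

definition SRIM :: "'a :: field poly \<Rightarrow> bool" where
  "SRIM f \<longleftrightarrow> monic f \<and> irreducible f \<and> coeff f 0 \<noteq> 0 \<and> f = recip_poly f"

definition M_power_poly :: "nat \<Rightarrow> 'a :: field poly \<Rightarrow> bool" where
  "M_power_poly M g \<longleftrightarrow> monic g \<and> irreducible g \<and> g \<noteq> [:0, 1:] \<and>
     (\<exists>h. monic h \<and> irreducible h \<and> degree h = degree g \<and> h dvd pcompose g (monom 1 M))"

definition M_star_power_SRIM :: "nat \<Rightarrow> 'a :: field poly \<Rightarrow> bool" where
  "M_star_power_SRIM M f \<longleftrightarrow> SRIM f \<and> even (degree f) \<and>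
     (\<exists>h. SRIM h \<and> degree h = degree f \<and> h dvd pcompose f (monom 1 M))"

definition N_star :: "'a :: field itself \<Rightarrow> nat \<Rightarrow> nat \<Rightarrow> nat" where
  "N_star TYPE('a) M d = card {f :: 'a poly. M_star_power_SRIM M f \<and> degree f = 2*d}"

definition R_star :: "'a :: field itself \<Rightarrow> nat \<Rightarrow> nat \<Rightarrow> nat" where
  "R_star TYPE('a) M d = card {{\<phi>, recip_poly \<phi>} | \<phi> :: 'a poly.
       M_power_poly M \<phi> \<and> degree \<phi> = d \<and> \<phi> \<noteq> recip_poly \<phi>}"

end

theory Submission
  imports Defs "HOL-Number_Theory.Cong"
begin

text \<open>
  Write $T_m g = x^m g(x + 1/x)$. A separable symplectic matrix $X$ has a palindromic characteristic
  polynomial, so it equals $T_m g$ for a unique monic $g$ of degree $m$. If $Y$ has characteristic polynomial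
  $g$, then the block matrix $C$ with rows $(0, -1)$ and $(1, Y)$ has characteristic polynomial $T_m g$.
  Counting the invertible $K$ for which $K C K^{-1}$ is symplectic in two ways gives
  $|\{X \in Sp : \chi_X = f\}| \, \Phi(f) = |Sp| \, \Phi(g)$ for $f = T_m g$, where $\Phi$ is the totient function
  of polynomials: the fibres of $K \mapsto K C K^{-1}$ are cosets of the centraliser of $C$, which has
  $\Phi(f)$ elements, while the $C$-invariant symplectic forms are parametrised by the self-adjoint $H$ with
  $H Y = Y^T H$, of which there are $\Phi(g)$.

  Roots of $X$ commute with $X$, hence are polynomials $h(X)$, and whether some $h(X)$ is a symplectic $M$-th root
  depends only on $f$, multiplicatively in $g$ by the Chinese remainder theorem. The irreducible $a$ are of two
  kinds: $T a$ is a SRIM polynomial, with $\Phi(a) / \Phi(T a) = 1 / (q^d + 1)$, or $T a = \varphi \varphi^*$ with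
  $\varphi \ne \varphi^*$ and $\Phi(a) / \Phi(T a) = 1 / (q^d - 1)$. Expanding the product over all $a$
  gives the series.
\<close>

subsection \<open>Polynomials over a field\<close>

text \<open>A separable matrix has a cyclic vector, so vectors and commuting matrices become
  residues modulo the characteristic polynomial; this gives the centraliser its totient and makes
  conjugacy depend on the characteristic polynomial alone. Two obstacles shape the proof. In
  characteristic 2 a skew form need not be alternating, so the invariant forms are pinned down
  through alternation. The lift T is multiplicative and preserves coprimality, but it can lose
  separability: x - 2 lifts to (x - 1)^2. Factorisation therefore takes place in g, and separability
  of the lift is carried along as a condition on each factor. That f is a lift at all holds because
  a separable symplectic matrix cannot have the eigenvalue 1, which forces determinant 1. At an
  irreducible a of degree d the totients are q^d - 1 for a, and q^(2d) - 1 or (q^d - 1)^2 for T a;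
  their quotients are the two denominators. Residue fields appear as polynomials modulo an
  irreducible, and their isomorphisms are obtained by counting.\<close>

lemma coprime_field_poly_iff_bezout:
  fixes p q :: "'a::field poly"
  shows "coprime p q \<longleftrightarrow> (\<exists>s t. s * p + t * q = 1)"
proof
  assume "\<exists>s t. s * p + t * q = 1"
  then obtain s t where st: "s * p + t * q = 1" by blast
  show "coprime p q"
  proof (rule coprimeI)
    fix d assume "d dvd p" "d dvd q"
    then have "d dvd s * p + t * q" by simp
    then show "is_unit d" using st by simp
  qed
next
  assume cop: "coprime p q"
  define I where "I = {s * p + t * q | s t. True}"
  have memI: "s * p + t * q \<in> I" for s t unfolding I_def by blast
  have pI: "p \<in> I" and qI: "q \<in> I" using memI[of 1 0] memI[of 0 1] by simp_all
  have "p \<noteq> 0 \<or> q \<noteq> 0" using cop by auto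
  with pI qI have "\<exists>d. d \<in> I \<and> d \<noteq> 0" by blast
  \<comment> \<open>An element of least degree in the ideal generated by \<open>p\<close> and
    \<open>q\<close> divides the whole ideal, so coprimality makes it a unit.\<close>
  then obtain d where d: "d \<in> I" "d \<noteq> 0" and
    dmin: "\<And>e. e \<in> I \<Longrightarrow> e \<noteq> 0 \<Longrightarrow> degree d \<le> degree e"
    using ex_has_least_nat[of "\<lambda>d. d \<in> I \<and> d \<noteq> 0" _ degree] by metis
  have sub: "a - k * d \<in> I" if "a \<in> I" for a k
  proof -
    from that obtain s t where a: "a = s * p + t * q" unfolding I_def by blast
    from d obtain s' t' where d': "d = s' * p + t' * q" unfolding I_def by blast
    have "a - k * d = (s - k * s') * p + (t - k * t') * q"
      unfolding a d' by (simp add: algebra_simps)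
    then show ?thesis using memI by metis
  qed
  have dv: "d dvd a" if "a \<in> I" for a
  proof (rule ccontr)
    assume "\<not> d dvd a"
    then have nz: "a mod d \<noteq> 0" by (simp add: dvd_eq_mod_eq_0)
    moreover have "a mod d \<in> I" using sub[OF that, of "a div d"]
      by (simp add: minus_div_mult_eq_mod)
    ultimately have "degree d \<le> degree (a mod d)" using dmin by blast
    then show False using degree_mod_less'[OF d(2) nz] by simp
  qed
  have "is_unit d" using coprime_common_divisor[OF cop dv[OF pI] dv[OF qI]] .
  then obtain e where e: "1 = d * e" unfolding dvd_def by blast
  from d obtain s t where "d = s * p + t * q" unfolding I_def by blast
  then have "(e * s) * p + (e * t) * q = 1" using e by (simp add: algebra_simps)
  then show "\<exists>s t. s * p + t * q = 1" by blast
qed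

lemma coprime_field_poly_mult:
  fixes a b c :: "'a::field poly"
  assumes "coprime a c" and "coprime b c"
  shows "coprime (a * b) c"
proof -
  obtain s t where 1: "s * a + t * c = 1"
    using assms(1) coprime_field_poly_iff_bezout by blast
  obtain s' t' where 2: "s' * b + t' * c = 1"
    using assms(2) coprime_field_poly_iff_bezout by blast
  have "(s * s') * (a * b) + (s * a * t' + t * s' * b + t * t' * c) * c
      = (s * a + t * c) * (s' * b + t' * c)" by (simp add: algebra_simps)
  also have "\<dots> = 1" using 1 2 by simp
  finally show ?thesis using coprime_field_poly_iff_bezout by blast
qed

lemma coprime_field_poly_prod:
  fixes F :: "'b \<Rightarrow> 'a::field poly"
  assumes "\<And>a. a \<in> A \<Longrightarrow> coprime (F a) c"
  shows "coprime (\<Prod>a\<in>A. F a) c"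
  using assms by (induction A rule: infinite_finite_induct) (auto intro: coprime_field_poly_mult)

lemma coprime_field_poly_dvd_mult:
  fixes a b c :: "'a::field poly"
  assumes "coprime a b" and "a dvd b * c"
  shows "a dvd c"
proof -
  obtain s t where "s * a + t * b = 1"
    using assms(1) coprime_field_poly_iff_bezout by blast
  then have "(s * a + t * b) * c = c" by simp
  then have "a * (s * c) + t * (b * c) = c" by (simp add: algebra_simps)
  moreover have "a dvd a * (s * c) + t * (b * c)" using assms(2) by simp
  ultimately show ?thesis by simp
qed

lemma coprime_field_poly_divides_mult:
  fixes a b c :: "'a::field poly"
  assumes "coprime a b" and "a dvd c" and "b dvd c"
  shows "a * b dvd c"
proof -
  obtain k where k: "c = b * k" using assms(3) by (elim dvdE)
  have "a dvd k" using coprime_field_poly_dvd_mult assms k by blast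
  then show ?thesis unfolding k by (simp add: mult_dvd_mono mult.commute)
qed

lemma coprime_field_poly_cong:
  fixes f r r' :: "'a::field poly"
  assumes "f dvd r - r'" and "coprime r f"
  shows "coprime r' f"
proof -
  obtain s t where st: "s * r + t * f = 1"
    using assms(2) coprime_field_poly_iff_bezout by blast
  obtain k where "r - r' = f * k" using assms(1) by (elim dvdE)
  then have "r = r' + f * k" by (simp add: algebra_simps)
  then have "s * r' + (s * k + t) * f = 1" using st by (simp add: algebra_simps)
  then show ?thesis using coprime_field_poly_iff_bezout by blast
qed

lemma coprime_field_poly_crt:
  fixes f g a b :: "'a::field poly"
  assumes "coprime f g"
  obtains h where "f dvd h - a" and "g dvd h - b"
proof -
  obtain s t where st: "s * f + t * g = 1"
    using assms coprime_field_poly_iff_bezout by blast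
  \<comment> \<open>\<open>t * g\<close> is 1 modulo \<open>f\<close> and 0 modulo \<open>g\<close>;
    \<open>s * f\<close> is the reverse.\<close>
  define h where "h = a * (t * g) + b * (s * f)"
  have 1: "h - a = f * (s * (b - a)) + a * (s * f + t * g - 1)"
    unfolding h_def by (simp add: algebra_simps)
  have 2: "h - b = g * (t * (a - b)) + b * (s * f + t * g - 1)"
    unfolding h_def by (simp add: algebra_simps)
  show ?thesis using that[of h] 1 2 st by simp
qed

lemma irreducible_field_poly_coprime:
  fixes p q :: "'a::field poly"
  assumes "irreducible p" and "\<not> p dvd q"
  shows "coprime p q"
proof (rule coprimeI)
  fix d assume d: "d dvd p" "d dvd q"
  then show "is_unit d" using irreducibleD'[OF assms(1) d(1)] assms(2) dvd_trans by blast
qed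

lemma irreducible_field_poly_dvd_mult:
  fixes p a b :: "'a::field poly"
  assumes "irreducible p" shows "p dvd a * b \<longleftrightarrow> p dvd a \<or> p dvd b"
  using field_poly_irreducible_imp_prime[OF assms] by (rule prime_elem_dvd_mult_iff)

lemma irreducible_field_poly_dvd_power:
  fixes p a :: "'a::field poly"
  assumes "irreducible p" and "p dvd a ^ n" shows "p dvd a"
  using field_poly_irreducible_imp_prime[OF assms(1)] assms(2) by (rule prime_elem_dvd_power)

lemma irreducible_field_poly_degree_pos:
  fixes p :: "'a::field poly"
  assumes "irreducible p" shows "degree p > 0"
proof (rule ccontr)
  assume "\<not> degree p > 0"
  then have "is_unit p" using assms by (auto simp: is_unit_iff_degree)
  then show False using assms by (simp add: irreducible_def)
qed

lemma monic_dvd_same_degree: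
  fixes p q :: "'a::field poly"
  assumes "monic p" "monic q" "p dvd q" "degree q \<le> degree p"
  shows "p = q"
proof -
  obtain k where k: "q = p * k" using assms(3) by (elim dvdE)
  have nz: "p \<noteq> 0" "k \<noteq> 0" using assms(1,2) k by auto
  then have "degree q = degree p + degree k" unfolding k by (simp add: degree_mult_eq)
  then have "degree k = 0" using assms(4) by simp
  then obtain c where c: "k = [:c:]" by (elim degree_eq_zeroE)
  have "lead_coeff q = lead_coeff p * lead_coeff k" unfolding k by (rule lead_coeff_mult)
  then have "c = 1" using assms(1,2) c by simp
  then show ?thesis using k c by simp
qed

lemma monic_irreducible_dvd_eq:
  fixes p q :: "'a::field poly"
  assumes "monic p" "monic q" "irreducible p" "irreducible q" "p dvd q"
  shows "p = q"
proof -
  have "q dvd p" using irreducibleD'[OF assms(4,5)] assms(3) by (auto simp: irreducible_def)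
  then have "degree q \<le> degree p" using assms(3) dvd_imp_degree_le by (metis irreducible_def)
  then show ?thesis using assms monic_dvd_same_degree by blast
qed

lemma monic_irreducible_factor_exists:
  fixes p :: "'a::field poly"
  assumes "degree p > 0"
  obtains a where "monic a" "irreducible a" "a dvd p"
proof -
  have "\<exists>b. irreducible b \<and> b dvd p"
    using assms
  proof (induction "degree p" arbitrary: p rule: less_induct)
    case less
    show ?case
    proof (cases "irreducible p")
      case True then show ?thesis using dvd_refl by blast
    next
      case False
      have p0: "p \<noteq> 0" using less.prems by auto
      then have "\<not> is_unit p" using less.prems by (auto simp: is_unit_iff_degree)
      then obtain a b where ab: "p = a * b" "\<not> is_unit a" "\<not> is_unit b"
        using False p0 unfolding irreducible_def by blast
      have nz: "a \<noteq> 0" "b \<noteq> 0" using ab(1) p0 by auto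
      then have "degree a > 0" "degree b > 0" "degree p = degree a + degree b"
        using ab by (auto simp: is_unit_iff_degree degree_mult_eq)
      then have "degree a < degree p" "degree a > 0" by auto
      from less.hyps[OF this] obtain c where "irreducible c" "c dvd a" by blast
      then show ?thesis using ab(1) by auto
    qed
  qed
  then obtain b where b: "irreducible b" "b dvd p" by blast
  have nz: "b \<noteq> 0" using b by auto
  define a where "a = Polynomial.smult (inverse (lead_coeff b)) b"
  have "monic a" using nz unfolding a_def by simp
  moreover have "irreducible a" unfolding a_def using b(1) nz
    using irreducible_mult_unit_left[of "[:inverse (lead_coeff b):]" b] by (simp add: is_unit_const_poly_iff)
  moreover have "a dvd p" unfolding a_def using b(2) nz by (simp add: smult_dvd)
  ultimately show ?thesis using that by blast
qed

lemma common_irreducible_factor_exists: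
  fixes p q :: "'a::field poly"
  assumes "\<not> coprime p q" and "p \<noteq> 0"
  obtains a where "monic a" "irreducible a" "a dvd p" "a dvd q"
proof -
  obtain d where d: "d dvd p" "d dvd q" "\<not> is_unit d" using assms(1) by (auto simp: coprime_def)
  then have "d \<noteq> 0" using assms(2) by auto
  then have "degree d > 0" using d(3) by (auto simp: is_unit_iff_degree)
  then obtain a where "monic a" "irreducible a" "a dvd d" using monic_irreducible_factor_exists by blast
  then show ?thesis using that d dvd_trans by blast
qed

section \<open>Separability and factorisation\<close>

lemma separable_poly_mult_iff:
  fixes f g :: "'a::field poly"
  shows "coprime (f * g) (pderiv (f * g)) \<longleftrightarrow>
    coprime f (pderiv f) \<and> coprime g (pderiv g) \<and> coprime f g"
proof (intro iffI conjI)
  assume A: "coprime (f * g) (pderiv (f * g))"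
  have D: "is_unit d" if "d dvd f * g" "d dvd f * pderiv g + g * pderiv f" for d
    using coprime_common_divisor[OF A[unfolded pderiv_mult]] that .
  show "coprime f (pderiv f)" by (rule coprimeI, rule D) (simp_all add: dvd_mult dvd_mult2)
  show "coprime g (pderiv g)" by (rule coprimeI, rule D) (simp_all add: dvd_mult dvd_mult2)
  show "coprime f g" by (rule coprimeI, rule D) (simp_all add: dvd_mult dvd_mult2)
next
  assume "coprime f (pderiv f) \<and> coprime g (pderiv g) \<and> coprime f g"
  then have f: "coprime (pderiv f) f" and g: "coprime (pderiv g) g" and fg: "coprime f g" "coprime g f"
    by (simp_all add: coprime_commute)
  \<comment> \<open>Modulo \<open>f\<close> the derivative of \<open>f * g\<close> is
    \<open>g * pderiv f\<close>, and coprimality with \<open>f\<close> depends only on the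
    residue.\<close>
  have "coprime (g * pderiv f) f" using fg f by (intro coprime_field_poly_mult) simp_all
  then have "coprime (pderiv (f * g)) f"
    by (rule coprime_field_poly_cong[rotated]) (simp add: pderiv_mult)
  moreover have "coprime (f * pderiv g) g" using fg g by (intro coprime_field_poly_mult) simp_all
  then have "coprime (pderiv (f * g)) g"
    by (rule coprime_field_poly_cong[rotated]) (simp add: pderiv_mult)
  ultimately show "coprime (f * g) (pderiv (f * g))"
    by (intro coprime_field_poly_mult) (simp_all add: coprime_commute)
qed

lemma separable_poly_dvd:
  fixes f g :: "'a::field poly"
  assumes "coprime g (pderiv g)" and "f dvd g"
  shows "coprime f (pderiv f)"
  using assms by (auto simp: separable_poly_mult_iff elim!: dvdE)

lemma separable_poly_prod_iff:
  fixes F :: "'b \<Rightarrow> 'a::field poly"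
  assumes "finite A" and "\<And>a b. a \<in> A \<Longrightarrow> b \<in> A \<Longrightarrow> a \<noteq> b \<Longrightarrow> coprime (F a) (F b)"
  shows "coprime (\<Prod>a\<in>A. F a) (pderiv (\<Prod>a\<in>A. F a)) \<longleftrightarrow> (\<forall>a\<in>A. coprime (F a) (pderiv (F a)))"
  using assms
proof (induction A rule: finite_induct)
  case (insert x A)
  have "coprime (prod F A) (F x)"
    using insert.hyps insert.prems by (intro coprime_field_poly_prod) auto
  then show ?case using insert by (simp add: separable_poly_mult_iff coprime_commute)
qed simp

text \<open>Finite fields are perfect. If \<open>f\<close> divided its derivative, the derivative
  would vanish by degree, only exponents divisible by the characteristic p would occur, and p-th
  roots of the coefficients would exhibit \<open>f\<close> as a p-th power.\<close>

lemma irreducible_separable_finite_field: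
  fixes f :: "'a::{finite,field} poly"
  assumes "irreducible f"
  shows "coprime f (pderiv f)"
proof (rule irreducible_field_poly_coprime[OF assms], rule notI)
  assume "f dvd pderiv f"
  have deg: "degree f > 0" using assms by (rule irreducible_field_poly_degree_pos)
  have z: "pderiv f = 0"
  proof (rule ccontr)
    assume "pderiv f \<noteq> 0"
    then have "degree f \<le> degree (pderiv f)" using \<open>f dvd pderiv f\<close> dvd_imp_degree_le by blast
    moreover have "degree (pderiv f) \<le> degree f - 1"
      by (rule degree_le) (auto simp: coeff_pderiv coeff_eq_0)
    ultimately show False using deg by simp
  qed
  define p where "p = CHAR('a)"
  have "CHAR('a) > 0" by (rule finite_imp_CHAR_pos) simp
  then have prime: "prime CHAR('a)" by (rule prime_CHAR_semidom)
  then have p0: "p > 0" "p > 1" unfolding p_def by (auto simp: prime_gt_0_nat prime_gt_Suc_0_nat)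
  have frob_inj: "inj (\<lambda>x::'a. x ^ p)"
  proof (rule injI)
    fix x y :: 'a assume e: "x ^ p = y ^ p"
    have "((x - y) + y) ^ p = (x - y) ^ p + y ^ p"
      by (rule freshmans_dream) (simp_all add: prime p_def)
    then have "(x - y) ^ p = 0" using e by simp
    then show "x = y" by simp
  qed
  have "surj (\<lambda>x::'a. x ^ p)" using finite_UNIV_inj_surj[OF _ frob_inj] by simp
  define rt where "rt = inv_into UNIV (\<lambda>x::'a. x ^ p)"
  have rt: "rt x ^ p = x" for x
    unfolding rt_def using surj_f_inv_f[OF \<open>surj (\<lambda>x::'a. x ^ p)\<close>, of x] by simp
  have cz: "coeff f i = 0" if "\<not> p dvd i" for i
  proof (cases i)
    case (Suc j)
    have "coeff (pderiv f) j = of_nat i * coeff f i" unfolding Suc by (simp add: coeff_pderiv)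
    then have "of_nat i * coeff f i = 0" using z by simp
    moreover have "(of_nat i :: 'a) \<noteq> 0" using that unfolding p_def by (simp add: of_nat_eq_0_iff_char_dvd)
    ultimately show ?thesis by simp
  qed (use that in simp)
  \<comment> \<open>The p-th root of \<open>f\<close>, with Frobenius inverted coefficientwise. The
    range up to \<open>degree f\<close> is generous: the surplus coefficients are 0.\<close>
  define g where "g = (\<Sum>i\<le>degree f. monom (rt (coeff f (p * i))) i)"
  have "g ^ p = (\<Sum>i\<le>degree f. monom (rt (coeff f (p * i))) i ^ p)"
    unfolding g_def by (rule freshmans_dream_sum) (simp_all add: prime p_def)
  also have "\<dots> = (\<Sum>i\<le>degree f. monom (coeff f (p * i)) (p * i))"
    by (simp add: monom_power rt mult.commute)
  also have "\<dots> = f"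
  proof (rule poly_eqI)
    fix n
    have "coeff (\<Sum>i\<le>degree f. monom (coeff f (p * i)) (p * i)) n
      = (\<Sum>i\<le>degree f. if p * i = n then coeff f n else 0)"
      by (auto simp: coeff_sum intro!: sum.cong)
    also have "\<dots> = coeff f n"
    proof (cases "p dvd n \<and> n \<le> degree f")
      case True
      then obtain k where k: "n = p * k" by auto
      have "k \<le> p * k" using p0 by simp
      then have "k \<le> degree f" using True k by linarith
      moreover have "(p * i = n) = (i = k)" for i using k p0 by auto
      ultimately show ?thesis by simp
    next
      case False
      then have "coeff f n = 0" using cz coeff_eq_0[of f n] by auto
      then show ?thesis by (simp cong: if_cong)
    qed
    finally show "coeff (\<Sum>i\<le>degree f. monom (coeff f (p * i)) (p * i)) n = coeff f n" .
  qed
  finally have fp: "g ^ p = f" .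
  \<comment> \<open>As p is at least 2, \<open>f\<close> splits as \<open>g\<close> times a positive
    power of \<open>g\<close>; irreducibility then makes \<open>g\<close>, hence \<open>f\<close>, a
    unit.\<close>
  define k where "k = p - 2"
  have k: "p = Suc (Suc k)" using p0 unfolding k_def by simp
  have fg: "f = g * g ^ Suc k" using fp unfolding k by simp
  have "is_unit g \<or> is_unit (g ^ Suc k)" using irreducibleD[OF assms fg] .
  then have "is_unit g" using is_unit_power_iff[of g "Suc k"] by blast
  then have "is_unit f" using fp is_unit_power_iff[of g p] by blast
  then show False using irreducible_not_unit[OF assms] by blast
qed

subsection \<open>Counting residues\<close>

text \<open>Phrased by coefficients so that the zero polynomial belongs to it even for n = 0, where
  \<open>degree p < n\<close> would give the empty set.\<close>

definition deg_lt :: "nat \<Rightarrow> 'a::zero poly set" where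
  "deg_lt n = {p. \<forall>i\<ge>n. coeff p i = 0}"

lemma deg_lt_iff: "p \<in> deg_lt n \<longleftrightarrow> p = 0 \<or> degree p < n"
proof
  assume "p \<in> deg_lt n"
  then have "n \<le> degree p \<Longrightarrow> lead_coeff p = 0" unfolding deg_lt_def by blast
  then show "p = 0 \<or> degree p < n" using leading_coeff_0_iff[of p] by linarith
qed (auto simp: deg_lt_def coeff_eq_0)

lemma deg_lt_diff: "p \<in> deg_lt n \<Longrightarrow> q \<in> deg_lt n \<Longrightarrow> (p :: 'a::ab_group_add poly) - q \<in> deg_lt n"
  by (auto simp: deg_lt_def)

lemma mod_in_deg_lt:
  fixes f :: "'a::field poly"
  assumes "f \<noteq> 0" shows "r mod f \<in> deg_lt (degree f)"
  using degree_mod_less[OF assms, of r] by (auto simp: deg_lt_iff)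

lemma deg_lt_dvd_imp_zero:
  fixes f r :: "'a::field poly"
  assumes "r \<in> deg_lt (degree f)" "f dvd r" shows "r = 0"
  using assms dvd_imp_degree_le by (force simp: deg_lt_iff)

lemma deg_lt_congD:
  fixes f r s :: "'a::field poly"
  assumes "r \<in> deg_lt (degree f)" "s \<in> deg_lt (degree f)" "f dvd r - s" shows "r = s"
  using deg_lt_dvd_imp_zero[OF deg_lt_diff[OF assms(1,2)] assms(3)] by simp

lemma finite_card_deg_lt:
  "finite (deg_lt n :: 'a::{finite,zero} poly set) \<and>
   card (deg_lt n :: 'a poly set) = card (UNIV :: 'a set) ^ n"
proof (induction n)
  case 0
  have "deg_lt 0 = {0 :: 'a poly}" by (auto simp: deg_lt_iff)
  then show ?case by simp
next
  case (Suc n)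
  have img: "deg_lt (Suc n) = (\<lambda>(a, p). pCons a p) ` ((UNIV :: 'a set) \<times> deg_lt n)"
  proof (intro equalityI subsetI)
    fix p :: "'a poly" assume p: "p \<in> deg_lt (Suc n)"
    obtain a q where q: "p = pCons a q" by (cases p)
    have "q \<in> deg_lt n" unfolding deg_lt_def
    proof (intro CollectI allI impI)
      fix i assume "i \<ge> n"
      then have "coeff p (Suc i) = 0" using p unfolding deg_lt_def by simp
      then show "coeff q i = 0" unfolding q by simp
    qed
    then show "p \<in> (\<lambda>(a, p). pCons a p) ` ((UNIV :: 'a set) \<times> deg_lt n)" using q by force
  qed (auto simp: deg_lt_def coeff_pCons split: nat.split)
  have inj: "inj_on (\<lambda>(a, p). pCons a p) ((UNIV :: 'a set) \<times> deg_lt n)"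
    by (auto simp: inj_on_def)
  show ?case unfolding img using Suc by (simp add: card_image[OF inj] card_cartesian_product)
qed

lemmas finite_deg_lt [simp] = finite_card_deg_lt[THEN conjunct1]
lemmas card_deg_lt = finite_card_deg_lt[THEN conjunct2]

text \<open>Remainders represent the residues, and those coprime to \<open>f\<close> the units of
  the quotient ring. For \<open>f = 1\<close> the only remainder is 0, which is coprime to 1, so the
  value is 1.\<close>

definition poly_totient :: "'a::field poly \<Rightarrow> nat" where
  "poly_totient f = card {r \<in> deg_lt (degree f). coprime r f}"

lemma coprime_mod_field_poly_iff:
  fixes r f :: "'a::field poly"
  shows "coprime (r mod f) f \<longleftrightarrow> coprime r f"
proof -
  have "f dvd r - r mod f" "f dvd r mod f - r" by (simp_all add: mod_eq_dvd_iff[symmetric])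
  then show ?thesis using coprime_field_poly_cong by blast
qed

text \<open>Chinese remainder theorem: reducing modulo both factors is injective on remainders,
  hence bijective because both sides have equally many elements, and it matches units with pairs of
  units.\<close>

lemma poly_totient_mult:
  fixes f g :: "'a::{finite,field} poly"
  assumes "coprime f g" "f \<noteq> 0" "g \<noteq> 0"
  shows "poly_totient (f * g) = poly_totient f * poly_totient g"
proof -
  define \<psi> where "\<psi> = (\<lambda>r. (r mod f, r mod g))"
  let ?D = "deg_lt (degree (f * g)) :: 'a poly set"
  let ?E = "deg_lt (degree f) \<times> deg_lt (degree g) :: ('a poly \<times> 'a poly) set"
  have inj: "inj_on \<psi> ?D"
  proof (rule inj_onI)
    fix r s assume rs: "r \<in> ?D" "s \<in> ?D" "\<psi> r = \<psi> s"
    then have "f dvd r - s" "g dvd r - s" unfolding \<psi>_def by (simp_all add: mod_eq_dvd_iff)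
    then have "f * g dvd r - s" using assms(1) coprime_field_poly_divides_mult by blast
    then show "r = s" using rs deg_lt_congD by blast
  qed
  have sub: "\<psi> ` ?D \<subseteq> ?E" using assms unfolding \<psi>_def by (auto intro: mod_in_deg_lt)
  have "card (\<psi> ` ?D) = card ?D" by (rule card_image[OF inj])
  also have "\<dots> = card ?E" using assms
    by (simp add: card_cartesian_product card_deg_lt degree_mult_eq power_add)
  finally have "card (\<psi> ` ?D) = card ?E" .
  then have img: "\<psi> ` ?D = ?E" using sub by (intro card_subset_eq) simp_all
  have cop: "coprime r (f * g) \<longleftrightarrow> coprime (fst (\<psi> r)) f \<and> coprime (snd (\<psi> r)) g" for r
  proof -
    have "coprime r (f * g) \<longleftrightarrow> coprime r f \<and> coprime r g"
    proof
      assume "coprime r (f * g)"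
      then show "coprime r f \<and> coprime r g"
        using coprime_divisors[OF dvd_refl dvd_triv_left] coprime_divisors[OF dvd_refl dvd_triv_right] by blast
    next
      assume "coprime r f \<and> coprime r g"
      then show "coprime r (f * g)" using coprime_field_poly_mult[of f r g] by (simp add: coprime_commute)
    qed
    then show ?thesis unfolding \<psi>_def by (simp add: coprime_mod_field_poly_iff)
  qed
  have "\<psi> ` {r \<in> ?D. coprime r (f * g)} =
     {r \<in> deg_lt (degree f). coprime r f} \<times> {r \<in> deg_lt (degree g). coprime r g}" (is "_ = ?R")
  proof (intro equalityI subsetI)
    fix x assume "x \<in> \<psi> ` {r \<in> ?D. coprime r (f * g)}"
    then obtain r where r: "x = \<psi> r" "r \<in> ?D" "coprime r (f * g)" by blast
    then have "x \<in> ?E" using img by blast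
    then show "x \<in> ?R" using r cop by (auto simp: mem_Times_iff)
  next
    fix x assume x: "x \<in> ?R"
    then have "x \<in> ?E" by auto
    then obtain r where r: "r \<in> ?D" "x = \<psi> r" using img by blast
    then have "coprime r (f * g)" using cop x by (auto simp: mem_Times_iff)
    then show "x \<in> \<psi> ` {r \<in> ?D. coprime r (f * g)}" using r by blast
  qed
  moreover have "inj_on \<psi> {r \<in> ?D. coprime r (f * g)}" using inj by (rule inj_on_subset) auto
  then have "card (\<psi> ` {r \<in> ?D. coprime r (f * g)}) = card {r \<in> ?D. coprime r (f * g)}"
    by (rule card_image)
  ultimately show ?thesis unfolding poly_totient_def by (simp add: card_cartesian_product)
qed

lemma poly_totient_irreducible:
  fixes f :: "'a::{finite,field} poly"
  assumes "irreducible f"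
  shows "poly_totient f = card (UNIV :: 'a set) ^ degree f - 1"
proof -
  have "{r \<in> deg_lt (degree f). coprime r f} = deg_lt (degree f) - {0}"
  proof (intro equalityI subsetI)
    fix r :: "'a poly" assume "r \<in> {r \<in> deg_lt (degree f). coprime r f}"
    moreover have "\<not> coprime 0 f" using irreducible_not_unit[OF assms] unfolding coprime_0_left_iff .
    ultimately show "r \<in> deg_lt (degree f) - {0}" by blast
  next
    fix r :: "'a poly" assume r: "r \<in> deg_lt (degree f) - {0}"
    then have "\<not> f dvd r" using deg_lt_dvd_imp_zero by blast
    then have "coprime r f" using irreducible_field_poly_coprime[OF assms] coprime_commute by blast
    then show "r \<in> {r \<in> deg_lt (degree f). coprime r f}" using r by simp
  qed
  moreover have "(0 :: 'a poly) \<in> deg_lt (degree f)" by (simp add: deg_lt_iff)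
  ultimately show ?thesis unfolding poly_totient_def by (simp add: card_deg_lt)
qed

lemma poly_totient_pos:
  fixes f :: "'a::{finite,field} poly"
  assumes "f \<noteq> 0" shows "poly_totient f > 0"
proof -
  have "coprime (1 mod f) f" by (simp add: coprime_mod_field_poly_iff)
  then have "1 mod f \<in> {r \<in> deg_lt (degree f). coprime r f}" using mod_in_deg_lt[OF assms] by blast
  moreover have "finite {r \<in> deg_lt (degree f). coprime r f}" by simp
  ultimately show ?thesis unfolding poly_totient_def using card_gt_0_iff by blast
qed

lemma poly_totient_prod:
  fixes F :: "'b \<Rightarrow> 'a::{finite,field} poly"
  assumes "finite A" and "\<And>a b. a \<in> A \<Longrightarrow> b \<in> A \<Longrightarrow> a \<noteq> b \<Longrightarrow> coprime (F a) (F b)"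
    and "\<And>a. a \<in> A \<Longrightarrow> F a \<noteq> 0"
  shows "poly_totient (\<Prod>a\<in>A. F a) = (\<Prod>a\<in>A. poly_totient (F a))"
  using assms
proof (induction A rule: finite_induct)
  case empty
  have "{r \<in> deg_lt 0. coprime r (1 :: 'a poly)} = {0}" by (auto simp: deg_lt_iff)
  then show ?case by (simp add: poly_totient_def)
next
  case (insert x A)
  have "coprime (prod F A) (F x)"
    using insert.hyps insert.prems(1) by (intro coprime_field_poly_prod) auto
  moreover have "prod F A \<noteq> 0" using insert by simp
  ultimately show ?case using insert by (simp add: poly_totient_mult coprime_commute)
qed

subsection \<open>Polynomials in a matrix\<close>

lemma mat_mult_assoc:
  "dim_col A = dim_row B \<Longrightarrow> dim_col B = dim_row C \<Longrightarrow> (A * B) * C = A * (B * C)"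
  by (rule assoc_mult_mat[of A "dim_row A" "dim_col A" B "dim_col B" C "dim_col C"]) auto

lemma mat_vec_assoc:
  "dim_col A = dim_row B \<Longrightarrow> dim_col B = dim_vec v \<Longrightarrow> (A * B) *\<^sub>v v = A *\<^sub>v (B *\<^sub>v v)"
  by (rule assoc_mult_mat_vec[of A "dim_row A" "dim_col A" B "dim_col B" v]) (auto intro: carrier_vecI)

lemma smult_smult_assoc_mat: "a \<cdot>\<^sub>m (b \<cdot>\<^sub>m A) = (a * b :: 'a::semigroup_mult) \<cdot>\<^sub>m A"
  by (auto intro!: eq_matI simp: mult.assoc)

lemma one_smult_mat: "(1 :: 'a::monoid_mult) \<cdot>\<^sub>m A = A"
  by (auto intro!: eq_matI)

lemma add_mat_interchange:
  fixes U V W Z :: "'a::comm_monoid_add mat"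
  assumes "U \<in> carrier_mat n k" "V \<in> carrier_mat n k" "W \<in> carrier_mat n k" "Z \<in> carrier_mat n k"
  shows "(U + V) + (W + Z) = (U + W) + (V + Z)"
  using assms by (auto intro!: eq_matI simp: add_ac)

lemma mat_inverse_exists:
  fixes A :: "'a::field mat"
  assumes "A \<in> carrier_mat n n" "det A \<noteq> 0"
  obtains B where "B \<in> carrier_mat n n" "A * B = 1\<^sub>m n" "B * A = 1\<^sub>m n"
proof -
  define B where "B = inverse (det A) \<cdot>\<^sub>m adj_mat A"
  note adj = adj_mat[OF assms(1)]
  have "B \<in> carrier_mat n n" using adj(1) unfolding B_def by simp
  moreover have "A * B = 1\<^sub>m n" unfolding B_def using adj assms
    by (simp add: mult_smult_distrib[OF assms(1) adj(1)] smult_smult_assoc_mat one_smult_mat)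
  moreover have "B * A = 1\<^sub>m n" unfolding B_def using adj assms
    by (simp add: mult_smult_assoc_mat[OF adj(1) assms(1)] smult_smult_assoc_mat one_smult_mat)
  ultimately show ?thesis using that by blast
qed

lemma det_nonzero_if_left_inverse:
  fixes A B :: "'a::field mat"
  assumes "A \<in> carrier_mat n n" "B \<in> carrier_mat n n" "B * A = 1\<^sub>m n"
  shows "det A \<noteq> 0"
proof -
  have "det B * det A = 1" using assms by (simp flip: det_mult)
  then show ?thesis by auto
qed

lemma mat_eq_if_eq_on_vecs:
  fixes A B :: "'a::comm_ring_1 mat"
  assumes A: "A \<in> carrier_mat n n" and B: "B \<in> carrier_mat n n"
    and eq: "\<And>v. v \<in> carrier_vec n \<Longrightarrow> A *\<^sub>v v = B *\<^sub>v v"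
  shows "A = B"
proof (rule eq_matI)
  fix i j assume ij: "i < dim_row B" "j < dim_col B"
  have "(A *\<^sub>v unit_vec n j) $ i = (B *\<^sub>v unit_vec n j) $ i" using eq by simp
  then show "A $$ (i, j) = B $$ (i, j)" using ij A B by simp
qed (use A B in auto)

text \<open>Horner evaluation of \<open>p\<close> at \<open>X\<close>. The size of the identity and
  zero matrices is read off from \<open>X\<close>, since the type does not carry it.\<close>

definition mat_poly :: "'a::comm_ring_1 poly \<Rightarrow> 'a mat \<Rightarrow> 'a mat" where
  "mat_poly p X = fold_coeffs (\<lambda>a B. a \<cdot>\<^sub>m 1\<^sub>m (dim_row X) + X * B) p (0\<^sub>m (dim_row X) (dim_row X))"

lemma mat_poly_0 [simp]: "mat_poly 0 X = 0\<^sub>m (dim_row X) (dim_row X)"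
  by (simp add: mat_poly_def)

lemma mat_poly_pCons:
  assumes "X \<in> carrier_mat n n"
  shows "mat_poly (pCons a p) X = a \<cdot>\<^sub>m 1\<^sub>m n + X * mat_poly p X"
proof (cases "a = 0 \<and> p = 0")
  case True
  then show ?thesis using assms by (auto intro!: eq_matI)
next
  case False
  then show ?thesis using assms
    by (auto simp: mat_poly_def fold_coeffs_pCons_not_0_0_eq fold_coeffs_pCons_coeff_not_0_eq)
qed

lemma mat_poly_carrier [simp]:
  assumes "X \<in> carrier_mat n n" shows "mat_poly p X \<in> carrier_mat n n"
  using assms by (induction p) (auto simp: mat_poly_pCons)

lemma mat_poly_dim [simp]:
  assumes "X \<in> carrier_mat n n" shows "dim_row (mat_poly p X) = n" "dim_col (mat_poly p X) = n"
  using mat_poly_carrier[OF assms] by auto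

lemma mat_poly_const:
  assumes "X \<in> carrier_mat n n" shows "mat_poly [:a:] X = a \<cdot>\<^sub>m 1\<^sub>m n"
  using assms by (auto simp: mat_poly_pCons intro!: eq_matI)

lemma mat_poly_1 [simp]:
  assumes "X \<in> carrier_mat n n" shows "mat_poly 1 X = 1\<^sub>m n"
  using mat_poly_const[OF assms, of 1] unfolding one_pCons[symmetric] by (simp add: one_smult_mat)

lemma mat_poly_var [simp]:
  assumes "X \<in> carrier_mat n n" shows "mat_poly [:0, 1:] X = X"
proof -
  have "mat_poly [:0, 1:] X = 0 \<cdot>\<^sub>m 1\<^sub>m n + X * (1 \<cdot>\<^sub>m 1\<^sub>m n)"
    unfolding mat_poly_pCons[OF assms, of 0] mat_poly_const[OF assms, of 1] ..
  also have "\<dots> = 0 \<cdot>\<^sub>m 1\<^sub>m n + X" using assms by (simp add: one_smult_mat)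
  also have "\<dots> = X" by (rule eq_matI) (use assms in auto)
  finally show ?thesis .
qed

lemma mat_poly_add:
  assumes X: "X \<in> carrier_mat n n"
  shows "mat_poly (p + q) X = mat_poly p X + mat_poly q X"
proof (induction p q rule: poly_induct2)
  case 0 then show ?case using X by (auto intro!: eq_matI)
next
  case (pCons a p b q)
  have "X * (mat_poly p X + mat_poly q X) = X * mat_poly p X + X * mat_poly q X"
    by (rule mult_add_distrib_mat) (use X in auto)
  moreover have "(a + b) \<cdot>\<^sub>m 1\<^sub>m n = a \<cdot>\<^sub>m 1\<^sub>m n + b \<cdot>\<^sub>m (1\<^sub>m n :: 'a mat)"
    by (auto intro!: eq_matI)
  ultimately show ?case using X
    by (simp add: mat_poly_pCons[OF X] pCons.IH add_mat_interchange[of _ n n] mult_carrier_mat[OF X]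
        del: assoc_add_mat)
qed

lemma mat_poly_smult:
  assumes X: "X \<in> carrier_mat n n"
  shows "mat_poly (Polynomial.smult c p) X = c \<cdot>\<^sub>m mat_poly p X"
proof (induction p)
  case (pCons a p)
  have "X * (c \<cdot>\<^sub>m mat_poly p X) = c \<cdot>\<^sub>m (X * mat_poly p X)"
    by (rule mult_smult_distrib) (use X in auto)
  moreover have "c \<cdot>\<^sub>m (U + V) = c \<cdot>\<^sub>m U + c \<cdot>\<^sub>m V"
    if "U \<in> carrier_mat n n" "V \<in> carrier_mat n n" for U V :: "'a mat"
    using that by (auto intro!: eq_matI simp: algebra_simps)
  moreover have "(c * a) \<cdot>\<^sub>m (1\<^sub>m n :: 'a mat) = c \<cdot>\<^sub>m (a \<cdot>\<^sub>m 1\<^sub>m n)" by (auto intro!: eq_matI)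
  ultimately show ?case using X by (simp add: mat_poly_pCons[OF X] pCons.IH mult_carrier_mat[OF X])
qed (use X in \<open>auto intro!: eq_matI\<close>)

lemma mat_poly_uminus:
  assumes X: "X \<in> carrier_mat n n" shows "mat_poly (- p) X = - mat_poly p X"
proof -
  have "mat_poly (- p) X = (- 1) \<cdot>\<^sub>m mat_poly p X"
    using mat_poly_smult[OF X, of "-1" p] by simp
  also have "\<dots> = - mat_poly p X" by (rule eq_matI) auto
  finally show ?thesis .
qed

lemma mat_poly_diff:
  assumes X: "X \<in> carrier_mat n n" shows "mat_poly (p - q) X = mat_poly p X - mat_poly q X"
proof -
  have "mat_poly (p - q) X = mat_poly p X + - mat_poly q X"
    unfolding diff_conv_add_uminus[of p q] mat_poly_add[OF X] mat_poly_uminus[OF X] ..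
  also have "\<dots> = mat_poly p X - mat_poly q X"
    by (rule add_uminus_minus_mat[of _ n n]) (use X in auto)
  finally show ?thesis .
qed

lemma mat_poly_mult:
  assumes X: "X \<in> carrier_mat n n"
  shows "mat_poly (p * q) X = mat_poly p X * mat_poly q X"
proof (induction p)
  case 0 then show ?case using X by (auto intro!: eq_matI)
next
  case (pCons a p)
  have z: "0 \<cdot>\<^sub>m 1\<^sub>m n + U = U" if "U \<in> carrier_mat n n" for U :: "'a mat"
    using that by (auto intro!: eq_matI)
  have "mat_poly (pCons a p * q) X = a \<cdot>\<^sub>m mat_poly q X + X * (mat_poly p X * mat_poly q X)"
    using X by (simp add: mat_poly_add[OF X] mat_poly_smult[OF X] mat_poly_pCons[OF X] pCons.IH
        z mult_carrier_mat[OF X] mult_carrier_mat[OF mat_poly_carrier[OF X]])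
  also have "\<dots> = (a \<cdot>\<^sub>m 1\<^sub>m n + X * mat_poly p X) * mat_poly q X"
    using X by (simp add: add_mult_distrib_mat[of _ n n _ _ n] mult_carrier_mat[OF X] mat_mult_assoc
        mult_smult_assoc_mat[of _ n n _ n])
  finally show ?case by (simp add: mat_poly_pCons[OF X])
qed

lemma mat_poly_power:
  assumes X: "X \<in> carrier_mat n n"
  shows "mat_poly (p ^ k) X = mat_poly p X ^\<^sub>m k"
proof (induction k)
  case (Suc k)
  have "mat_poly (p ^ Suc k) X = mat_poly (p ^ k * p) X" by (simp add: mult.commute)
  then show ?case using Suc by (simp add: mat_poly_mult[OF X])
qed (use X in simp)

lemma mat_poly_pcompose:
  assumes X: "X \<in> carrier_mat n n"
  shows "mat_poly (pcompose p r) X = mat_poly p (mat_poly r X)"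
proof (induction p)
  case (pCons a p)
  show ?case
    unfolding pcompose_pCons mat_poly_add[OF X] mat_poly_mult[OF X] mat_poly_const[OF X]
      mat_poly_pCons[OF mat_poly_carrier[OF X]] pCons.IH ..
qed (use X in simp)

text \<open>Serves with \<open>K\<close> commuting with \<open>A = B\<close>, and with
  \<open>K\<close> the Gram matrix of a form for which \<open>A\<close> is the transposed adjoint of
  \<open>B\<close>.\<close>

lemma mat_poly_intertwine:
  assumes A: "A \<in> carrier_mat n n" and B: "B \<in> carrier_mat n n" and K: "K \<in> carrier_mat n n"
    and eq: "A * K = K * B"
  shows "mat_poly p A * K = K * mat_poly p B"
proof (induction p)
  case 0 then show ?case using assms by (auto intro!: eq_matI)
next
  case (pCons a p)
  have "(a \<cdot>\<^sub>m 1\<^sub>m n + A * mat_poly p A) * K = a \<cdot>\<^sub>m K + A * (mat_poly p A * K)"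
    using assms by (simp add: add_mult_distrib_mat[of _ n n _ _ n] mult_carrier_mat[OF A] mat_mult_assoc
        mult_smult_assoc_mat[of _ n n _ n])
  also have "\<dots> = a \<cdot>\<^sub>m K + (A * K) * mat_poly p B"
    using A B K by (simp add: pCons.IH mat_mult_assoc)
  also have "(A * K) * mat_poly p B = K * (B * mat_poly p B)"
    unfolding eq using A B K by (simp add: mat_mult_assoc)
  also have "a \<cdot>\<^sub>m K + K * (B * mat_poly p B) = K * (a \<cdot>\<^sub>m 1\<^sub>m n + B * mat_poly p B)"
    using A B K by (simp add: mult_add_distrib_mat[of _ n n _ n] mult_smult_distrib[of _ n n _ n]
        mult_carrier_mat[OF B])
  finally show ?case by (simp add: mat_poly_pCons[OF A] mat_poly_pCons[OF B])
qed

lemma mat_poly_transpose: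
  assumes X: "X \<in> carrier_mat n n"
  shows "(mat_poly p X)\<^sup>T = mat_poly p (X\<^sup>T)"
proof (induction p)
  case 0 then show ?case using X by (auto intro!: eq_matI)
next
  case (pCons a p)
  have XT: "X\<^sup>T \<in> carrier_mat n n" using X by simp
  have "(a \<cdot>\<^sub>m 1\<^sub>m n + X * mat_poly p X)\<^sup>T = a \<cdot>\<^sub>m 1\<^sub>m n + (X * mat_poly p X)\<^sup>T"
    using X by (auto intro!: eq_matI)
  also have "(X * mat_poly p X)\<^sup>T = mat_poly p (X\<^sup>T) * X\<^sup>T"
    using X pCons.IH by (simp add: transpose_mult[of _ n n _ n])
  also have "\<dots> = X\<^sup>T * mat_poly p (X\<^sup>T)" by (rule mat_poly_intertwine) (use XT in auto)
  finally show ?case by (simp add: mat_poly_pCons[OF X] mat_poly_pCons[OF XT])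
qed

subsection \<open>The Cayley--Hamilton theorem\<close>

text \<open>The remainder theorem for division by the matrix polynomial x - X, by Horner's scheme.
  It feeds both the Cayley-Hamilton theorem and
  \<open>char_poly_dvd_annihilator_power\<close>.\<close>

lemma char_poly_matrix_division:
  fixes X :: "'a::comm_ring_1 mat"
  assumes X: "X \<in> carrier_mat n n"
  shows "\<exists>B\<in>carrier_mat n n. p \<cdot>\<^sub>m 1\<^sub>m n = char_poly_matrix X * B + map_mat (\<lambda>a. [:a:]) (mat_poly p X)"
proof (induction p)
  case 0
  have "map_mat (\<lambda>a. [:a:]) (mat_poly 0 X) = 0\<^sub>m n n" using X by (auto intro!: eq_matI)
  moreover have "0 \<cdot>\<^sub>m 1\<^sub>m n = (0\<^sub>m n n :: 'a poly mat)" by (auto intro!: eq_matI)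
  ultimately show ?case using X
    by (intro bexI[of _ "0\<^sub>m n n"]) (simp_all add: right_mult_zero_mat[of _ n n])
next
  case (pCons a p)
  let ?Q = "char_poly_matrix X" and ?C = "map_mat (\<lambda>a. [:a:]) :: 'a mat \<Rightarrow> 'a poly mat"
  let ?x = "[:0, 1:] :: 'a poly"
  have Q: "?Q \<in> carrier_mat n n" using X by simp
  from pCons.IH obtain B where B: "B \<in> carrier_mat n n"
    and eq: "p \<cdot>\<^sub>m 1\<^sub>m n = ?Q * B + ?C (mat_poly p X)" by blast
  have P: "?C (mat_poly p X) \<in> carrier_mat n n" and CX: "?C X \<in> carrier_mat n n" using X by auto
  \<comment> \<open>Writing x as (x - X) + X turns the new factor x of the Horner step into a
    multiple of x - X plus a constant term.\<close>
  have xone: "?x \<cdot>\<^sub>m 1\<^sub>m n = ?Q + ?C X"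
    using X by (auto intro!: eq_matI simp: char_poly_matrix_def)
  have "pCons a p \<cdot>\<^sub>m 1\<^sub>m n = ?C (a \<cdot>\<^sub>m 1\<^sub>m n) + ?x \<cdot>\<^sub>m (p \<cdot>\<^sub>m 1\<^sub>m n)"
    by (auto intro!: eq_matI)
  also have "?x \<cdot>\<^sub>m (p \<cdot>\<^sub>m 1\<^sub>m n) = ?x \<cdot>\<^sub>m (?Q * B) + ?x \<cdot>\<^sub>m ?C (mat_poly p X)"
  proof -
    have "?x \<cdot>\<^sub>m (U + V) = ?x \<cdot>\<^sub>m U + ?x \<cdot>\<^sub>m V"
      if "U \<in> carrier_mat n n" "V \<in> carrier_mat n n" for U V :: "'a poly mat"
      using that by (auto intro!: eq_matI)
    then show ?thesis unfolding eq using P mult_carrier_mat[OF Q B] by blast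
  qed
  also have "?x \<cdot>\<^sub>m (?Q * B) = ?Q * (?x \<cdot>\<^sub>m B)"
    using mult_smult_distrib[OF Q B] by simp
  also have "?x \<cdot>\<^sub>m ?C (mat_poly p X) = (?x \<cdot>\<^sub>m 1\<^sub>m n) * ?C (mat_poly p X)"
    using mult_smult_assoc_mat[OF one_carrier_mat P] P by simp
  also have "\<dots> = ?Q * ?C (mat_poly p X) + ?C X * ?C (mat_poly p X)"
    unfolding xone by (rule add_mult_distrib_mat[OF Q CX P])
  also have "?C X * ?C (mat_poly p X) = ?C (X * mat_poly p X)"
    using map_poly_mult(1)[OF X mat_poly_carrier[OF X]] by simp
  also have "?C (a \<cdot>\<^sub>m 1\<^sub>m n) + (?Q * (?x \<cdot>\<^sub>m B) + (?Q * ?C (mat_poly p X) + ?C (X * mat_poly p X)))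
    = ?Q * (?x \<cdot>\<^sub>m B + ?C (mat_poly p X)) + ?C (a \<cdot>\<^sub>m 1\<^sub>m n + X * mat_poly p X)"
  proof -
    have 1: "?Q * (?x \<cdot>\<^sub>m B + ?C (mat_poly p X)) = ?Q * (?x \<cdot>\<^sub>m B) + ?Q * ?C (mat_poly p X)"
      by (rule mult_add_distrib_mat[OF Q _ P]) (use B in simp)
    have 2: "?C (U + V) = ?C U + ?C V" if "U \<in> carrier_mat n n" "V \<in> carrier_mat n n" for U V
      using that by (auto intro!: eq_matI)
    have 3: "U + (V + (W + Z)) = (V + W) + (U + Z)"
      if "U \<in> carrier_mat n n" "V \<in> carrier_mat n n" "W \<in> carrier_mat n n" "Z \<in> carrier_mat n n"
      for U V W Z :: "'a poly mat" using that by (auto intro!: eq_matI)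
    have XP: "X * mat_poly p X \<in> carrier_mat n n" using X by (simp add: mult_carrier_mat[OF X])
    have xB: "?x \<cdot>\<^sub>m B \<in> carrier_mat n n" using B by simp
    have CC: "?C V \<in> carrier_mat n n" if "V \<in> carrier_mat n n" for V using that by simp
    have a1: "a \<cdot>\<^sub>m 1\<^sub>m n \<in> carrier_mat n n" by simp
    show ?thesis unfolding 1 2[OF a1 XP]
      by (rule 3[OF CC[OF a1] mult_carrier_mat[OF Q xB] mult_carrier_mat[OF Q P] CC[OF XP]])
  qed
  finally show ?case using X B P
    by (intro bexI[of _ "?x \<cdot>\<^sub>m B + ?C (mat_poly p X)"]) (auto simp: mat_poly_pCons[OF X])
qed

text \<open>Since x - X is monic in x, a nonzero \<open>D\<close> would make the product
  nonconstant. Coefficientwise: that of x^k in \<open>D\<close> is \<open>X\<close> times that of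
  x^(k+1), so vanishing propagates down from the top.\<close>

lemma char_poly_matrix_mult_const_imp_zero:
  fixes X N :: "'a::comm_ring_1 mat"
  assumes X: "X \<in> carrier_mat n n" and D: "D \<in> carrier_mat n n" and N: "N \<in> carrier_mat n n"
    and eq: "char_poly_matrix X * D = map_mat (\<lambda>a. [:a:]) N"
  shows "N = 0\<^sub>m n n"
proof -
  have entry: "[:N $$ (i, j):] = [:0, 1:] * D $$ (i, j) - (\<Sum>l<n. [:X $$ (i, l):] * D $$ (l, j))"
    if ij: "i < n" "j < n" for i j
  proof -
    have "[:N $$ (i, j):] = (char_poly_matrix X * D) $$ (i, j)" using eq N ij by simp
    also have "\<dots> = (\<Sum>l<n. char_poly_matrix X $$ (i, l) * D $$ (l, j))"
      using carrier_matD[OF char_poly_matrix_closed[OF X]] D ij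
      by (simp add: scalar_prod_def atLeast0LessThan)
    also have "\<dots> = (\<Sum>l<n. (if i = l then [:0, 1:] * D $$ (l, j) else 0) - [:X $$ (i, l):] * D $$ (l, j))"
      by (rule sum.cong) (use X D ij in \<open>auto simp: char_poly_matrix_def algebra_simps\<close>)
    also have "\<dots> = [:0, 1:] * D $$ (i, j) - (\<Sum>l<n. [:X $$ (i, l):] * D $$ (l, j))"
      using ij by (simp add: sum_subtractf)
    finally show ?thesis .
  qed
  have step: "coeff (D $$ (i, j)) k = (\<Sum>l<n. X $$ (i, l) * coeff (D $$ (l, j)) (Suc k))"
    if "i < n" "j < n" for i j k
    using arg_cong[OF entry[OF that], of "\<lambda>p. coeff p (Suc k)"] by (simp add: coeff_sum)
  \<comment> \<open>Larger than the degree of every entry of \<open>D\<close>.\<close>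
  define K where "K = Suc (Max ((\<lambda>(i, j). degree (D $$ (i, j))) ` ({..<n} \<times> {..<n})))"
  have top: "coeff (D $$ (i, j)) k = 0" if "i < n" "j < n" "k \<ge> K" for i j k
  proof -
    have "degree (D $$ (i, j)) \<in> (\<lambda>(i, j). degree (D $$ (i, j))) ` ({..<n} \<times> {..<n})" using that by force
    then have "degree (D $$ (i, j)) < K" unfolding K_def by (simp add: le_imp_less_Suc)
    then show ?thesis using that by (intro coeff_eq_0) simp
  qed
  \<comment> \<open>Descent from index K. Once \<open>t\<close> passes K the truncated difference
    stays at 0 and the claim merely repeats itself.\<close>
  have bot: "\<forall>i<n. \<forall>j<n. coeff (D $$ (i, j)) (K - t) = 0" for t
  proof (induction t)
    case (Suc t)
    show ?case
    proof (cases "t < K")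
      case True
      then have "Suc (K - Suc t) = K - t" by simp
      then show ?thesis using Suc step[of _ _ "K - Suc t"] by (simp del: diff_Suc_eq_diff_pred)
    next
      case False
      then have "K - Suc t = K - t" by simp
      then show ?thesis using Suc by (simp only: simp_thms)
    qed
  qed (use top in simp)
  have "coeff (D $$ (i, j)) k = 0" if "i < n" "j < n" for i j k
  proof (cases "k \<ge> K")
    case False
    then have "K - (K - k) = k" by simp
    then show ?thesis using bot[of "K - k"] that by simp
  qed (use top that in simp)
  then have "D $$ (i, j) = 0" if "i < n" "j < n" for i j using that by (intro poly_eqI) simp
  then have "N $$ (i, j) = 0" if "i < n" "j < n" for i j using entry[OF that] that by simp
  then show ?thesis using N by (auto intro!: eq_matI)
qed

text \<open>The adjugate divides the characteristic polynomial by x - X without remainder.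
  Subtracting the division with remainder shows the constant remainder to be a multiple of x - X,
  hence 0.\<close>

theorem cayley_hamilton_mat:
  fixes X :: "'a::comm_ring_1 mat"
  assumes X: "X \<in> carrier_mat n n"
  shows "mat_poly (char_poly X) X = 0\<^sub>m n n"
proof -
  let ?Q = "char_poly_matrix X" and ?C = "map_mat (\<lambda>a. [:a:]) :: 'a mat \<Rightarrow> 'a poly mat"
  have Q: "?Q \<in> carrier_mat n n" using X by simp
  obtain B where B: "B \<in> carrier_mat n n"
    and eq: "char_poly X \<cdot>\<^sub>m 1\<^sub>m n = ?Q * B + ?C (mat_poly (char_poly X) X)"
    using char_poly_matrix_division[OF X] by blast
  have adj: "adj_mat ?Q \<in> carrier_mat n n" "?Q * adj_mat ?Q = char_poly X \<cdot>\<^sub>m 1\<^sub>m n"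
    using adj_mat[OF Q] by (simp_all add: char_poly_def)
  have "?Q * (adj_mat ?Q - B) = ?Q * adj_mat ?Q - ?Q * B"
    by (rule mult_minus_distrib_mat[OF Q adj(1) B])
  also have "\<dots> = ?C (mat_poly (char_poly X) X)"
  proof -
    have "(U + V) - U = V" if "U \<in> carrier_mat n n" "V \<in> carrier_mat n n" for U V :: "'a poly mat"
      using that by (auto intro!: eq_matI)
    moreover have "?C (mat_poly (char_poly X) X) \<in> carrier_mat n n" using X by simp
    ultimately show ?thesis unfolding adj(2) eq using mult_carrier_mat[OF Q B] by blast
  qed
  finally show ?thesis
    by (rule char_poly_matrix_mult_const_imp_zero[rotated 3]) (use X B adj in auto)
qed

text \<open>Take determinants in p = (x - X) B. This replaces the comparison of the irreducible
  factors of the minimal and the characteristic polynomial.\<close>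

lemma char_poly_dvd_annihilator_power:
  fixes X :: "'a::comm_ring_1 mat"
  assumes X: "X \<in> carrier_mat n n" and p: "mat_poly p X = 0\<^sub>m n n"
  shows "char_poly X dvd p ^ n"
proof -
  let ?Q = "char_poly_matrix X"
  have Q: "?Q \<in> carrier_mat n n" using X by simp
  obtain B where B: "B \<in> carrier_mat n n"
    and eq: "p \<cdot>\<^sub>m 1\<^sub>m n = ?Q * B + map_mat (\<lambda>a. [:a:]) (mat_poly p X)"
    using char_poly_matrix_division[OF X] by blast
  have "map_mat (\<lambda>a. [:a:]) (0\<^sub>m n n) = (0\<^sub>m n n :: 'a poly mat)" by (auto intro!: eq_matI)
  then have "p \<cdot>\<^sub>m 1\<^sub>m n = ?Q * B" unfolding eq p using mult_carrier_mat[OF Q B] by simp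
  then have "det (p \<cdot>\<^sub>m 1\<^sub>m n) = det ?Q * det B" using det_mult[OF Q B] by simp
  then show ?thesis by (simp add: char_poly_def)
qed

subsection \<open>Cyclic vectors\<close>

lemma mult_mat_zero_vec [simp]:
  assumes "A \<in> carrier_mat nr nc" shows "A *\<^sub>v 0\<^sub>v nc = 0\<^sub>v nr"
  by (rule eq_vecI) (use assms in auto)

lemma mult_zero_mat_vec [simp]:
  assumes "v \<in> carrier_vec nc" shows "0\<^sub>m nr nc *\<^sub>v v = 0\<^sub>v nr"
  by (rule eq_vecI) (use assms in auto)

lemma mat_poly_act_mult:
  assumes "X \<in> carrier_mat n n" "v \<in> carrier_vec n"
  shows "mat_poly (p * q) X *\<^sub>v v = mat_poly p X *\<^sub>v (mat_poly q X *\<^sub>v v)"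
  using assms by (simp add: mat_poly_mult[OF assms(1)] mat_vec_assoc)

lemma mat_poly_act_add:
  assumes "X \<in> carrier_mat n n" "v \<in> carrier_vec n"
  shows "mat_poly (p + q) X *\<^sub>v v = mat_poly p X *\<^sub>v v + mat_poly q X *\<^sub>v v"
  unfolding mat_poly_add[OF assms(1)] by (rule add_mult_distrib_mat_vec) (use assms in auto)

lemma mat_poly_act_carrier [simp]:
  assumes "X \<in> carrier_mat n n" "v \<in> carrier_vec n"
  shows "mat_poly p X *\<^sub>v v \<in> carrier_vec n"
  by (rule mult_mat_vec_carrier[of _ n n]) (use assms in auto)

lemma mat_poly_act_dvd:
  assumes X: "X \<in> carrier_mat n n" "v \<in> carrier_vec n"
    and "p dvd r" "mat_poly p X *\<^sub>v v = 0\<^sub>v n"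
  shows "mat_poly r X *\<^sub>v v = 0\<^sub>v n"
proof -
  obtain k where "r = k * p" using assms(3) by (metis dvd_def mult.commute)
  then show ?thesis using assms mat_poly_act_mult[OF X, of k p] mult_mat_zero_vec[OF mat_poly_carrier[OF X(1)]]
    by simp
qed

lemma mat_poly_act_coprime:
  fixes X :: "'a::field mat"
  assumes X: "X \<in> carrier_mat n n" "v \<in> carrier_vec n" and "coprime p r"
    and "mat_poly p X *\<^sub>v v = 0\<^sub>v n" "mat_poly r X *\<^sub>v v = 0\<^sub>v n"
  shows "v = 0\<^sub>v n"
proof -
  obtain s t where st: "s * p + t * r = 1" using assms(3) coprime_field_poly_iff_bezout by blast
  have "mat_poly (s * p) X *\<^sub>v v = 0\<^sub>v n" "mat_poly (t * r) X *\<^sub>v v = 0\<^sub>v n"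
    using assms(4,5) mat_poly_act_dvd[OF X] by (meson dvd_triv_right)+
  then have "mat_poly (s * p + t * r) X *\<^sub>v v = 0\<^sub>v n" unfolding mat_poly_act_add[OF X] by simp
  then show ?thesis using X unfolding st by simp
qed

text \<open>If p(X) were invertible, the cofactor k of \<open>p\<close> would annihilate
  \<open>X\<close>; then \<open>p\<close> would divide a power of k, against separability.\<close>

lemma irreducible_factor_annihilates_vec:
  fixes X :: "'a::field mat"
  assumes X: "X \<in> carrier_mat n n"
    and sep: "coprime (char_poly X) (pderiv (char_poly X))"
    and p: "irreducible p" "p dvd char_poly X"
  obtains w where "w \<in> carrier_vec n" "w \<noteq> 0\<^sub>v n" "mat_poly p X *\<^sub>v w = 0\<^sub>v n"
proof -
  have "det (mat_poly p X) = 0"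
  proof (rule ccontr)
    assume "det (mat_poly p X) \<noteq> 0"
    then obtain B where B: "B \<in> carrier_mat n n" "B * mat_poly p X = 1\<^sub>m n"
      using mat_inverse_exists[OF mat_poly_carrier[OF X]] by blast
    obtain k where k: "char_poly X = p * k" using p(2) by (elim dvdE)
    have "mat_poly p X * mat_poly k X = 0\<^sub>m n n"
      using cayley_hamilton_mat[OF X] unfolding k mat_poly_mult[OF X] .
    then have "B * (mat_poly p X * mat_poly k X) = 0\<^sub>m n n" using B(1) by simp
    then have "(B * mat_poly p X) * mat_poly k X = 0\<^sub>m n n" using B(1) X by (simp add: mat_mult_assoc)
    then have "mat_poly k X = 0\<^sub>m n n" unfolding B(2) using X by simp
    then have "char_poly X dvd k ^ n" by (rule char_poly_dvd_annihilator_power[OF X])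
    then have "p dvd k ^ n" using p(2) dvd_trans by blast
    then have "p dvd k" using p(1) irreducible_field_poly_dvd_power by blast
    moreover have "coprime p k" using sep unfolding k separable_poly_mult_iff by blast
    ultimately have "is_unit p" using coprime_common_divisor[of p k p] by simp
    then show False using irreducible_not_unit[OF p(1)] by blast
  qed
  then show ?thesis using that det_0_iff_vec_prod_zero_field[OF mat_poly_carrier[OF X]] by blast
qed

text \<open>Vectors with coprime annihilators add up to one whose annihilator is the product; the
  divisor \<open>d\<close> is built up one irreducible factor at a time.\<close>

lemma exists_vec_with_annihilator:
  fixes X :: "'a::field mat"
  assumes X: "X \<in> carrier_mat n n"
    and sep: "coprime (char_poly X) (pderiv (char_poly X))"
    and d: "d dvd char_poly X"
  shows "\<exists>v\<in>carrier_vec n. \<forall>r. mat_poly r X *\<^sub>v v = 0\<^sub>v n \<longleftrightarrow> d dvd r"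
  using d
proof (induction "degree d" arbitrary: d rule: less_induct)
  case less
  have "char_poly X \<noteq> 0" using degree_monic_char_poly[OF X] by auto
  then have d0: "d \<noteq> 0" using less.prems by auto
  show ?case
  proof (cases "degree d = 0")
    case True
    then have "is_unit d" using d0 by (simp add: is_unit_iff_degree)
    then have "d dvd r" for r using unit_imp_dvd by blast
    then show ?thesis using X by (intro bexI[of _ "0\<^sub>v n"]) (simp_all add: mult_mat_zero_vec[of _ n n])
  next
    case False
    then obtain p where p: "monic p" "irreducible p" "p dvd d"
      using monic_irreducible_factor_exists by blast
    then obtain e where e: "d = p * e" by (elim dvdE)
    have "degree p > 0" using p(2) by (rule irreducible_field_poly_degree_pos)
    moreover have "degree d = degree p + degree e" using d0 unfolding e by (simp add: degree_mult_eq)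
    ultimately have "degree e < degree d" by simp
    moreover have "e dvd char_poly X" using less.prems unfolding e by (rule dvd_mult_right)
    ultimately obtain v where v: "v \<in> carrier_vec n"
      and va: "\<And>r. mat_poly r X *\<^sub>v v = 0\<^sub>v n \<longleftrightarrow> e dvd r" using less.hyps by blast
    have pc: "p dvd char_poly X" using less.prems p(3) dvd_trans by blast
    obtain w where w: "w \<in> carrier_vec n" "w \<noteq> 0\<^sub>v n" "mat_poly p X *\<^sub>v w = 0\<^sub>v n"
      using irreducible_factor_annihilates_vec[OF X sep p(2) pc] by blast
    \<comment> \<open>A nonzero vector killed by the irreducible \<open>p\<close> has exactly the
      multiples of \<open>p\<close> as annihilators.\<close>
    have wa: "mat_poly r X *\<^sub>v w = 0\<^sub>v n \<longleftrightarrow> p dvd r" for r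
    proof
      assume r: "mat_poly r X *\<^sub>v w = 0\<^sub>v n"
      show "p dvd r"
      proof (rule ccontr)
        assume "\<not> p dvd r"
        then have "coprime p r" using p(2) irreducible_field_poly_coprime by blast
        then show False using mat_poly_act_coprime[OF X w(1) _ w(3) r] w(2) by blast
      qed
    qed (use mat_poly_act_dvd[OF X w(1) _ w(3)] in blast)
    have "coprime d (pderiv d)" using separable_poly_dvd[OF sep less.prems] .
    then have cop: "coprime p e" unfolding e separable_poly_mult_iff by blast
    have dist: "mat_poly r X *\<^sub>v (v + w) = mat_poly r X *\<^sub>v v + mat_poly r X *\<^sub>v w" for r
      by (rule mult_add_distrib_mat_vec) (use X v w in auto)
    have vw: "v + w \<in> carrier_vec n" using v w by simp
    have "mat_poly r X *\<^sub>v (v + w) = 0\<^sub>v n \<longleftrightarrow> d dvd r" for r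
    proof
      assume "d dvd r"
      then have "e dvd r" "p dvd r" unfolding e using dvd_mult_left dvd_mult_right by blast+
      then have "mat_poly r X *\<^sub>v v = 0\<^sub>v n" "mat_poly r X *\<^sub>v w = 0\<^sub>v n" using va wa by blast+
      then show "mat_poly r X *\<^sub>v (v + w) = 0\<^sub>v n" unfolding dist by simp
    next
      assume r: "mat_poly r X *\<^sub>v (v + w) = 0\<^sub>v n"
      have "mat_poly (e * r) X *\<^sub>v (v + w) = 0\<^sub>v n" "mat_poly (p * r) X *\<^sub>v (v + w) = 0\<^sub>v n"
        using mat_poly_act_dvd[OF X vw _ r] by simp_all
      moreover have "mat_poly (e * r) X *\<^sub>v v = 0\<^sub>v n" "mat_poly (p * r) X *\<^sub>v w = 0\<^sub>v n"
        using va[of "e * r"] wa[of "p * r"] by simp_all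
      moreover have "mat_poly (e * r) X *\<^sub>v w \<in> carrier_vec n" "mat_poly (p * r) X *\<^sub>v v \<in> carrier_vec n"
        using X v w by simp_all
      ultimately have "mat_poly (e * r) X *\<^sub>v w = 0\<^sub>v n" "mat_poly (p * r) X *\<^sub>v v = 0\<^sub>v n"
        unfolding dist by simp_all
      then have dv: "p dvd e * r" "e dvd p * r" using va wa by blast+
      have "coprime e p" using cop by (simp add: coprime_commute)
      then have "p dvd r" "e dvd r" using cop dv coprime_field_poly_dvd_mult by blast+
      then show "d dvd r" unfolding e using cop coprime_field_poly_divides_mult by blast
    qed
    then show ?thesis using vw by blast
  qed
qed

text \<open>Cyclicity is encoded by the annihilator: r -> r(X) v embeds the residues modulo
  \<open>char_poly X\<close>, which for reasons of dimension makes \<open>v\<close> a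
  generator.\<close>

definition cyclic_vec :: "'a::field mat \<Rightarrow> 'a vec \<Rightarrow> bool" where
  "cyclic_vec X v \<longleftrightarrow> v \<in> carrier_vec (dim_row X) \<and>
     (\<forall>r. mat_poly r X *\<^sub>v v = 0\<^sub>v (dim_row X) \<longleftrightarrow> char_poly X dvd r)"

lemma cyclic_vecD:
  assumes "X \<in> carrier_mat n n" "cyclic_vec X v"
  shows "v \<in> carrier_vec n" "mat_poly r X *\<^sub>v v = 0\<^sub>v n \<longleftrightarrow> char_poly X dvd r"
  using assms unfolding cyclic_vec_def by auto

lemma separable_imp_cyclic_vec:
  fixes X :: "'a::field mat"
  assumes X: "X \<in> carrier_mat n n" and "coprime (char_poly X) (pderiv (char_poly X))"
  obtains v where "cyclic_vec X v"
proof -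
  obtain v where "v \<in> carrier_vec n" "\<forall>r. mat_poly r X *\<^sub>v v = 0\<^sub>v n \<longleftrightarrow> char_poly X dvd r"
    using exists_vec_with_annihilator[OF assms dvd_refl] by blast
  then show ?thesis using that X unfolding cyclic_vec_def by auto
qed

lemma cyclic_vec_eq_iff:
  assumes X: "X \<in> carrier_mat n n" "cyclic_vec X v"
  shows "mat_poly r X *\<^sub>v v = mat_poly s X *\<^sub>v v \<longleftrightarrow> char_poly X dvd r - s"
proof -
  note v = cyclic_vecD(1)[OF X]
  have "mat_poly (r - s) X *\<^sub>v v = mat_poly r X *\<^sub>v v - mat_poly s X *\<^sub>v v"
    unfolding mat_poly_diff[OF X(1)] by (rule minus_mult_distrib_mat_vec) (use X v in auto)
  moreover have "a - b = 0\<^sub>v n \<longleftrightarrow> a = b" if "a \<in> carrier_vec n" "b \<in> carrier_vec n" for a b :: "'a vec"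
  proof
    assume eq: "a - b = 0\<^sub>v n"
    show "a = b"
    proof (rule eq_vecI)
      fix i assume "i < dim_vec b"
      then have i: "i < n" using that by simp
      have "(a - b) $ i = 0" using eq i by simp
      then show "a $ i = b $ i" using that i by simp
    qed (use that in simp)
  qed (use that in simp)
  ultimately show ?thesis using cyclic_vecD(2)[OF X, of "r - s"] X v by simp
qed

section \<open>Coordinates with respect to a cyclic vector\<close>

lemma poly_of_coeff_vec:
  fixes c :: "'a::field vec"
  assumes "c \<in> carrier_vec n"
  obtains r where "r \<in> deg_lt n" "c = vec n (coeff r)"
proof -
  define r where "r = (\<Sum>i<n. monom (c $ i) i)"
  have co: "coeff r k = (if k < n then c $ k else 0)" for k unfolding r_def by (simp add: coeff_sum)
  have "r \<in> deg_lt n" unfolding deg_lt_def using co by simp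
  moreover have "c = vec n (coeff r)" by (rule eq_vecI) (use assms co in auto)
  ultimately show ?thesis using that by blast
qed

lemma finite_card_carrier_vec:
  "finite (carrier_vec n :: 'a::{finite,field} vec set)"
  "card (carrier_vec n :: 'a vec set) = card (UNIV :: 'a set) ^ n"
proof -
  have img: "carrier_vec n = (\<lambda>r. vec n (coeff r)) ` (deg_lt n :: 'a poly set)"
    using poly_of_coeff_vec by (auto simp: image_iff) blast
  have inj: "inj_on (\<lambda>r. vec n (coeff r)) (deg_lt n :: 'a poly set)"
  proof (rule inj_onI)
    fix r s :: "'a poly" assume rs: "r \<in> deg_lt n" "s \<in> deg_lt n" "vec n (coeff r) = vec n (coeff s)"
    show "r = s"
    proof (rule poly_eqI)
      fix i show "coeff r i = coeff s i"
      proof (cases "i < n")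
        case True
        then show ?thesis using arg_cong[OF rs(3), of "\<lambda>v. v $ i"] by simp
      next
        case False
        then show ?thesis using rs(1,2) unfolding deg_lt_def by simp
      qed
    qed
  qed
  show "finite (carrier_vec n :: 'a vec set)" unfolding img by simp
  show "card (carrier_vec n :: 'a vec set) = card (UNIV :: 'a set) ^ n"
    unfolding img card_image[OF inj] by (rule card_deg_lt)
qed

text \<open>The map r -> r(X) v is injective on remainders, and both sides have q^n
  elements.\<close>

lemma cyclic_vec_generates:
  fixes X :: "'a::{finite,field} mat"
  assumes X: "X \<in> carrier_mat n n" "cyclic_vec X v" and u: "u \<in> carrier_vec n"
  obtains r where "r \<in> deg_lt n" "u = mat_poly r X *\<^sub>v v"
proof -
  note v = cyclic_vecD(1)[OF X]
  have deg: "degree (char_poly X) = n" using degree_monic_char_poly[OF X(1)] by simp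
  define F where "F = (\<lambda>r. mat_poly r X *\<^sub>v v)"
  have inj: "inj_on F (deg_lt n)"
  proof (rule inj_onI)
    fix r s assume rs: "r \<in> deg_lt n" "s \<in> deg_lt n" "F r = F s"
    then have "char_poly X dvd r - s" unfolding F_def using cyclic_vec_eq_iff[OF X] by blast
    then show "r = s" using deg_lt_congD[of r "char_poly X" s] rs deg by simp
  qed
  have "F ` deg_lt n = carrier_vec n"
  proof (rule card_subset_eq)
    show "F ` deg_lt n \<subseteq> carrier_vec n" unfolding F_def using X v by auto
    show "card (F ` deg_lt n) = card (carrier_vec n :: 'a vec set)"
      by (simp add: card_image[OF inj] card_deg_lt finite_card_carrier_vec(2))
  qed (rule finite_card_carrier_vec)
  then show ?thesis using that u unfolding F_def by blast
qed

text \<open>A matrix commuting with \<open>X\<close> is determined by its value at the generator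
  \<open>v\<close>, and that value is r(X) v for some r.\<close>

lemma commutant_cyclic:
  fixes X :: "'a::{finite,field} mat"
  assumes X: "X \<in> carrier_mat n n" "cyclic_vec X v"
    and Z: "Z \<in> carrier_mat n n" "Z * X = X * Z"
  obtains r where "r \<in> deg_lt n" "Z = mat_poly r X"
proof -
  note v = cyclic_vecD(1)[OF X]
  have "Z *\<^sub>v v \<in> carrier_vec n" using Z v by simp
  then obtain r where r: "r \<in> deg_lt n" "Z *\<^sub>v v = mat_poly r X *\<^sub>v v"
    using cyclic_vec_generates[OF X] by blast
  have "Z = mat_poly r X"
  proof (rule mat_eq_if_eq_on_vecs[OF Z(1) mat_poly_carrier[OF X(1)]])
    fix u :: "'a vec" assume "u \<in> carrier_vec n"
    then obtain s where s: "u = mat_poly s X *\<^sub>v v" using cyclic_vec_generates[OF X] by blast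
    have "Z *\<^sub>v u = (Z * mat_poly s X) *\<^sub>v v" unfolding s using X Z v by (simp add: mat_vec_assoc)
    also have "Z * mat_poly s X = mat_poly s X * Z"
      using mat_poly_intertwine[OF X(1) X(1) Z(1) Z(2)[symmetric]] by simp
    also have "\<dots> *\<^sub>v v = mat_poly s X *\<^sub>v (mat_poly r X *\<^sub>v v)"
      using X Z v r by (simp add: mat_vec_assoc)
    also have "\<dots> = mat_poly r X *\<^sub>v u"
      unfolding s mat_poly_act_mult[OF X(1) v, symmetric] by (simp add: mult.commute)
    finally show "Z *\<^sub>v u = mat_poly r X *\<^sub>v u" .
  qed
  then show ?thesis using that r by blast
qed

text \<open>Bezout gives the inverse. Conversely, if \<open>r\<close> shares the factor a with the
  characteristic polynomial and k is the cofactor of a, then r(X) kills the nonzero vector k(X)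
  v.\<close>

lemma mat_poly_invertible_iff:
  fixes X :: "'a::field mat"
  assumes X: "X \<in> carrier_mat n n" "cyclic_vec X v"
  shows "det (mat_poly r X) \<noteq> 0 \<longleftrightarrow> coprime r (char_poly X)"
proof
  assume "coprime r (char_poly X)"
  then obtain s t where st: "s * r + t * char_poly X = 1" using coprime_field_poly_iff_bezout by blast
  have "mat_poly (s * r + t * char_poly X) X = mat_poly s X * mat_poly r X"
    using X mult_carrier_mat[OF mat_poly_carrier[OF X(1)] mat_poly_carrier[OF X(1)]]
    by (simp add: mat_poly_add[OF X(1)] mat_poly_mult[OF X(1)] cayley_hamilton_mat[OF X(1)])
  then have "mat_poly s X * mat_poly r X = 1\<^sub>m n" unfolding st using X by simp
  then show "det (mat_poly r X) \<noteq> 0"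
    by (rule det_nonzero_if_left_inverse[rotated 2]) (use X in auto)
next
  assume nz: "det (mat_poly r X) \<noteq> 0"
  note v = cyclic_vecD(1)[OF X]
  have f0: "char_poly X \<noteq> 0" using degree_monic_char_poly[OF X(1)] by auto
  show "coprime r (char_poly X)"
  proof (rule ccontr)
    assume "\<not> coprime r (char_poly X)"
    then have "\<not> coprime (char_poly X) r" by (simp add: coprime_commute)
    then obtain a where a: "monic a" "irreducible a" "a dvd char_poly X" "a dvd r"
      using common_irreducible_factor_exists f0 by blast
    obtain k where k: "char_poly X = a * k" using a(3) by (elim dvdE)
    obtain l where l: "r = a * l" using a(4) by (elim dvdE)
    have "\<not> char_poly X dvd k"
    proof
      assume "char_poly X dvd k"
      moreover have "k \<noteq> 0" using f0 k by auto
      ultimately have "degree (char_poly X) \<le> degree k" by (rule dvd_imp_degree_le)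
      then show False using irreducible_field_poly_degree_pos[OF a(2)] f0 unfolding k by (simp add: degree_mult_eq)
    qed
    then have "mat_poly k X *\<^sub>v v \<noteq> 0\<^sub>v n" using cyclic_vecD(2)[OF X] by blast
    moreover have "mat_poly r X *\<^sub>v (mat_poly k X *\<^sub>v v) = 0\<^sub>v n"
    proof -
      have "char_poly X dvd r * k" unfolding k l by simp
      then show ?thesis unfolding mat_poly_act_mult[OF X(1) v, symmetric] cyclic_vecD(2)[OF X] .
    qed
    moreover have "mat_poly k X *\<^sub>v v \<in> carrier_vec n" using X v by simp
    ultimately show False using nz det_0_iff_vec_prod_zero_field[OF mat_poly_carrier[OF X(1)]] by blast
  qed
qed

lemma card_invertible_commutant:
  fixes X :: "'a::{finite,field} mat"
  assumes X: "X \<in> carrier_mat n n" and sep: "coprime (char_poly X) (pderiv (char_poly X))"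
  shows "card {Z \<in> carrier_mat n n. Z * X = X * Z \<and> det Z \<noteq> 0} = poly_totient (char_poly X)"
proof -
  obtain v where v: "cyclic_vec X v" using separable_imp_cyclic_vec[OF assms] by blast
  have deg: "degree (char_poly X) = n" using degree_monic_char_poly[OF X] by simp
  have "{Z \<in> carrier_mat n n. Z * X = X * Z \<and> det Z \<noteq> 0} =
      (\<lambda>r. mat_poly r X) ` {r \<in> deg_lt n. coprime r (char_poly X)}"
  proof (intro equalityI subsetI)
    fix Z assume "Z \<in> {Z \<in> carrier_mat n n. Z * X = X * Z \<and> det Z \<noteq> 0}"
    then have Z: "Z \<in> carrier_mat n n" "Z * X = X * Z" "det Z \<noteq> 0" by auto
    obtain r where "r \<in> deg_lt n" "Z = mat_poly r X" using commutant_cyclic[OF X v Z(1,2)] by blast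
    then show "Z \<in> (\<lambda>r. mat_poly r X) ` {r \<in> deg_lt n. coprime r (char_poly X)}"
      using mat_poly_invertible_iff[OF X v] Z(3) by blast
  next
    fix Z assume "Z \<in> (\<lambda>r. mat_poly r X) ` {r \<in> deg_lt n. coprime r (char_poly X)}"
    then obtain r where "coprime r (char_poly X)" "Z = mat_poly r X" by blast
    moreover have "mat_poly r X * X = X * mat_poly r X"
      by (rule mat_poly_intertwine) (use X in auto)
    ultimately show "Z \<in> {Z \<in> carrier_mat n n. Z * X = X * Z \<and> det Z \<noteq> 0}"
      using X mat_poly_invertible_iff[OF X v] by simp
  qed
  moreover have "inj_on (\<lambda>r. mat_poly r X) {r \<in> deg_lt n. coprime r (char_poly X)}"
  proof (rule inj_onI)
    fix r s assume rs: "r \<in> {r \<in> deg_lt n. coprime r (char_poly X)}"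
      "s \<in> {r \<in> deg_lt n. coprime r (char_poly X)}" "mat_poly r X = mat_poly s X"
    then have "char_poly X dvd r - s" using cyclic_vec_eq_iff[OF X v, of r s] by simp
    then show "r = s" using deg_lt_congD[of r "char_poly X" s] rs deg by simp
  qed
  ultimately show ?thesis unfolding poly_totient_def deg by (simp add: card_image)
qed

text \<open>Columns v, X v, ..., X^(n-1) v: the change of basis from coefficients of remainders to
  vectors.\<close>

definition krylov_mat :: "nat \<Rightarrow> 'a::comm_ring_1 mat \<Rightarrow> 'a vec \<Rightarrow> 'a mat" where
  "krylov_mat n X v = mat n n (\<lambda>(i, j). (mat_poly (monom 1 j) X *\<^sub>v v) $ i)"

lemma krylov_mat_mult_vec:
  fixes X :: "'a::field mat"
  assumes X: "X \<in> carrier_mat n n" and v: "v \<in> carrier_vec n" and r: "r \<in> deg_lt n"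
  shows "krylov_mat n X v *\<^sub>v vec n (coeff r) = mat_poly r X *\<^sub>v v"
proof (rule eq_vecI)
  fix i assume "i < dim_vec (mat_poly r X *\<^sub>v v)"
  then have i: "i < n" using X by simp
  have sums: "(mat_poly (\<Sum>j\<in>J. F j) X *\<^sub>v v) $ i = (\<Sum>j\<in>J. (mat_poly (F j) X *\<^sub>v v) $ i)"
    if "finite J" for J and F :: "nat \<Rightarrow> 'a poly"
    using that
  proof (induction J rule: finite_induct)
    case empty then show ?case using X v i by (simp add: mult_zero_mat_vec[of _ n n])
  next
    case (insert j J)
    have "(mat_poly (F j) X *\<^sub>v v + mat_poly (sum F J) X *\<^sub>v v) $ i
      = (mat_poly (F j) X *\<^sub>v v) $ i + (mat_poly (sum F J) X *\<^sub>v v) $ i"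
      by (rule index_add_vec) (use X i in simp)
    then show ?case using insert by (simp add: mat_poly_act_add[OF X v])
  qed
  have rs: "r = (\<Sum>j<n. monom (coeff r j) j)"
  proof (rule poly_eqI)
    fix k show "coeff r k = coeff (\<Sum>j<n. monom (coeff r j) j) k"
      using r by (auto simp: coeff_sum deg_lt_def)
  qed
  have mon: "(mat_poly (monom c j) X *\<^sub>v v) $ i = c * (mat_poly (monom 1 j) X *\<^sub>v v) $ i" for c j
  proof -
    have "monom c j = Polynomial.smult c (monom 1 j)" by (simp add: smult_monom)
    then show ?thesis using X v i by (simp add: mat_poly_smult[OF X])
  qed
  have "(mat_poly r X *\<^sub>v v) $ i = (\<Sum>j<n. (mat_poly (monom (coeff r j) j) X *\<^sub>v v) $ i)"
    using sums[of "{..<n}" "\<lambda>j. monom (coeff r j) j"] rs by simp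
  also have "\<dots> = (\<Sum>j<n. coeff r j * (mat_poly (monom 1 j) X *\<^sub>v v) $ i)"
    by (rule sum.cong[OF refl]) (rule mon)
  also have "\<dots> = (krylov_mat n X v *\<^sub>v vec n (coeff r)) $ i"
    using i by (simp add: krylov_mat_def scalar_prod_def atLeast0LessThan mult.commute)
  finally show "(krylov_mat n X v *\<^sub>v vec n (coeff r)) $ i = (mat_poly r X *\<^sub>v v) $ i" ..
qed (use X in \<open>simp add: krylov_mat_def\<close>)

lemma det_krylov_mat:
  fixes X :: "'a::field mat"
  assumes X: "X \<in> carrier_mat n n" and v: "cyclic_vec X v"
  shows "det (krylov_mat n X v) \<noteq> 0"
proof
  have K: "krylov_mat n X v \<in> carrier_mat n n" by (simp add: krylov_mat_def)
  assume "det (krylov_mat n X v) = 0"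
  then obtain c where c: "c \<in> carrier_vec n" "c \<noteq> 0\<^sub>v n" "krylov_mat n X v *\<^sub>v c = 0\<^sub>v n"
    using det_0_iff_vec_prod_zero_field[OF K] by blast
  obtain r where r: "r \<in> deg_lt n" "c = vec n (coeff r)" using poly_of_coeff_vec[OF c(1)] by blast
  have "mat_poly r X *\<^sub>v v = 0\<^sub>v n"
    using c(3) krylov_mat_mult_vec[OF X cyclic_vecD(1)[OF X v] r(1)] r(2) by simp
  then have "char_poly X dvd r" using cyclic_vecD(2)[OF X v] by blast
  moreover have "degree (char_poly X) = n" using degree_monic_char_poly[OF X] by simp
  ultimately have "r = 0" using deg_lt_dvd_imp_zero[of r "char_poly X"] r(1) by simp
  then have "c = 0\<^sub>v n" unfolding r(2) by (intro eq_vecI) simp_all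
  then show False using c(2) by simp
qed

text \<open>Both modules are the residues modulo the same polynomial, so r(Y) w -> r(X) v is a
  well-defined isomorphism. Its matrix is one Krylov matrix times the inverse of the other.\<close>

lemma same_separable_char_poly_intertwiner:
  fixes X Y :: "'a::{finite,field} mat"
  assumes X: "X \<in> carrier_mat n n" and Y: "Y \<in> carrier_mat n n"
    and sep: "coprime (char_poly X) (pderiv (char_poly X))"
    and eq: "char_poly Y = char_poly X"
  obtains K where "K \<in> carrier_mat n n" "det K \<noteq> 0" "X * K = K * Y"
proof -
  obtain v where v: "cyclic_vec X v" using separable_imp_cyclic_vec[OF X sep] by blast
  obtain w where w: "cyclic_vec Y w" using separable_imp_cyclic_vec[OF Y] sep eq by auto
  note vc = cyclic_vecD(1)[OF X v] and wc = cyclic_vecD(1)[OF Y w]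
  define A where "A = krylov_mat n X v"
  define B where "B = krylov_mat n Y w"
  have A: "A \<in> carrier_mat n n" "det A \<noteq> 0" and B: "B \<in> carrier_mat n n" "det B \<noteq> 0"
    unfolding A_def B_def using det_krylov_mat[OF X v] det_krylov_mat[OF Y w] by (simp_all add: krylov_mat_def)
  obtain C where C: "C \<in> carrier_mat n n" "B * C = 1\<^sub>m n" "C * B = 1\<^sub>m n"
    using mat_inverse_exists[OF B] by blast
  define K where "K = A * C"
  have K: "K \<in> carrier_mat n n" unfolding K_def using A C by simp
  have "det C \<noteq> 0" using det_nonzero_if_left_inverse[OF C(1) B(1) C(2)] .
  then have detK: "det K \<noteq> 0" unfolding K_def using A C by (simp add: det_mult)
  have deg: "degree (char_poly X) = n" and f0: "char_poly X \<noteq> 0"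
    using degree_monic_char_poly[OF X] by auto
  have act0: "K *\<^sub>v (mat_poly r Y *\<^sub>v w) = mat_poly r X *\<^sub>v v" if "r \<in> deg_lt n" for r
  proof -
    have "K *\<^sub>v (mat_poly r Y *\<^sub>v w) = (A * C) *\<^sub>v (B *\<^sub>v vec n (coeff r))"
      unfolding K_def B_def using krylov_mat_mult_vec[OF Y wc that] by simp
    also have "\<dots> = A *\<^sub>v ((C * B) *\<^sub>v vec n (coeff r))"
      using A(1) B(1) C(1) by (simp add: mat_vec_assoc)
    also have "\<dots> = mat_poly r X *\<^sub>v v"
      unfolding C(3) A_def using krylov_mat_mult_vec[OF X vc that] by simp
    finally show ?thesis .
  qed
  \<comment> \<open>Both sides depend on \<open>r\<close> only modulo the common characteristic
    polynomial, which reduces to remainders.\<close>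
  have act: "K *\<^sub>v (mat_poly r Y *\<^sub>v w) = mat_poly r X *\<^sub>v v" for r
  proof -
    have cong: "char_poly X dvd r - r mod char_poly X" by (simp add: minus_mod_eq_mult_div)
    have "mat_poly r Y *\<^sub>v w = mat_poly (r mod char_poly X) Y *\<^sub>v w"
      using cyclic_vec_eq_iff[OF Y w] eq cong by simp
    moreover have "mat_poly r X *\<^sub>v v = mat_poly (r mod char_poly X) X *\<^sub>v v"
      using cyclic_vec_eq_iff[OF X v] cong by simp
    ultimately show ?thesis using act0 mod_in_deg_lt[OF f0, of r] deg by simp
  qed
  have "X * K = K * Y"
  proof (rule mat_eq_if_eq_on_vecs)
    fix u :: "'a vec" assume "u \<in> carrier_vec n"
    then obtain r where r: "u = mat_poly r Y *\<^sub>v w" using cyclic_vec_generates[OF Y w] by blast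
    have u: "u \<in> carrier_vec n" by fact
    have XYx: "X *\<^sub>v (mat_poly r X *\<^sub>v v) = mat_poly ([:0, 1:] * r) X *\<^sub>v v"
      "Y *\<^sub>v (mat_poly r Y *\<^sub>v w) = mat_poly ([:0, 1:] * r) Y *\<^sub>v w"
      unfolding mat_poly_act_mult[OF X vc] mat_poly_act_mult[OF Y wc] mat_poly_var[OF X] mat_poly_var[OF Y]
      by simp_all
    have "(X * K) *\<^sub>v u = X *\<^sub>v (K *\<^sub>v u)" using X K u by (simp add: mat_vec_assoc)
    also have "\<dots> = mat_poly ([:0, 1:] * r) X *\<^sub>v v" unfolding r act XYx ..
    also have "\<dots> = K *\<^sub>v (Y *\<^sub>v u)" unfolding r XYx act ..
    also have "\<dots> = (K * Y) *\<^sub>v u" using Y K u by (simp add: mat_vec_assoc)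
    finally show "(X * K) *\<^sub>v u = (K * Y) *\<^sub>v u" .
  qed (use X Y K in auto)
  then show ?thesis using that K detK by blast
qed

text \<open>The companion matrix, taken as multiplication by x on remainders modulo
  \<open>g\<close>. Since p(C) sends the coordinates of 1 to those of \<open>p\<close>,
  Cayley-Hamilton yields that \<open>g\<close> divides the characteristic polynomial, and degrees
  give equality.\<close>

lemma exists_mat_with_char_poly:
  fixes g :: "'a::field poly"
  assumes "monic g" and n: "degree g = n" "n > 0"
  obtains C where "C \<in> carrier_mat n n" "char_poly C = g"
proof -
  define C where "C = mat n n (\<lambda>(i, j). coeff (monom 1 (Suc j) mod g) i)"
  have C: "C \<in> carrier_mat n n" unfolding C_def by simp
  have g0: "g \<noteq> 0" using assms by auto
  define co where "co = (\<lambda>p. vec n (coeff (p mod g)))"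
  have co: "co p \<in> carrier_vec n" for p unfolding co_def by simp
  have sums: "coeff ((\<Sum>j\<in>J. Polynomial.smult (c j) (F j)) mod g) i = (\<Sum>j\<in>J. c j * coeff (F j mod g) i)"
    if "finite J" for J :: "nat set" and F c i
    using that by (induction J rule: finite_induct) (simp_all add: poly_mod_add_left mod_smult_left)
  have shift: "C *\<^sub>v co p = co ([:0, 1:] * p)" for p
  proof (rule eq_vecI)
    fix i assume "i < dim_vec (co ([:0, 1:] * p))"
    then have i: "i < n" unfolding co_def by simp
    let ?s = "p mod g"
    have s: "?s \<in> deg_lt n" using mod_in_deg_lt[OF g0] n by simp
    have "[:0, 1:] * ?s = (\<Sum>j<n. Polynomial.smult (coeff ?s j) (monom 1 (Suc j)))"
    proof (rule poly_eqI)
      fix k show "coeff ([:0, 1:] * ?s) k = coeff (\<Sum>j<n. Polynomial.smult (coeff ?s j) (monom 1 (Suc j))) k"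
        using s by (cases k) (auto simp: coeff_sum deg_lt_def if_distrib cong: if_cong)
    qed
    then have "coeff (([:0, 1:] * ?s) mod g) i = (\<Sum>j<n. coeff ?s j * coeff (monom 1 (Suc j) mod g) i)"
      using sums[of "{..<n}" "coeff ?s" "\<lambda>j. monom 1 (Suc j)" i] by simp
    also have "\<dots> = (C *\<^sub>v co p) $ i"
      using i unfolding C_def co_def by (simp add: scalar_prod_def atLeast0LessThan mult.commute)
    also have "([:0, 1:] * ?s) mod g = ([:0, 1:] * p) mod g" by (rule mod_mult_right_eq)
    finally show "(C *\<^sub>v co p) $ i = co ([:0, 1:] * p) $ i"
      using i unfolding co_def by simp
  qed (simp add: C_def co_def)
  have act: "mat_poly p C *\<^sub>v co 1 = co p" for p
  proof (induction p)
    case 0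
    have "co 0 = 0\<^sub>v n" unfolding co_def by (rule eq_vecI) auto
    then show ?case using C co[of 1] by (simp add: mult_zero_mat_vec[of _ n n])
  next
    case (pCons a p)
    have "mat_poly (pCons a p) C *\<^sub>v co 1 = (a \<cdot>\<^sub>m 1\<^sub>m n) *\<^sub>v co 1 + (C * mat_poly p C) *\<^sub>v co 1"
      unfolding mat_poly_pCons[OF C]
      by (rule add_mult_distrib_mat_vec) (use C co in \<open>auto simp: mult_carrier_mat[OF C]\<close>)
    also have "(C * mat_poly p C) *\<^sub>v co 1 = co ([:0, 1:] * p)"
      unfolding assoc_mult_mat_vec[OF C mat_poly_carrier[OF C] co] pCons.IH shift ..
    also have "(a \<cdot>\<^sub>m 1\<^sub>m n) *\<^sub>v co 1 = co [:a:]"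
    proof (rule eq_vecI)
      fix i assume "i < dim_vec (co [:a:])"
      then have i: "i < n" unfolding co_def by simp
      have "[:a:] = Polynomial.smult a 1" by simp
      then show "((a \<cdot>\<^sub>m 1\<^sub>m n) *\<^sub>v co 1) $ i = co [:a:] $ i" using i
        unfolding co_def by (simp add: mod_smult_left del: smult_one)
    qed (simp add: co_def)
    also have "co [:a:] + co ([:0, 1:] * p) = co (pCons a p)"
    proof (rule eq_vecI)
      have "pCons a p = [:a:] + [:0, 1:] * p" by simp
      then show "\<And>i. i < dim_vec (co (pCons a p)) \<Longrightarrow> (co [:a:] + co ([:0, 1:] * p)) $ i = co (pCons a p) $ i"
        unfolding co_def by (simp only: poly_mod_add_left) simp
    qed (simp add: co_def)
    finally show ?case .
  qed
  have cp: "degree (char_poly C) = n" "monic (char_poly C)" using degree_monic_char_poly[OF C] by auto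
  have "co (char_poly C) = 0\<^sub>v n"
    using act[of "char_poly C"] cayley_hamilton_mat[OF C] co[of 1] by simp
  then have z0: "co (char_poly C) $ i = 0\<^sub>v n $ i" for i by simp
  have z: "coeff (char_poly C mod g) i = 0" if "i < n" for i
    using z0[of i] that unfolding co_def by simp
  have "char_poly C mod g = 0"
  proof (rule poly_eqI)
    fix i show "coeff (char_poly C mod g) i = coeff 0 i"
      using z[of i] mod_in_deg_lt[OF g0, of "char_poly C"] n unfolding deg_lt_def by (cases "i < n") simp_all
  qed
  then have "g dvd char_poly C" by (simp add: dvd_eq_mod_eq_0)
  then have "char_poly C = g" using monic_dvd_same_degree[of g "char_poly C"] cp assms by simp
  then show ?thesis using that C by blast
qed

subsection \<open>The substitution $x + 1/x$\<close>

text \<open>For \<open>degree g \<le> m\<close> this is $x^m g(x + 1/x)$.\<close>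
definition recip_lift :: "nat \<Rightarrow> 'a::field poly \<Rightarrow> 'a poly" where
  "recip_lift m g = (\<Sum>i\<le>m. monom (coeff g i) (m - i) * [:1, 0, 1:] ^ i)"

lemma recip_lift_add: "recip_lift m (g + h) = recip_lift m g + recip_lift m h"
  by (simp add: recip_lift_def add_monom[symmetric] distrib_right sum.distrib)

lemma recip_lift_smult: "recip_lift m (Polynomial.smult c g) = Polynomial.smult c (recip_lift m g)"
  unfolding recip_lift_def coeff_smult smult_sum2
  by (rule sum.cong) (simp_all add: smult_monom flip: mult_smult_left)

lemma recip_lift_0 [simp]: "recip_lift m 0 = 0"
  by (simp add: recip_lift_def)

lemma recip_lift_index_0: "recip_lift 0 [:c:] = [:c:]"
  by (simp add: recip_lift_def monom_0)

lemma recip_lift_minus: "recip_lift m (- g) = - recip_lift m g"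
  using recip_lift_smult[of m "- 1" g] by simp

lemma recip_lift_diff: "recip_lift m (g - h) = recip_lift m g - recip_lift m h"
  using recip_lift_add[of m g "- h"] recip_lift_minus[of m h] by simp

lemma recip_lift_pCons:
  "recip_lift (Suc m) (pCons c g) = monom c (Suc m) + [:1, 0, 1:] * recip_lift m g"
  unfolding recip_lift_def sum.atMost_Suc_shift by (simp add: sum_distrib_left mult_ac)

text \<open>Raising the index clears one more denominator x. The degree bound is essential because
  \<open>recip_lift m\<close> truncates \<open>g\<close> after x^m.\<close>

lemma recip_lift_Suc:
  assumes "degree g \<le> m" shows "recip_lift (Suc m) g = [:0, 1:] * recip_lift m g"
proof -
  have "(\<Sum>i\<le>m. monom (coeff g i) (Suc m - i) * [:1, 0, 1:] ^ i)
    = (\<Sum>i\<le>m. [:0, 1:] * (monom (coeff g i) (m - i) * [:1, 0, 1:] ^ i))"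
    by (rule sum.cong) (simp_all add: Suc_diff_le monom_Suc)
  then show ?thesis using assms unfolding recip_lift_def by (simp add: coeff_eq_0 sum_distrib_left)
qed

lemma recip_lift_add_index:
  assumes "degree g \<le> m" shows "recip_lift (k + m) g = monom 1 k * recip_lift m g"
proof (induction k)
  case (Suc k)
  have "degree g \<le> k + m" using assms by simp
  then have "recip_lift (Suc k + m) g = [:0, 1:] * recip_lift (k + m) g" using recip_lift_Suc by simp
  then show ?case unfolding Suc by (simp add: monom_Suc)
qed simp

text \<open>Evaluation at x + 1/x is multiplicative, and the cleared powers x^m and x^k multiply.
  The induction is Horner's scheme in \<open>g\<close>.\<close>

lemma recip_lift_mult:
  assumes "degree g \<le> m" "degree h \<le> k"
  shows "recip_lift (m + k) (g * h) = recip_lift m g * recip_lift k h"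
  using assms
proof (induction g arbitrary: m)
  case (pCons c g)
  show ?case
  proof (cases m)
    case 0
    then have "g = 0" using pCons by (auto split: if_splits)
    then show ?thesis using 0 by (simp add: recip_lift_smult recip_lift_index_0)
  next
    case (Suc l)
    have l: "degree g \<le> l" using pCons.prems Suc by (cases "g = 0") auto
    have "recip_lift (m + k) (pCons c g * h)
      = Polynomial.smult c (recip_lift (Suc l + k) h) + recip_lift (Suc (l + k)) (pCons 0 (g * h))"
      unfolding Suc by (simp add: recip_lift_add recip_lift_smult)
    also have "recip_lift (Suc l + k) h = monom 1 (Suc l) * recip_lift k h"
      using recip_lift_add_index[OF pCons.prems(2)] .
    also have "recip_lift (Suc (l + k)) (pCons 0 (g * h)) = [:1, 0, 1:] * (recip_lift l g * recip_lift k h)"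
      unfolding recip_lift_pCons using pCons.IH[OF l pCons.prems(2)] by simp
    also have "Polynomial.smult c (monom 1 (Suc l) * recip_lift k h) = monom c (Suc l) * recip_lift k h"
      by (simp add: smult_monom flip: mult_smult_left)
    finally show ?thesis unfolding Suc recip_lift_pCons by (simp add: algebra_simps)
  qed
qed simp

lemma recip_lift_1: "recip_lift m 1 = monom 1 m"
  using recip_lift_add_index[of 1 0 m] by (simp add: recip_lift_def monom_0)

lemma coeff_0_recip_lift: "coeff (recip_lift m g) 0 = coeff g m"
proof -
  have "coeff (recip_lift m g) 0 = (\<Sum>i\<le>m. if i = m then coeff g i else 0)"
    unfolding recip_lift_def coeff_sum
    by (rule sum.cong) (auto simp: coeff_mult coeff_0_power)
  then show ?thesis by simp
qed

lemma degree_monic_recip_lift: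
  assumes "monic g" "degree g = m"
  shows "degree (recip_lift m g) = 2 * m \<and> monic (recip_lift m g)"
  using assms
proof (induction m arbitrary: g)
  case 0
  then have "g = 1" using monic_degree_0 by blast
  then show ?case by (simp add: recip_lift_1)
next
  case (Suc m)
  obtain c h where g: "g = pCons c h" by (cases g)
  have h: "h \<noteq> 0" using Suc.prems g by auto
  then have "monic h" "degree h = m" using Suc.prems g by auto
  from Suc.IH[OF this] have IH: "degree (recip_lift m h) = 2 * m" "monic (recip_lift m h)" by auto
  have mon: "monic ([:1, 0, 1:] * recip_lift m h)" using IH(2) by (intro monic_mult) auto
  have nz: "recip_lift m h \<noteq> 0" using IH(2) by auto
  have deg: "degree ([:1, 0, 1:] * recip_lift m h) = 2 * Suc m" using IH(1) nz
    by (subst degree_mult_eq) auto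
  have lt: "degree (monom c (Suc m)) < degree ([:1, 0, 1:] * recip_lift m h)"
    unfolding deg by (rule le_less_trans[OF degree_monom_le]) simp
  show ?case unfolding g recip_lift_pCons using lt deg mon
    by (simp add: degree_add_eq_right lead_coeff_add_le del: mult_pCons_left)
qed

section \<open>Palindromic polynomials are exactly the lifts\<close>

lemma coeff_x2_plus_1_mult:
  fixes F :: "'a::comm_ring_1 poly"
  shows "coeff ([:1, 0, 1:] * F) k = coeff F k + (if k \<ge> 2 then coeff F (k - 2) else 0)"
  by (cases k; cases "k - 1") (auto simp: coeff_pCons split: nat.split)

text \<open>Here \<open>n\<close> is a formal degree: \<open>f\<close> may have smaller degree or
  vanish, as happens when an inductive argument strips off outer coefficients.\<close>

definition palindromic :: "nat \<Rightarrow> 'a::comm_ring_1 poly \<Rightarrow> bool" where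
  "palindromic n f \<longleftrightarrow> (\<forall>i\<le>n. coeff f (n - i) = coeff f i) \<and> (\<forall>i>n. coeff f i = 0)"

lemma palindromic_recip_lift: "palindromic (2 * m) (recip_lift m g)"
proof (induction m arbitrary: g)
  case 0
  show ?case by (auto simp: palindromic_def recip_lift_def monom_0 coeff_pCons split: nat.split)
next
  case (Suc m)
  obtain c h where g: "g = pCons c h" by (cases g)
  define F where "F = recip_lift m h"
  have pal: "coeff F (2 * m - i) = coeff F i" if "i \<le> 2 * m" for i
    using Suc.IH[of h] that unfolding F_def palindromic_def by blast
  have zero: "coeff F i = 0" if "i > 2 * m" for i
    using Suc.IH[of h] that unfolding F_def palindromic_def by blast
  have co: "coeff (recip_lift (Suc m) g) k
    = (if k = Suc m then c else 0) + (coeff F k + (if k \<ge> 2 then coeff F (k - 2) else 0))" for k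
    unfolding g recip_lift_pCons F_def coeff_add coeff_x2_plus_1_mult by simp
  have "coeff (recip_lift (Suc m) g) (2 * Suc m - i) = coeff (recip_lift (Suc m) g) i"
    if i: "i \<le> 2 * Suc m" for i
  proof -
    \<comment> \<open>The reflection of indices exchanges the two summands of (x^2 + 1) F and fixes
      the middle term.\<close>
    let ?j = "2 * Suc m - i"
    have 1: "(if ?j = Suc m then c else 0) = (if i = Suc m then c else 0)" using i by auto
    have 2: "(if ?j \<ge> 2 then coeff F (?j - 2) else 0) = coeff F i"
    proof (cases "i \<le> 2 * m")
      case True
      then have "?j \<ge> 2" "?j - 2 = 2 * m - i" by simp_all
      then show ?thesis using pal[OF True] by simp
    next
      case False
      then show ?thesis using zero[of i] i by simp
    qed
    have 3: "coeff F ?j = (if i \<ge> 2 then coeff F (i - 2) else 0)"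
    proof (cases "i \<ge> 2")
      case True
      then have "2 * m - (i - 2) = ?j" by simp
      then show ?thesis using pal[of "i - 2"] True i by simp
    next
      case False
      then show ?thesis using zero[of ?j] by simp
    qed
    show ?thesis unfolding co 1 2 3 by (simp add: add_ac)
  qed
  moreover have "coeff (recip_lift (Suc m) g) i = 0" if "i > 2 * Suc m" for i
    unfolding co using that zero[of i] zero[of "i - 2"] by auto
  ultimately show ?case unfolding palindromic_def by blast
qed

text \<open>Subtracting f(0) (x^2 + 1)^(m+1), itself a lift, removes the constant term and by
  symmetry the top one. What remains is x times a palindrome of formal degree 2 m.\<close>

lemma palindromic_imp_recip_lift:
  assumes "palindromic (2 * m) f"
  shows "\<exists>g. degree g \<le> m \<and> f = recip_lift m g"
  using assms
proof (induction m arbitrary: f)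
  case 0
  have "f = [:coeff f 0:]"
    by (rule poly_eqI) (use 0 in \<open>auto simp: palindromic_def coeff_pCons split: nat.split\<close>)
  then have "f = recip_lift 0 [:coeff f 0:]" unfolding recip_lift_index_0 .
  moreover have "degree [:coeff f 0:] \<le> 0" by simp
  ultimately show ?case by blast
next
  case (Suc m)
  define c where "c = coeff f 0"
  define e where "e = recip_lift (Suc m) (monom c (Suc m))"
  have e: "coeff e (2 * Suc m - i) = coeff e i" if "i \<le> 2 * Suc m" for i
    using palindromic_recip_lift[of "Suc m" "monom c (Suc m)"] that unfolding e_def palindromic_def by blast
  have e0: "coeff e i = 0" if "i > 2 * Suc m" for i
    using palindromic_recip_lift[of "Suc m" "monom c (Suc m)"] that unfolding e_def palindromic_def by blast
  have f: "coeff f (2 * Suc m - i) = coeff f i" if "i \<le> 2 * Suc m" for i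
    using Suc.prems that unfolding palindromic_def by blast
  have f0: "coeff f i = 0" if "i > 2 * Suc m" for i
    using Suc.prems that unfolding palindromic_def by blast
  obtain d h where dh: "f - e = pCons d h" by (cases "f - e")
  have "coeff (f - e) 0 = 0" unfolding e_def by (simp add: coeff_0_recip_lift c_def)
  then have d: "d = 0" unfolding dh by simp
  have hc: "coeff h i = coeff f (Suc i) - coeff e (Suc i)" for i
    using arg_cong[OF dh, of "\<lambda>p. coeff p (Suc i)"] by simp
  have top: "coeff f (2 * Suc m) - coeff e (2 * Suc m) = 0"
    using f[of 0] e[of 0] \<open>coeff (f - e) 0 = 0\<close> by simp
  have "palindromic (2 * m) h" unfolding palindromic_def
  proof (intro conjI allI impI)
    fix i assume i: "i \<le> 2 * m"
    then have "2 * Suc m - Suc i = Suc (2 * m - i)" by simp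
    then show "coeff h (2 * m - i) = coeff h i" unfolding hc using f[of "Suc i"] e[of "Suc i"] i by simp
  next
    fix i assume i: "i > 2 * m"
    show "coeff h i = 0"
    proof (cases "i = Suc (2 * m)")
      case True
      then have "Suc i = 2 * Suc m" by simp
      then show ?thesis unfolding hc using top by simp
    next
      case False
      then have "Suc i > 2 * Suc m" using i by simp
      then show ?thesis unfolding hc using f0 e0 by simp
    qed
  qed
  from Suc.IH[OF this] obtain g where g: "degree g \<le> m" "h = recip_lift m g" by blast
  have "f = e + [:0, 1:] * h" using dh d by (simp add: algebra_simps)
  also have "\<dots> = recip_lift (Suc m) (monom c (Suc m) + g)"
    unfolding recip_lift_add e_def g(2) using recip_lift_Suc[OF g(1)] by simp
  finally show ?case using g(1) by (intro exI[of _ "monom c (Suc m) + g"])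
      (auto intro!: degree_add_le order.trans[OF degree_monom_le])
qed

lemma monic_palindromic_imp_recip_lift:
  assumes "palindromic (2 * m) f" "monic f" "degree f = 2 * m"
  obtains g where "monic g" "degree g = m" "f = recip_lift m g"
proof -
  obtain g where g: "degree g \<le> m" "f = recip_lift m g" using palindromic_imp_recip_lift assms(1) by blast
  have "coeff f (2 * m) = coeff f 0" using assms(1) unfolding palindromic_def by force
  then have "coeff g m = 1" using assms(2,3) coeff_0_recip_lift[of m g] g(2) by simp
  moreover from this have "m \<le> degree g" by (intro le_degree) simp
  ultimately show ?thesis using that g by auto
qed

section \<open>Injectivity, divisibility and coprimality of lifts\<close>

lemma recip_lift_eq_0_iff:
  assumes "degree g \<le> m" shows "recip_lift m g = 0 \<longleftrightarrow> g = 0"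
proof
  assume z: "recip_lift m g = 0"
  show "g = 0"
  proof (rule ccontr)
    assume "g \<noteq> 0"
    then have "coeff (recip_lift (degree g) g) 0 \<noteq> 0" by (simp add: coeff_0_recip_lift)
    moreover have "recip_lift m g = monom 1 (m - degree g) * recip_lift (degree g) g"
      using recip_lift_add_index[of g "degree g" "m - degree g"] assms by simp
    ultimately show False using z by auto
  qed
qed simp

lemma recip_lift_inj:
  assumes "degree g \<le> m" "degree h \<le> m" "recip_lift m g = recip_lift m h" shows "g = h"
  using recip_lift_eq_0_iff[of "g - h" m] assms by (simp add: recip_lift_diff degree_diff_le)

lemma recip_lift_dvd:
  assumes "g dvd h" "h \<noteq> 0" shows "recip_lift (degree g) g dvd recip_lift (degree h) h"
proof -
  obtain k where k: "h = g * k" using assms(1) by (elim dvdE)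
  then have "degree h = degree g + degree k" using assms(2) by (auto simp: degree_mult_eq)
  then have "recip_lift (degree h) h = recip_lift (degree g) g * recip_lift (degree k) k"
    unfolding k using recip_lift_mult[of g "degree g" k "degree k"] k by simp
  then show ?thesis by simp
qed

text \<open>A Bezout identity lifts to one with a power of x in place of 1. The only possible common
  irreducible factor is then x, which the constant term of the lift, the leading coefficient of
  \<open>g\<close>, excludes.\<close>

lemma recip_lift_coprime:
  fixes g h :: "'a::field poly"
  assumes "coprime g h" "monic g" "degree g = m" "degree h = k"
  shows "coprime (recip_lift m g) (recip_lift k h)"
proof (rule ccontr)
  assume "\<not> coprime (recip_lift m g) (recip_lift k h)"
  moreover have "recip_lift m g \<noteq> 0" using assms by (auto simp: recip_lift_eq_0_iff)
  ultimately obtain a where "monic a" and a: "irreducible a" "a dvd recip_lift m g" "a dvd recip_lift k h"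
    by (rule common_irreducible_factor_exists)
  obtain s t where st: "s * g + t * h = 1" using assms(1) coprime_field_poly_iff_bezout by blast
  \<comment> \<open>Large enough for both cofactors, so that both products can be lifted at the same
    index N + m + k.\<close>
  define N where "N = degree s + degree t"
  have "recip_lift ((N + k) + m) (s * g) = recip_lift (N + k) s * recip_lift m g"
    by (rule recip_lift_mult) (simp_all add: N_def assms)
  moreover have "recip_lift ((N + m) + k) (t * h) = recip_lift (N + m) t * recip_lift k h"
    by (rule recip_lift_mult) (simp_all add: N_def assms)
  moreover have "(N + k) + m = (N + m) + k" by simp
  ultimately have "recip_lift ((N + m) + k) (s * g + t * h)
      = recip_lift (N + k) s * recip_lift m g + recip_lift (N + m) t * recip_lift k h"
    by (simp only: recip_lift_add)
  then have "monom 1 ((N + m) + k) = recip_lift (N + k) s * recip_lift m g + recip_lift (N + m) t * recip_lift k h"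
    unfolding st recip_lift_1 .
  then have "a dvd monom 1 ((N + m) + k)" using a by simp
  then have "a dvd [:0, 1:] ^ ((N + m) + k)" by (simp add: monom_altdef)
  then have "a dvd [:0, 1:]" using a(1) irreducible_field_poly_dvd_power by blast
  moreover have "irreducible ([:0, 1:] :: 'a poly)" by (rule irreducible_linear_field_poly) simp
  ultimately have "[:0, 1:] dvd a" using irreducibleD' irreducible_not_unit[OF a(1)] by blast
  then have "[:0, 1:] dvd recip_lift m g" using a(2) dvd_trans by blast
  then have "poly (recip_lift m g) 0 = 0" using poly_eq_0_iff_dvd[of "recip_lift m g" 0] by simp
  then show False using assms(2,3) by (simp add: poly_0_coeff_0 coeff_0_recip_lift)
qed

lemma recip_lift_prod:
  assumes "finite A" "\<And>a. a \<in> A \<Longrightarrow> monic a"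
  shows "recip_lift (degree (\<Prod>a\<in>A. a)) (\<Prod>a\<in>A. a) = (\<Prod>a\<in>A. recip_lift (degree a) a)"
  using assms
proof (induction A rule: finite_induct)
  case empty then show ?case by (simp add: recip_lift_1)
next
  case (insert x A)
  have "monic (\<Prod>a\<in>A. a)" using insert by (intro monic_prod) auto
  moreover have "monic x" using insert.prems by simp
  ultimately have "x * (\<Prod>a\<in>A. a) \<noteq> 0" "(\<Prod>a\<in>A. a) \<noteq> 0" "x \<noteq> 0" by auto
  then have "degree (x * (\<Prod>a\<in>A. a)) = degree x + degree (\<Prod>a\<in>A. a)" by (simp add: degree_mult_eq)
  then show ?case using insert recip_lift_mult[of x "degree x" "\<Prod>a\<in>A. a" "degree (\<Prod>a\<in>A. a)"] by simp
qed

text \<open>A repeated irreducible factor of \<open>g\<close> lifts to a repeated factor. The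
  converse fails: x - 2 lifts to (x - 1)^2.\<close>

lemma separable_recip_lift_imp_separable:
  fixes g :: "'a::{finite,field} poly"
  assumes "monic g" "degree g = m" "coprime (recip_lift m g) (pderiv (recip_lift m g))"
  shows "coprime g (pderiv g)"
proof (rule ccontr)
  assume "\<not> coprime g (pderiv g)"
  moreover have g0: "g \<noteq> 0" using assms by auto
  ultimately obtain a where a: "monic a" "irreducible a" "a dvd g" "a dvd pderiv g"
    by (rule common_irreducible_factor_exists)
  obtain k where k: "g = a * k" using a(3) by (elim dvdE)
  have "a dvd k * pderiv a" using a(4) unfolding k pderiv_mult by (simp add: dvd_add_right_iff)
  then have "a dvd pderiv a * k" by (subst mult.commute)
  then have "a dvd k" by (rule coprime_field_poly_dvd_mult[OF irreducible_separable_finite_field[OF a(2)]])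
  then obtain l where l: "k = a * l" by (elim dvdE)
  have nz: "a \<noteq> 0" "k \<noteq> 0" "l \<noteq> 0" using g0 k l by auto
  have "recip_lift (degree a + degree k) g = recip_lift (degree a) a * recip_lift (degree k) k"
    unfolding k by (rule recip_lift_mult) simp_all
  then have 1: "recip_lift m g = recip_lift (degree a) a * recip_lift (degree k) k"
    using nz assms(2) k by (simp add: degree_mult_eq)
  have "recip_lift (degree a) a dvd recip_lift (degree k) k"
    using recip_lift_dvd[of a k] l nz by simp
  moreover have "coprime (recip_lift (degree a) a) (recip_lift (degree k) k)"
    using assms(3) unfolding 1 separable_poly_mult_iff by blast
  ultimately have "is_unit (recip_lift (degree a) a)" using coprime_common_divisor[OF _ dvd_refl] by blast
  moreover have "degree (recip_lift (degree a) a) = 2 * degree a" using degree_monic_recip_lift[OF a(1)] by simp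
  ultimately show False using irreducible_field_poly_degree_pos[OF a(2)] by (auto simp: is_unit_iff_degree)
qed

subsection \<open>A matrix with characteristic polynomial $x^m g(x + 1/x)$\<close>

text \<open>The homogenised characteristic polynomial. With an outer variable z, the identity b z -
  b Y = b (z - Y) relates the coefficients of \<open>char_poly\<close> for b Y to those for Y;
  cancelling b^i is where \<open>b\<close> must be nonzero. It is applied with (a, b) = (x^2 + 1, x)
  and (1, x).\<close>

lemma det_homogenised_char_poly:
  fixes Y :: "'a::field mat" and a b :: "'a poly"
  assumes Y: "Y \<in> carrier_mat m m" and b: "b \<noteq> 0"
  shows "det (a \<cdot>\<^sub>m 1\<^sub>m m - b \<cdot>\<^sub>m map_mat (\<lambda>c. [:c:]) Y)
    = (\<Sum>i\<le>m. [:coeff (char_poly Y) i:] * a ^ i * b ^ (m - i))"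
proof -
  have lift: "comm_ring_hom (\<lambda>c::'a. [:c:])" by unfold_locales simp_all
  have scale: "comm_ring_hom (\<lambda>p::'a poly poly. pcompose p [:0, b:])"
    by unfold_locales (auto simp: pcompose_add pcompose_mult pcompose_1)
  define L where "L = map_mat (\<lambda>c. [:c:]) Y"
  have L: "L \<in> carrier_mat m m" "b \<cdot>\<^sub>m L \<in> carrier_mat m m" unfolding L_def using Y by auto
  define G where "G = char_poly (b \<cdot>\<^sub>m L)"
  have degG: "degree G = m" unfolding G_def using degree_monic_char_poly[OF L(2)] by simp
  have charL: "char_poly L = map_poly (\<lambda>c. [:c:]) (char_poly Y)"
    unfolding L_def by (rule comm_ring_hom.char_poly_hom[OF lift Y])
  \<comment> \<open>\<open>[:0, b:]\<close> is b z in the outer variable z of the iterated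
    polynomial ring.\<close>
  have "map_mat (\<lambda>p. pcompose p [:0, b:]) (char_poly_matrix (b \<cdot>\<^sub>m L)) = [:b:] \<cdot>\<^sub>m char_poly_matrix L"
    using L by (auto intro!: eq_matI simp: char_poly_matrix_def pcompose_pCons)
  then have "pcompose G [:0, b:] = [:b:] ^ m * char_poly L"
    unfolding G_def char_poly_def using comm_ring_hom.hom_det[OF scale, of "char_poly_matrix (b \<cdot>\<^sub>m L)"]
      carrier_matD[OF char_poly_matrix_closed[OF L(1)]] by simp
  then have "coeff (pcompose G [:0, b:]) i = coeff ([:b ^ m:] * char_poly L) i" for i
    by (simp add: poly_const_pow)
  then have scaled: "b ^ i * coeff G i = b ^ m * [:coeff (char_poly Y) i:]" for i
    unfolding charL by (simp add: coeff_pcompose_linear coeff_map_poly)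
  have Gi: "coeff G i = [:coeff (char_poly Y) i:] * b ^ (m - i)" if "i \<le> m" for i
  proof -
    have "b ^ i * coeff G i = b ^ i * ([:coeff (char_poly Y) i:] * b ^ (m - i))"
      unfolding scaled using that by (simp add: mult_ac flip: power_add)
    then show ?thesis using b by (simp only: mult_cancel_left power_eq_0_iff) simp
  qed
  have "det (a \<cdot>\<^sub>m 1\<^sub>m m - b \<cdot>\<^sub>m L) = poly G a" unfolding G_def char_poly_def
    by (rule poly_det_cong[symmetric, of _ m]) (use L in \<open>auto simp: char_poly_matrix_def\<close>)
  also have "\<dots> = (\<Sum>i\<le>m. coeff G i * a ^ i)" by (simp add: poly_altdef degG)
  also have "\<dots> = (\<Sum>i\<le>m. [:coeff (char_poly Y) i:] * a ^ i * b ^ (m - i))"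
    by (rule sum.cong) (use Gi in \<open>simp_all add: mult_ac\<close>)
  finally show ?thesis unfolding L_def .
qed

text \<open>This matrix $C$ satisfies $C + C^{-1} = diag(Y, Y)$.\<close>
definition recip_mat :: "nat \<Rightarrow> 'a::field mat \<Rightarrow> 'a mat" where
  "recip_mat m Y = four_block_mat (0\<^sub>m m m) (- 1\<^sub>m m) (1\<^sub>m m) Y"

text \<open>The block determinant collapses to det(x (x - Y) + 1) = det((x^2 + 1) - x Y), a
  homogenised characteristic polynomial of \<open>Y\<close>.\<close>

lemma char_poly_recip_mat:
  fixes Y :: "'a::field mat"
  assumes Y: "Y \<in> carrier_mat m m"
  shows "char_poly (recip_mat m Y) = recip_lift m (char_poly Y)"
proof -
  let ?x = "[:0, 1:] :: 'a poly"
  let ?L = "map_mat (\<lambda>c. [:c:]) Y"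
  define D where "D = ?x \<cdot>\<^sub>m 1\<^sub>m m - ?L"
  have L: "?L \<in> carrier_mat m m" and D: "D \<in> carrier_mat m m" unfolding D_def using Y by auto
  have m1: "[:- 1:] = (- 1 :: 'a poly)" unfolding one_pCons by simp
  have blk: "char_poly_matrix (recip_mat m Y)
      = four_block_mat (?x \<cdot>\<^sub>m 1\<^sub>m m) (1\<^sub>m m) (- 1\<^sub>m m) D"
    by (rule eq_matI) (use Y in \<open>auto simp: char_poly_matrix_def recip_mat_def D_def m1\<close>)
  have "char_poly (recip_mat m Y) = det ((?x \<cdot>\<^sub>m 1\<^sub>m m) * D - 1\<^sub>m m * (- 1\<^sub>m m))"
    unfolding char_poly_def blk by (rule det_four_block_mat) (use D in auto)
  also have "(?x \<cdot>\<^sub>m 1\<^sub>m m) * D - 1\<^sub>m m * (- 1\<^sub>m m) = [:1, 0, 1:] \<cdot>\<^sub>m 1\<^sub>m m - ?x \<cdot>\<^sub>m ?L"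
  proof -
    have "(?x \<cdot>\<^sub>m 1\<^sub>m m) * D = ?x \<cdot>\<^sub>m D"
      using mult_smult_assoc_mat[OF one_carrier_mat D, of ?x] D by simp
    then show ?thesis unfolding D_def using Y by (auto intro!: eq_matI)
  qed
  also have "det \<dots> = (\<Sum>i\<le>m. [:coeff (char_poly Y) i:] * [:1, 0, 1:] ^ i * ?x ^ (m - i))"
    by (rule det_homogenised_char_poly[OF Y]) simp
  also have "\<dots> = recip_lift m (char_poly Y)" unfolding recip_lift_def
    by (rule sum.cong) (simp_all add: monom_altdef mult_ac)
  finally show ?thesis .
qed

subsection \<open>Counting symplectic matrices with given characteristic polynomial\<close>

lemma sympl_J_block:
  "sympl_J m = four_block_mat (0\<^sub>m m m) (1\<^sub>m m) (- 1\<^sub>m m) (0\<^sub>m m m)"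
  by (rule eq_matI) (auto simp: sympl_J_def)

lemma sympl_J_carrier [simp]: "sympl_J m \<in> carrier_mat (m + m) (m + m)"
  unfolding sympl_J_block by (rule four_block_carrier_mat) simp_all

lemma sympl_J_dim [simp]: "dim_row (sympl_J m) = m + m" "dim_col (sympl_J m) = m + m"
  using carrier_matD[OF sympl_J_carrier] by blast+

text \<open>Writes the dimension as \<open>m + m\<close>, the form that block matrices
  produce.\<close>

lemma Sp_iff: "X \<in> Sp m \<longleftrightarrow> X \<in> carrier_mat (m + m) (m + m) \<and> X\<^sup>T * sympl_J m * X = sympl_J m"
  by (simp add: Sp_def mult_2)

lemma det_sympl_J: "det (sympl_J m :: 'a::field mat) = 1"
proof -
  have "det (sympl_J m :: 'a mat) = det (0\<^sub>m m m * 0\<^sub>m m m - 1\<^sub>m m * (- 1\<^sub>m m) :: 'a mat)"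
    unfolding sympl_J_block by (rule det_four_block_mat) auto
  also have "0\<^sub>m m m * 0\<^sub>m m m - 1\<^sub>m m * (- 1\<^sub>m m) = (1\<^sub>m m :: 'a mat)"
    by (rule eq_matI) auto
  finally show ?thesis by simp
qed

lemma sympl_J_transpose: "(sympl_J m)\<^sup>T = - (sympl_J m :: 'a::field mat)"
  by (rule eq_matI) (auto simp: sympl_J_def)

text \<open>Skew-symmetry does not imply this in characteristic 2, so it is computed on the two
  halves of the vector.\<close>

lemma sympl_J_alternating:
  fixes u :: "'a::field vec"
  assumes "u \<in> carrier_vec (m + m)"
  shows "u \<bullet> (sympl_J m *\<^sub>v u) = 0"
proof -
  have "\<forall>u \<in> carrier_vec (m + m). u \<bullet> (sympl_J m *\<^sub>v u) = (0 :: 'a)"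
    unfolding all_vec_append
  proof (intro ballI)
    fix a b :: "'a vec" assume ab: "a \<in> carrier_vec m" "b \<in> carrier_vec m"
    have "sympl_J m *\<^sub>v (a @\<^sub>v b) = (0\<^sub>m m m *\<^sub>v a + 1\<^sub>m m *\<^sub>v b) @\<^sub>v (- 1\<^sub>m m *\<^sub>v a + 0\<^sub>m m m *\<^sub>v b)"
      unfolding sympl_J_block by (rule four_block_mat_mult_vec) (use ab in auto)
    also have "\<dots> = b @\<^sub>v - a" using ab by simp
    finally have "(a @\<^sub>v b) \<bullet> (sympl_J m *\<^sub>v (a @\<^sub>v b)) = a \<bullet> b + b \<bullet> - a"
      using ab by (simp add: scalar_prod_append[of _ m _ m])
    then show "(a @\<^sub>v b) \<bullet> (sympl_J m *\<^sub>v (a @\<^sub>v b)) = 0"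
      using ab comm_scalar_prod[of a m b] by simp
  qed
  then show ?thesis using assms by blast
qed

lemma finite_carrier_mat: "finite (carrier_mat n k :: 'a::finite mat set)"
proof (rule finite_subset)
  show "carrier_mat n k \<subseteq> (\<lambda>F. mat n k F) ` (({..<n} \<times> {..<k}) \<rightarrow>\<^sub>E (UNIV :: 'a set))"
  proof
    fix A :: "'a mat" assume A: "A \<in> carrier_mat n k"
    let ?F = "restrict (\<lambda>ij. A $$ ij) ({..<n} \<times> {..<k})"
    have "A = mat n k ?F" by (rule eq_matI) (use A in auto)
    moreover have "?F \<in> ({..<n} \<times> {..<k}) \<rightarrow>\<^sub>E (UNIV :: 'a set)" by auto
    ultimately show "A \<in> (\<lambda>F. mat n k F) ` (({..<n} \<times> {..<k}) \<rightarrow>\<^sub>E (UNIV :: 'a set))"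
      by (rule image_eqI)
  qed
  show "finite ((\<lambda>F. mat n k F) ` (({..<n} \<times> {..<k}) \<rightarrow>\<^sub>E (UNIV :: 'a set)))"
    by (intro finite_imageI finite_PiE) auto
qed

lemma finite_Sp: "finite (Sp m :: 'a::{finite,field} mat set)"
  by (rule finite_subset[OF _ finite_carrier_mat[of "m + m" "m + m"]]) (auto simp: Sp_iff)

lemma Sp_det_nonzero:
  fixes X :: "'a::field mat"
  assumes "X \<in> Sp m" shows "det X \<noteq> 0"
proof -
  have X: "X \<in> carrier_mat (m + m) (m + m)" "X\<^sup>T * sympl_J m * X = sympl_J m" using assms by (auto simp: Sp_iff)
  have "det (X\<^sup>T * sympl_J m * X) = det (X\<^sup>T * sympl_J m) * det X"
    by (rule det_mult) (use X in \<open>auto intro!: mult_carrier_mat[of _ _ "m + m"]\<close>)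
  then show ?thesis unfolding X(2) det_sympl_J by auto
qed

section \<open>Forms under change of basis\<close>

lemma congruence_cancel:
  fixes K A B :: "'a::field mat"
  assumes K: "K \<in> carrier_mat n n" "det K \<noteq> 0" and A: "A \<in> carrier_mat n n" and B: "B \<in> carrier_mat n n"
    and eq: "K\<^sup>T * A * K = K\<^sup>T * B * K"
  shows "A = B"
proof -
  obtain L where L: "L \<in> carrier_mat n n" "K * L = 1\<^sub>m n" using mat_inverse_exists[OF K] by blast
  have "L\<^sup>T * K\<^sup>T = (K * L)\<^sup>T" using transpose_mult[OF K(1) L(1)] by simp
  then have LK: "L\<^sup>T * K\<^sup>T = 1\<^sub>m n" unfolding L(2) by simp
  have red: "L\<^sup>T * (K\<^sup>T * Z * K) * L = Z" if Z: "Z \<in> carrier_mat n n" for Z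
  proof -
    have "L\<^sup>T * (K\<^sup>T * Z * K) * L = (L\<^sup>T * K\<^sup>T) * (Z * (K * L))"
      using K(1) L(1) Z by (simp add: mat_mult_assoc)
    then show ?thesis unfolding LK L(2) using Z by simp
  qed
  have "A = L\<^sup>T * (K\<^sup>T * A * K) * L" by (rule red[OF A, symmetric])
  also have "\<dots> = B" unfolding eq by (rule red[OF B])
  finally show ?thesis .
qed

lemma congruence_mult:
  fixes K C A :: "'a::field mat"
  assumes "K \<in> carrier_mat n n" "C \<in> carrier_mat n n" "A \<in> carrier_mat n n"
  shows "(K * C)\<^sup>T * A * (K * C) = C\<^sup>T * (K\<^sup>T * A * K) * C"
  using assms by (simp add: transpose_mult[of _ n n _ n] mat_mult_assoc)

text \<open>Pulling the form back along X and then K is the same as along K and then C. This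
  translates symplectic conjugates of \<open>C\<close> into \<open>C\<close>-invariant
  forms.\<close>

lemma Sp_conj_iff:
  fixes K X C :: "'a::field mat"
  assumes K: "K \<in> carrier_mat (m + m) (m + m)" "det K \<noteq> 0" and X: "X \<in> carrier_mat (m + m) (m + m)"
    and C: "C \<in> carrier_mat (m + m) (m + m)" and eq: "X * K = K * C"
  shows "X \<in> Sp m \<longleftrightarrow> C\<^sup>T * (K\<^sup>T * sympl_J m * K) * C = K\<^sup>T * sympl_J m * K"
proof -
  have J: "sympl_J m \<in> carrier_mat (m + m) (m + m)" by simp
  have 1: "C\<^sup>T * (K\<^sup>T * sympl_J m * K) * C = K\<^sup>T * (X\<^sup>T * sympl_J m * X) * K"
    using congruence_mult[OF K(1) C J] congruence_mult[OF X K(1) J] eq by simp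
  have XJ: "X\<^sup>T * sympl_J m * X \<in> carrier_mat (m + m) (m + m)"
    using X by (auto intro!: mult_carrier_mat[of _ _ "m + m"])
  show ?thesis unfolding 1 Sp_iff using congruence_cancel[OF K XJ J] X by auto
qed

text \<open>Polynomials in a self-adjoint \<open>Y\<close> are self-adjoint, so the form sees only
  the product \<open>p * s\<close>. For cyclic \<open>v\<close> the form is thus encoded by a single
  linear functional on residues.\<close>

lemma bilinear_self_adjoint:
  fixes Y H :: "'a::field mat"
  assumes Y: "Y \<in> carrier_mat m m" and H: "H \<in> carrier_mat m m" and HY: "H * Y = Y\<^sup>T * H"
    and v: "v \<in> carrier_vec m"
  shows "(mat_poly p Y *\<^sub>v v) \<bullet> (H *\<^sub>v (mat_poly s Y *\<^sub>v v)) = v \<bullet> (H *\<^sub>v (mat_poly (p * s) Y *\<^sub>v v))"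
proof -
  have YT: "Y\<^sup>T \<in> carrier_mat m m" using Y by simp
  let ?w = "H *\<^sub>v (mat_poly s Y *\<^sub>v v)"
  have w: "?w \<in> carrier_vec m" using H Y v by (intro mult_mat_vec_carrier[of _ m m]) simp_all
  have "mat_poly p Y = (mat_poly p (Y\<^sup>T))\<^sup>T" unfolding mat_poly_transpose[OF YT] by simp
  then have "(mat_poly p Y *\<^sub>v v) \<bullet> ?w = v \<bullet> (mat_poly p (Y\<^sup>T) *\<^sub>v ?w)"
    using transpose_vec_mult_scalar[OF mat_poly_carrier[OF YT] w v] by simp
  also have "mat_poly p (Y\<^sup>T) *\<^sub>v ?w = (mat_poly p (Y\<^sup>T) * H) *\<^sub>v (mat_poly s Y *\<^sub>v v)"
    using Y H v by (simp add: mat_vec_assoc)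
  also have "mat_poly p (Y\<^sup>T) * H = H * mat_poly p Y"
    by (rule mat_poly_intertwine[OF YT Y H HY[symmetric]])
  also have "(H * mat_poly p Y) *\<^sub>v (mat_poly s Y *\<^sub>v v) = H *\<^sub>v (mat_poly (p * s) Y *\<^sub>v v)"
    using Y H v by (simp add: mat_vec_assoc mat_poly_mult[OF Y])
  finally show ?thesis .
qed

lemma mat_eq_if_bilinear_eq:
  fixes A B :: "'a::field mat"
  assumes A: "A \<in> carrier_mat n n" and B: "B \<in> carrier_mat n n"
    and eq: "\<And>u w. u \<in> carrier_vec n \<Longrightarrow> w \<in> carrier_vec n \<Longrightarrow> w \<bullet> (A *\<^sub>v u) = w \<bullet> (B *\<^sub>v u)"
  shows "A = B"
proof (rule mat_eq_if_eq_on_vecs[OF A B])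
  fix u :: "'a vec" assume u: "u \<in> carrier_vec n"
  show "A *\<^sub>v u = B *\<^sub>v u"
  proof (rule eq_vecI)
    fix i assume "i < dim_vec (B *\<^sub>v u)"
    then have i: "i < n" using B by simp
    have c: "A *\<^sub>v u \<in> carrier_vec n" "B *\<^sub>v u \<in> carrier_vec n" using A B u by simp_all
    show "(A *\<^sub>v u) $ i = (B *\<^sub>v u) $ i"
      using eq[OF u unit_vec_carrier[of n i]] scalar_prod_left_unit[OF c(1) i] scalar_prod_left_unit[OF c(2) i]
      by simp
  qed (use A B in simp)
qed

text \<open>On a cyclic space the form depends only on the product of two polynomials, and this
  product is commutative.\<close>

lemma self_adjoint_symmetric:
  fixes Y H :: "'a::{finite,field} mat"
  assumes Y: "Y \<in> carrier_mat m m" "cyclic_vec Y v" and H: "H \<in> carrier_mat m m" "H * Y = Y\<^sup>T * H"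
  shows "H\<^sup>T = H"
proof (rule mat_eq_if_bilinear_eq)
  note v = cyclic_vecD(1)[OF Y]
  fix u w :: "'a vec" assume uw: "u \<in> carrier_vec m" "w \<in> carrier_vec m"
  obtain s where s: "u = mat_poly s Y *\<^sub>v v" using cyclic_vec_generates[OF Y uw(1)] by blast
  obtain p where p: "w = mat_poly p Y *\<^sub>v v" using cyclic_vec_generates[OF Y uw(2)] by blast
  have HT: "H\<^sup>T \<in> carrier_mat m m" using H by simp
  have Hw: "H *\<^sub>v w \<in> carrier_vec m" using H uw by simp
  have "w \<bullet> (H\<^sup>T *\<^sub>v u) = (H *\<^sub>v w) \<bullet> u"
    using transpose_vec_mult_scalar[OF HT uw(1) uw(2)] by simp
  also have "\<dots> = u \<bullet> (H *\<^sub>v w)" by (rule comm_scalar_prod[OF Hw uw(1)])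
  also have "\<dots> = w \<bullet> (H *\<^sub>v u)" unfolding s p
    bilinear_self_adjoint[OF Y(1) H v] by (simp add: mult.commute)
  finally show "w \<bullet> (H\<^sup>T *\<^sub>v u) = w \<bullet> (H *\<^sub>v u)" .
qed (use H in auto)

text \<open>The values $\phi(s^2)$ and $\phi(x s^2)$ of the functional $\phi(r) = v^T A \, r(Y) v$ vanish and span
  everything; the hypothesis on \<open>A * Y\<close> is what covers characteristic 2.\<close>
lemma alternating_self_adjoint_zero:
  fixes Y A :: "'a::{finite,field} mat"
  assumes Y: "Y \<in> carrier_mat m m" "cyclic_vec Y v" and A: "A \<in> carrier_mat m m" "A * Y = Y\<^sup>T * A"
    and alt: "\<And>u. u \<in> carrier_vec m \<Longrightarrow> u \<bullet> (A *\<^sub>v u) = 0"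
    and altY: "\<And>u. u \<in> carrier_vec m \<Longrightarrow> u \<bullet> ((A * Y) *\<^sub>v u) = 0"
  shows "A = 0\<^sub>m m m"
proof (rule mat_eq_if_bilinear_eq)
  note v = cyclic_vecD(1)[OF Y]
  define \<phi> where "\<phi> r = v \<bullet> (A *\<^sub>v (mat_poly r Y *\<^sub>v v))" for r
  have bil: "(mat_poly p Y *\<^sub>v v) \<bullet> (A *\<^sub>v (mat_poly s Y *\<^sub>v v)) = \<phi> (p * s)" for p s
    unfolding \<phi>_def by (rule bilinear_self_adjoint[OF Y(1) A v])
  have c: "mat_poly r Y *\<^sub>v v \<in> carrier_vec m" "A *\<^sub>v (mat_poly r Y *\<^sub>v v) \<in> carrier_vec m" for r
    using Y(1) v A by (auto intro!: mult_mat_vec_carrier[of _ m m])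
  have \<phi>_add: "\<phi> (r + s) = \<phi> r + \<phi> s" for r s
    unfolding \<phi>_def mat_poly_act_add[OF Y(1) v] mult_add_distrib_mat_vec[OF A(1) c(1) c(1)]
    by (rule scalar_prod_add_distrib[OF v c(2) c(2)])
  have \<phi>_smult: "\<phi> (Polynomial.smult a r) = a * \<phi> r" for a r
  proof -
    have "mat_poly (Polynomial.smult a r) Y *\<^sub>v v = a \<cdot>\<^sub>v (mat_poly r Y *\<^sub>v v)"
      unfolding mat_poly_smult[OF Y(1)] by (rule eq_vecI) (use Y(1) v in auto)
    then show ?thesis unfolding \<phi>_def using A(1) c v by (simp add: mult_mat_vec[of _ m m])
  qed
  have \<phi>_0: "\<phi> 0 = 0" using \<phi>_smult[of 0 0] by simp
  have even: "\<phi> (s * s) = 0" for s unfolding bil[symmetric] by (rule alt[OF c(1)])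
  have odd: "\<phi> (s * ([:0, 1:] * s)) = 0" for s
  proof -
    have "(A * Y) *\<^sub>v (mat_poly s Y *\<^sub>v v) = A *\<^sub>v (mat_poly ([:0, 1:] * s) Y *\<^sub>v v)"
      using Y(1) A(1) v c by (simp add: mat_vec_assoc mat_poly_act_mult[OF Y(1) v] del: mult_pCons_left)
    then show ?thesis unfolding bil[symmetric] using altY[OF c(1)[of s]] by simp
  qed
  have mono: "\<phi> (monom 1 k) = 0" for k
  proof (cases "even k")
    case True
    then obtain j where "k = 2 * j" by (elim evenE)
    then have "k = j + j" by simp
    then have "monom (1 :: 'a) k = monom 1 j * monom 1 j" by (simp add: mult_monom)
    then show ?thesis using even by simp
  next
    case False
    then obtain j where "k = 2 * j + 1" by (elim oddE)
    then have "k = j + Suc j" by simp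
    then have "monom (1 :: 'a) k = monom 1 j * ([:0, 1:] * monom 1 j)" by (simp add: mult_monom monom_Suc)
    then show ?thesis using odd[of "monom 1 j"] by simp
  qed
  have "\<phi> (monom 1 k * r) = 0" for k r
  proof (induction r arbitrary: k)
    case (pCons a r)
    have "monom 1 k * pCons a r = Polynomial.smult a (monom 1 k) + monom 1 (Suc k) * r"
      by (simp add: monom_Suc)
    then show ?case using pCons.IH by (simp only: \<phi>_add \<phi>_smult mono) simp
  qed (simp add: \<phi>_0)
  from this[of 0] have \<phi>_zero: "\<phi> r = 0" for r by simp
  fix u w :: "'a vec" assume uw: "u \<in> carrier_vec m" "w \<in> carrier_vec m"
  obtain s where s: "u = mat_poly s Y *\<^sub>v v" using cyclic_vec_generates[OF Y uw(1)] by blast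
  obtain p where p: "w = mat_poly p Y *\<^sub>v v" using cyclic_vec_generates[OF Y uw(2)] by blast
  have "w \<bullet> (A *\<^sub>v u) = 0" unfolding s p bil \<phi>_zero ..
  then show "w \<bullet> (A *\<^sub>v u) = w \<bullet> (0\<^sub>m m m *\<^sub>v u)" using uw by simp
qed (use A in auto)

section \<open>Forms invariant under the block matrix\<close>

lemma four_block_mat_inject:
  assumes eq: "four_block_mat A B C D = four_block_mat A' B' C' D'"
    and c: "A \<in> carrier_mat m m" "B \<in> carrier_mat m m" "C \<in> carrier_mat m m" "D \<in> carrier_mat m m"
      "A' \<in> carrier_mat m m" "B' \<in> carrier_mat m m" "C' \<in> carrier_mat m m" "D' \<in> carrier_mat m m"
  shows "A = A' \<and> B = B' \<and> C = C' \<and> D = D'"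
proof (intro conjI)
  have e: "four_block_mat A B C D $$ (i, j) = four_block_mat A' B' C' D' $$ (i, j)" for i j using eq by simp
  show "A = A'"
  proof (rule eq_matI)
    fix i j assume "i < dim_row A'" "j < dim_col A'"
    then show "A $$ (i, j) = A' $$ (i, j)" using e[of i j] c by simp
  qed (use c in auto)
  show "B = B'"
  proof (rule eq_matI)
    fix i j assume "i < dim_row B'" "j < dim_col B'"
    then show "B $$ (i, j) = B' $$ (i, j)" using e[of i "j + m"] c by simp
  qed (use c in auto)
  show "C = C'"
  proof (rule eq_matI)
    fix i j assume "i < dim_row C'" "j < dim_col C'"
    then show "C $$ (i, j) = C' $$ (i, j)" using e[of "i + m" j] c by simp
  qed (use c in auto)
  show "D = D'"
  proof (rule eq_matI)
    fix i j assume "i < dim_row D'" "j < dim_col D'"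
    then show "D $$ (i, j) = D' $$ (i, j)" using e[of "i + m" "j + m"] c by simp
  qed (use c in auto)
qed

lemma recip_mat_carrier [simp]:
  "Y \<in> carrier_mat m m \<Longrightarrow> recip_mat m Y \<in> carrier_mat (m + m) (m + m)"
  unfolding recip_mat_def by (rule four_block_carrier_mat) simp_all

lemma recip_mat_congruence:
  fixes Y :: "'a::field mat"
  assumes Y: "Y \<in> carrier_mat m m" and c: "A \<in> carrier_mat m m" "B \<in> carrier_mat m m"
    "E \<in> carrier_mat m m" "D \<in> carrier_mat m m"
  shows "(recip_mat m Y)\<^sup>T * four_block_mat A B E D * recip_mat m Y
    = four_block_mat D (D * Y - E) (Y\<^sup>T * D - B) (A - B * Y + Y\<^sup>T * (D * Y - E))"
proof -
  have T: "(recip_mat m Y)\<^sup>T = four_block_mat (0\<^sub>m m m) (1\<^sub>m m) (- 1\<^sub>m m) (Y\<^sup>T)"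
  proof -
    have "(recip_mat m Y)\<^sup>T = four_block_mat ((0\<^sub>m m m)\<^sup>T) ((1\<^sub>m m)\<^sup>T) ((- 1\<^sub>m m)\<^sup>T) (Y\<^sup>T)"
      unfolding recip_mat_def by (rule transpose_four_block_mat) (use Y in auto)
    then show ?thesis by (simp add: transpose_uminus)
  qed
  have AB: "A * - 1\<^sub>m m = - A" "E * - 1\<^sub>m m = - E" using c by simp_all
  have sums: "U + - V = U - V" "- V + U = U - V" "0\<^sub>m m m + U = U" "U + 0\<^sub>m m m = U" "- (U - V) = V - U"
    if "U \<in> carrier_mat m m" "V \<in> carrier_mat m m" for U V :: "'a mat"
    using that by (auto intro!: eq_matI)
  have c2: "B * Y \<in> carrier_mat m m" "D * Y \<in> carrier_mat m m" "D * Y - E \<in> carrier_mat m m"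
     "B * Y - A \<in> carrier_mat m m" "Y\<^sup>T * D \<in> carrier_mat m m" "Y\<^sup>T * (D * Y - E) \<in> carrier_mat m m"
    using c Y by (auto intro!: mult_carrier_mat[of _ m m] minus_carrier_mat)
  have "four_block_mat A B E D * recip_mat m Y
      = four_block_mat (A * 0\<^sub>m m m + B * 1\<^sub>m m) (A * - 1\<^sub>m m + B * Y) (E * 0\<^sub>m m m + D * 1\<^sub>m m) (E * - 1\<^sub>m m + D * Y)"
    unfolding recip_mat_def by (rule mult_four_block_mat) (use c Y in auto)
  also have "\<dots> = four_block_mat B (B * Y - A) D (D * Y - E)"
    unfolding AB using c c2 by (simp add: sums(2)[OF c2(1) c(1)] sums(2)[OF c2(2) c(3)])
  finally have 1: "four_block_mat A B E D * recip_mat m Y = four_block_mat B (B * Y - A) D (D * Y - E)" .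
  have "(recip_mat m Y)\<^sup>T * four_block_mat B (B * Y - A) D (D * Y - E)
      = four_block_mat (0\<^sub>m m m * B + 1\<^sub>m m * D) (0\<^sub>m m m * (B * Y - A) + 1\<^sub>m m * (D * Y - E))
         (- 1\<^sub>m m * B + Y\<^sup>T * D) (- 1\<^sub>m m * (B * Y - A) + Y\<^sup>T * (D * Y - E))"
    unfolding T
    by (rule mult_four_block_mat[OF zero_carrier_mat one_carrier_mat _ _ c(2) c2(4) c(4) c2(3)]) (use Y in auto)
  also have "\<dots> = four_block_mat D (D * Y - E) (Y\<^sup>T * D - B) (A - B * Y + Y\<^sup>T * (D * Y - E))"
  proof -
    have b1: "0\<^sub>m m m * B + 1\<^sub>m m * D = D" using c by simp
    have b2: "0\<^sub>m m m * (B * Y - A) + 1\<^sub>m m * (D * Y - E) = D * Y - E"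
      using c c2 by (simp add: left_mult_zero_mat[OF c2(4)] left_mult_one_mat[OF c2(3)])
    have b3: "- 1\<^sub>m m * B + Y\<^sup>T * D = Y\<^sup>T * D - B" using c c2 by (simp add: sums(2)[OF c2(5) c(2)])
    have "- 1\<^sub>m m * Z = - Z" if "Z \<in> carrier_mat m m" for Z :: "'a mat" using that by simp
    then have "- 1\<^sub>m m * (B * Y - A) = - (B * Y - A)" using c2(4) by blast
    then have b4: "- 1\<^sub>m m * (B * Y - A) + Y\<^sup>T * (D * Y - E) = A - B * Y + Y\<^sup>T * (D * Y - E)"
      using sums(5)[OF c2(1) c(1)] by simp
    show ?thesis unfolding b1 b2 b3 b4 ..
  qed
  finally have 2: "(recip_mat m Y)\<^sup>T * four_block_mat B (B * Y - A) D (D * Y - E)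
    = four_block_mat D (D * Y - E) (Y\<^sup>T * D - B) (A - B * Y + Y\<^sup>T * (D * Y - E))" .
  have "four_block_mat A B E D \<in> carrier_mat (m + m) (m + m)" using c by (intro four_block_carrier_mat)
  then have "(recip_mat m Y)\<^sup>T * four_block_mat A B E D * recip_mat m Y
    = (recip_mat m Y)\<^sup>T * (four_block_mat A B E D * recip_mat m Y)"
    using Y carrier_matD[OF recip_mat_carrier[OF Y]] by (intro mat_mult_assoc) auto
  then show ?thesis unfolding 1 2 .
qed

text \<open>Both coordinate halves are isotropic and \<open>H\<close> pairs them; for symmetric
  \<open>H\<close> the form is alternating in every characteristic.\<close>

definition hyperbolic_form :: "nat \<Rightarrow> 'a::field mat \<Rightarrow> 'a mat" where
  "hyperbolic_form m H = four_block_mat (0\<^sub>m m m) H (- H) (0\<^sub>m m m)"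

lemma det_hyperbolic_form:
  assumes H: "H \<in> carrier_mat m m" shows "det (hyperbolic_form m H) = det H * det H"
proof -
  have "det (hyperbolic_form m H) = det (0\<^sub>m m m * 0\<^sub>m m m - H * (- H))"
    unfolding hyperbolic_form_def by (rule det_four_block_mat) (use H in auto)
  also have "0\<^sub>m m m * 0\<^sub>m m m - H * (- H) = H * H" by (rule eq_matI) (use H in auto)
  finally show ?thesis using det_mult[OF H H] by simp
qed

lemma hyperbolic_form_invariant:
  assumes Y: "Y \<in> carrier_mat m m" and H: "H \<in> carrier_mat m m" and HY: "H * Y = Y\<^sup>T * H"
  shows "(recip_mat m Y)\<^sup>T * hyperbolic_form m H * recip_mat m Y = hyperbolic_form m H"
proof -
  have "(recip_mat m Y)\<^sup>T * hyperbolic_form m H * recip_mat m Y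
    = four_block_mat (0\<^sub>m m m) (0\<^sub>m m m * Y - - H) (Y\<^sup>T * 0\<^sub>m m m - H) (0\<^sub>m m m - H * Y + Y\<^sup>T * (0\<^sub>m m m * Y - - H))"
    unfolding hyperbolic_form_def by (rule recip_mat_congruence) (use Y H in auto)
  also have "0\<^sub>m m m * Y - - H = H" by (rule eq_matI) (use Y H in auto)
  also have "Y\<^sup>T * 0\<^sub>m m m - H = - H" by (rule eq_matI) (use Y H in auto)
  also have "0\<^sub>m m m - H * Y + Y\<^sup>T * H = 0\<^sub>m m m"
  proof -
    have "0\<^sub>m m m - Z + Z = 0\<^sub>m m m" if "Z \<in> carrier_mat m m" for Z :: "'a mat"
      using that by (auto intro!: eq_matI)
    moreover have "Y\<^sup>T * H \<in> carrier_mat m m" using Y H by (intro mult_carrier_mat[of _ m m]) auto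
    ultimately show ?thesis unfolding HY by blast
  qed
  finally show ?thesis unfolding hyperbolic_form_def .
qed

text \<open>In blocks A, B, E, D, invariance and skewness give D = A, E = -B^T and A Y = B - B^T =
  Y^T A. So A is self-adjoint, and both A and A Y are alternating, whence A = 0; then B is symmetric
  and self-adjoint.\<close>

lemma invariant_form_is_hyperbolic:
  fixes Y K :: "'a::{finite,field} mat"
  assumes Y: "Y \<in> carrier_mat m m" "cyclic_vec Y v"
    and K: "K \<in> carrier_mat (m + m) (m + m)" "det K \<noteq> 0"
    and inv: "(recip_mat m Y)\<^sup>T * (K\<^sup>T * sympl_J m * K) * recip_mat m Y = K\<^sup>T * sympl_J m * K"
  obtains H where "H \<in> carrier_mat m m" "det H \<noteq> 0" "H * Y = Y\<^sup>T * H"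
    "K\<^sup>T * sympl_J m * K = hyperbolic_form m H"
proof -
  let ?N = "m + m"
  define W where "W = K\<^sup>T * sympl_J m * K"
  have W: "W \<in> carrier_mat ?N ?N" unfolding W_def using K by (auto intro!: mult_carrier_mat[of _ _ ?N])
  have KJ: "K\<^sup>T * sympl_J m \<in> carrier_mat ?N ?N" "sympl_J m * K \<in> carrier_mat ?N ?N"
    using K by (auto intro!: mult_carrier_mat[of _ _ ?N])
  have skew: "W\<^sup>T = - W"
  proof -
    have KT: "K\<^sup>T \<in> carrier_mat ?N ?N" using K by simp
    have JT: "(sympl_J m)\<^sup>T \<in> carrier_mat ?N ?N" by (simp del: sympl_J_dim)
    have "W\<^sup>T = K\<^sup>T * ((sympl_J m)\<^sup>T * (K\<^sup>T)\<^sup>T)"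
      unfolding W_def transpose_mult[OF KJ(1) K(1)] transpose_mult[OF KT sympl_J_carrier] ..
    also have "\<dots> = K\<^sup>T * (- sympl_J m * K)" unfolding sympl_J_transpose by simp
    also have "\<dots> = - (K\<^sup>T * (sympl_J m * K))" using K KJ(2) by simp
    also have "K\<^sup>T * (sympl_J m * K) = W" unfolding W_def using K by (simp add: mat_mult_assoc)
    finally show ?thesis .
  qed
  have alt: "u \<bullet> (W *\<^sub>v u) = 0" if u: "u \<in> carrier_vec ?N" for u
  proof -
    have KT: "K\<^sup>T \<in> carrier_mat ?N ?N" using K by simp
    have Ku: "K *\<^sub>v u \<in> carrier_vec ?N" using K u by simp
    have JKu: "sympl_J m *\<^sub>v (K *\<^sub>v u) \<in> carrier_vec ?N"
      by (rule mult_mat_vec_carrier[OF sympl_J_carrier Ku])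
    have "W *\<^sub>v u = K\<^sup>T *\<^sub>v (sympl_J m *\<^sub>v (K *\<^sub>v u))"
      unfolding W_def using K u by (simp add: mat_vec_assoc)
    then have "u \<bullet> (W *\<^sub>v u) = u \<bullet> (K\<^sup>T *\<^sub>v (sympl_J m *\<^sub>v (K *\<^sub>v u)))" by simp
    also have "\<dots> = (K *\<^sub>v u) \<bullet> (sympl_J m *\<^sub>v (K *\<^sub>v u))"
      using transpose_vec_mult_scalar[OF KT JKu u] by simp
    also have "\<dots> = 0" by (rule sympl_J_alternating[OF Ku])
    finally show ?thesis .
  qed
  obtain A B E D where sp: "split_block W m m = (A, B, E, D)" by (cases "split_block W m m")
  have dims: "dim_row W = m + m" "dim_col W = m + m" using W by auto
  note blk = split_block[OF sp dims]
  have c: "A \<in> carrier_mat m m" "B \<in> carrier_mat m m" "E \<in> carrier_mat m m" "D \<in> carrier_mat m m"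
    and WB: "W = four_block_mat A B E D" by (fact blk)+
  have c2: "B * Y \<in> carrier_mat m m" "D * Y \<in> carrier_mat m m" "D * Y - E \<in> carrier_mat m m"
     "A - B * Y \<in> carrier_mat m m" "Y\<^sup>T * D \<in> carrier_mat m m" "Y\<^sup>T * (D * Y - E) \<in> carrier_mat m m"
     "A - B * Y + Y\<^sup>T * (D * Y - E) \<in> carrier_mat m m" "Y\<^sup>T * D - B \<in> carrier_mat m m"
    using c Y(1) by (auto intro!: mult_carrier_mat[of _ m m] minus_carrier_mat add_carrier_mat)
  have "four_block_mat D (D * Y - E) (Y\<^sup>T * D - B) (A - B * Y + Y\<^sup>T * (D * Y - E)) = four_block_mat A B E D"
    using inv unfolding W_def[symmetric] WB recip_mat_congruence[OF Y(1) c] .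
  then have eqs: "D = A" "D * Y - E = B" "Y\<^sup>T * D - B = E" "A - B * Y + Y\<^sup>T * (D * Y - E) = D"
    using four_block_mat_inject[of D "D * Y - E" "Y\<^sup>T * D - B" "A - B * Y + Y\<^sup>T * (D * Y - E)" A B E D m] c c2
    by blast+
  have "four_block_mat (A\<^sup>T) (E\<^sup>T) (B\<^sup>T) (D\<^sup>T) = four_block_mat (- A) (- B) (- E) (- D)"
  proof -
    have "W\<^sup>T = four_block_mat (A\<^sup>T) (E\<^sup>T) (B\<^sup>T) (D\<^sup>T)" unfolding WB by (rule transpose_four_block_mat[OF c])
    moreover have "- W = four_block_mat (- A) (- B) (- E) (- D)" unfolding WB
      by (rule eq_matI) (use c in auto)
    ultimately show ?thesis using skew by simp
  qed
  then have "B\<^sup>T = - E"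
    using four_block_mat_inject[of "A\<^sup>T" "E\<^sup>T" "B\<^sup>T" "D\<^sup>T" "- A" "- B" "- E" "- D" m] c by auto
  then have EB: "E = - B\<^sup>T" using c by simp
  have BT: "B\<^sup>T \<in> carrier_mat m m" using c by simp
  have AYc: "A * Y \<in> carrier_mat m m" "Y\<^sup>T * A \<in> carrier_mat m m" using c2(2,5) eqs(1) by simp_all
  have arith: "P = Q - R" if "P - - R = Q" "P \<in> carrier_mat m m" "Q \<in> carrier_mat m m" "R \<in> carrier_mat m m"
    for P Q R :: "'a mat"
    unfolding that(1)[symmetric] using that(2,4) by (auto intro!: eq_matI)
  have arith2: "P = Q - R" if "P - Q = - R" "P \<in> carrier_mat m m" "Q \<in> carrier_mat m m" "R \<in> carrier_mat m m"
    for P Q R :: "'a mat"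
  proof (rule eq_matI)
    fix i j assume "i < dim_row (Q - R)" "j < dim_col (Q - R)"
    then show "P $$ (i, j) = (Q - R) $$ (i, j)"
      using arg_cong[OF that(1), of "\<lambda>M. M $$ (i, j)"] that(2-4) by (simp add: algebra_simps)
  qed (use that in auto)
  have AY: "A * Y = B - B\<^sup>T" using arith[of "A * Y" "B\<^sup>T" B] eqs(1,2) EB AYc c BT by simp
  have YA: "Y\<^sup>T * A = B - B\<^sup>T" using arith2[of "Y\<^sup>T * A" B "B\<^sup>T"] eqs(1,3) EB AYc c BT by simp
  have altA: "u \<bullet> (A *\<^sub>v u) = 0" if u: "u \<in> carrier_vec m" for u
  proof -
    have z: "0\<^sub>v m \<in> carrier_vec m" by simp
    have "W *\<^sub>v (u @\<^sub>v 0\<^sub>v m) = (A *\<^sub>v u + B *\<^sub>v 0\<^sub>v m) @\<^sub>v (E *\<^sub>v u + D *\<^sub>v 0\<^sub>v m)"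
      unfolding WB by (rule four_block_mat_mult_vec[OF c u z])
    also have "\<dots> = (A *\<^sub>v u) @\<^sub>v (E *\<^sub>v u)"
      using c u by (simp add: mult_mat_zero_vec[of _ m m])
    finally have "0 = (u @\<^sub>v 0\<^sub>v m) \<bullet> ((A *\<^sub>v u) @\<^sub>v (E *\<^sub>v u))"
      using alt[of "u @\<^sub>v 0\<^sub>v m"] u by simp
    also have "\<dots> = u \<bullet> (A *\<^sub>v u) + 0\<^sub>v m \<bullet> (E *\<^sub>v u)"
      by (rule scalar_prod_append[of _ m _ m]) (use c u in auto)
    also have "0\<^sub>v m \<bullet> (E *\<^sub>v u) = 0" using c u by simp
    finally show ?thesis by simp
  qed
  \<comment> \<open>B - B^T is alternating in every characteristic; this is the second alternation
    hypothesis of \<open>alternating_self_adjoint_zero\<close>.\<close>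
  have altAY: "u \<bullet> ((A * Y) *\<^sub>v u) = 0" if u: "u \<in> carrier_vec m" for u
  proof -
    have Bu: "B *\<^sub>v u \<in> carrier_vec m" "B\<^sup>T *\<^sub>v u \<in> carrier_vec m" using c u by auto
    have "(A * Y) *\<^sub>v u = B *\<^sub>v u - B\<^sup>T *\<^sub>v u" unfolding AY by (rule minus_mult_distrib_mat_vec[OF c(2) BT u])
    then have "u \<bullet> ((A * Y) *\<^sub>v u) = u \<bullet> (B *\<^sub>v u) - u \<bullet> (B\<^sup>T *\<^sub>v u)"
      using scalar_prod_minus_distrib[OF u Bu] by simp
    also have "u \<bullet> (B\<^sup>T *\<^sub>v u) = (B *\<^sub>v u) \<bullet> u" using transpose_vec_mult_scalar[OF BT u u] by simp
    also have "\<dots> = u \<bullet> (B *\<^sub>v u)" by (rule comm_scalar_prod[OF Bu(1) u])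
    finally show ?thesis by simp
  qed
  have A0: "A = 0\<^sub>m m m"
    by (rule alternating_self_adjoint_zero[OF Y c(1) _ altA altAY]) (simp_all add: AY YA)
  have BBT: "B\<^sup>T = B"
  proof -
    have "B - B\<^sup>T = 0\<^sub>m m m" using AY Y(1) unfolding A0 by simp
    then have e: "(B - B\<^sup>T) $$ (i, j) = 0" if "i < m" "j < m" for i j using that by simp
    show ?thesis
    proof (rule eq_matI)
      fix i j assume "i < dim_row B" "j < dim_col B"
      then show "B\<^sup>T $$ (i, j) = B $$ (i, j)" using e[of i j] c(2) by simp
    qed (use c in auto)
  qed
  have EB': "E = - B" using EB BBT by simp
  have WH: "W = hyperbolic_form m B" unfolding WB hyperbolic_form_def eqs(1) EB' A0 ..
  have BY: "B * Y = Y\<^sup>T * B"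
  proof -
    have "A - B * Y + Y\<^sup>T * B = D" using eqs(4) unfolding eqs(2) .
    then have "0\<^sub>m m m - B * Y + Y\<^sup>T * B = 0\<^sub>m m m" unfolding eqs(1) A0 .
    moreover have YB: "Y\<^sup>T * B \<in> carrier_mat m m" using Y(1) c by (intro mult_carrier_mat[of _ m m]) auto
    ultimately have e: "(0\<^sub>m m m - B * Y + Y\<^sup>T * B) $$ (i, j) = 0" if "i < m" "j < m" for i j using that by simp
    show ?thesis
    proof (rule eq_matI)
      fix i j assume "i < dim_row (Y\<^sup>T * B)" "j < dim_col (Y\<^sup>T * B)"
      then have ij: "i < m" "j < m" using YB by auto
      have d: "dim_row (B * Y) = m" "dim_col (B * Y) = m" "dim_row (Y\<^sup>T * B) = m" "dim_col (Y\<^sup>T * B) = m"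
        using carrier_matD[OF YB] carrier_matD[OF c2(1)] by blast+
      have "(0\<^sub>m m m - B * Y + Y\<^sup>T * B) $$ (i, j) = 0 - (B * Y) $$ (i, j) + (Y\<^sup>T * B) $$ (i, j)"
        using ij d by (simp del: index_mult_mat)
      then show "(B * Y) $$ (i, j) = (Y\<^sup>T * B) $$ (i, j)" using e[OF ij] by simp
    qed (use Y(1) c in auto)
  qed
  have "det W = det (K\<^sup>T * sympl_J m) * det K" unfolding W_def by (rule det_mult[OF KJ(1) K(1)])
  also have "det (K\<^sup>T * sympl_J m) = det (K\<^sup>T) * det (sympl_J m :: 'a mat)"
    by (rule det_mult[OF _ sympl_J_carrier]) (use K in simp)
  finally have "det W \<noteq> 0" using K by (simp add: det_sympl_J det_transpose[OF K(1)])
  then have "det B \<noteq> 0" unfolding WH det_hyperbolic_form[OF c(2)] by auto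
  then show ?thesis using that[OF c(2) _ BY] WH unfolding W_def by blast
qed

text \<open>The lower left block comes out as minus the transpose of \<open>H\<close>, so symmetry
  is needed. The explicit \<open>P\<close> lets every admissible change of basis be split as a
  symplectic matrix times \<open>P\<close>.\<close>

lemma hyperbolic_form_congruent:
  assumes H: "H \<in> carrier_mat m m" "H\<^sup>T = H"
  defines "P \<equiv> four_block_mat (1\<^sub>m m) (0\<^sub>m m m) (0\<^sub>m m m) H"
  shows "P\<^sup>T * sympl_J m * P = hyperbolic_form m H" "P \<in> carrier_mat (m + m) (m + m)" "det P = det H"
proof -
  have "P\<^sup>T = four_block_mat ((1\<^sub>m m)\<^sup>T) ((0\<^sub>m m m)\<^sup>T) ((0\<^sub>m m m)\<^sup>T) (H\<^sup>T)"
    unfolding P_def by (rule transpose_four_block_mat) (use H in auto)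
  then have PT: "P\<^sup>T = P" unfolding P_def by (simp add: H)
  have "P * sympl_J m = four_block_mat (1\<^sub>m m * 0\<^sub>m m m + 0\<^sub>m m m * - 1\<^sub>m m) (1\<^sub>m m * 1\<^sub>m m + 0\<^sub>m m m * 0\<^sub>m m m)
      (0\<^sub>m m m * 0\<^sub>m m m + H * - 1\<^sub>m m) (0\<^sub>m m m * 1\<^sub>m m + H * 0\<^sub>m m m)"
    unfolding P_def sympl_J_block by (rule mult_four_block_mat) (use H in auto)
  also have "\<dots> = four_block_mat (0\<^sub>m m m) (1\<^sub>m m) (- H) (0\<^sub>m m m)"
    by (rule cong_four_block_mat) (use H in auto)
  finally have 1: "P * sympl_J m = four_block_mat (0\<^sub>m m m) (1\<^sub>m m) (- H) (0\<^sub>m m m)" .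
  have "four_block_mat (0\<^sub>m m m) (1\<^sub>m m) (- H) (0\<^sub>m m m) * P
    = four_block_mat (0\<^sub>m m m * 1\<^sub>m m + 1\<^sub>m m * 0\<^sub>m m m) (0\<^sub>m m m * 0\<^sub>m m m + 1\<^sub>m m * H)
      (- H * 1\<^sub>m m + 0\<^sub>m m m * 0\<^sub>m m m) (- H * 0\<^sub>m m m + 0\<^sub>m m m * H)"
    unfolding P_def by (rule mult_four_block_mat) (use H in auto)
  also have "\<dots> = hyperbolic_form m H" unfolding hyperbolic_form_def
    by (rule cong_four_block_mat) (use H in auto)
  finally show "P\<^sup>T * sympl_J m * P = hyperbolic_form m H" unfolding PT 1 .
  show "P \<in> carrier_mat (m + m) (m + m)" unfolding P_def by (rule four_block_carrier_mat) (use H in auto)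
  have "det P = det (1\<^sub>m m :: 'a mat) * det H" unfolding P_def
    by (rule det_four_block_mat_upper_right_zero) (use H in auto)
  then show "det P = det H" by simp
qed

section \<open>Intertwiners and the double count\<close>

lemma mat_mult_right_cancel:
  fixes A B K :: "'a::field mat"
  assumes "A \<in> carrier_mat n n" "B \<in> carrier_mat n n" "K \<in> carrier_mat n n" "det K \<noteq> 0" "A * K = B * K"
  shows "A = B"
proof -
  obtain L where L: "L \<in> carrier_mat n n" "K * L = 1\<^sub>m n" using mat_inverse_exists[OF assms(3,4)] by blast
  have red: "Z * K * L = Z" if "Z \<in> carrier_mat n n" for Z
  proof -
    have "Z * K * L = Z * (K * L)" using that assms(3) L(1) by (simp add: mat_mult_assoc)
    then show ?thesis unfolding L(2) using that by simp
  qed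
  have "A = A * K * L" by (rule red[OF assms(1), symmetric])
  also have "\<dots> = B" unfolding assms(5) by (rule red[OF assms(2)])
  finally show ?thesis .
qed

lemma mat_mult_left_cancel:
  fixes A B K :: "'a::field mat"
  assumes "A \<in> carrier_mat n n" "B \<in> carrier_mat n n" "K \<in> carrier_mat n n" "det K \<noteq> 0" "K * A = K * B"
  shows "A = B"
proof -
  obtain L where L: "L \<in> carrier_mat n n" "L * K = 1\<^sub>m n" using mat_inverse_exists[OF assms(3,4)] by blast
  have red: "L * (K * Z) = Z" if "Z \<in> carrier_mat n n" for Z
  proof -
    have "L * (K * Z) = (L * K) * Z" using that assms(3) L(1) by (simp add: mat_mult_assoc)
    then show ?thesis unfolding L(2) using that by simp
  qed
  have "A = L * (K * A)" by (rule red[OF assms(1), symmetric])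
  also have "\<dots> = B" unfolding assms(5) by (rule red[OF assms(2)])
  finally show ?thesis .
qed

text \<open>One intertwiner K0 identifies all of them with the centraliser of \<open>C\<close>
  through K = K0 Z.\<close>

lemma card_intertwiners:
  fixes X C :: "'a::{finite,field} mat"
  assumes X: "X \<in> carrier_mat n n" and C: "C \<in> carrier_mat n n" and eq: "char_poly X = char_poly C"
    and sep: "coprime (char_poly C) (pderiv (char_poly C))"
  shows "card {K \<in> carrier_mat n n. det K \<noteq> 0 \<and> X * K = K * C} = poly_totient (char_poly C)"
proof -
  obtain K0 where K0: "K0 \<in> carrier_mat n n" "det K0 \<noteq> 0" "X * K0 = K0 * C"
    using same_separable_char_poly_intertwiner[OF X C] sep eq by metis
  obtain L where L: "L \<in> carrier_mat n n" "K0 * L = 1\<^sub>m n" "L * K0 = 1\<^sub>m n"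
    using mat_inverse_exists[OF K0(1,2)] by blast
  let ?Z = "{Z \<in> carrier_mat n n. Z * C = C * Z \<and> det Z \<noteq> 0}"
  have "{K \<in> carrier_mat n n. det K \<noteq> 0 \<and> X * K = K * C} = (\<lambda>Z. K0 * Z) ` ?Z" (is "?L = ?R")
  proof (intro equalityI subsetI)
    fix K assume "K \<in> ?L"
    then have K: "K \<in> carrier_mat n n" "det K \<noteq> 0" "X * K = K * C" by auto
    define Z where "Z = L * K"
    have Z: "Z \<in> carrier_mat n n" unfolding Z_def using L K by simp
    have KZ: "K0 * Z = K"
    proof -
      have "K0 * Z = (K0 * L) * K" unfolding Z_def using K0(1) L(1) K(1) by (simp add: mat_mult_assoc)
      then show ?thesis unfolding L(2) using K by simp
    qed
    have "K0 * (Z * C) = K * C" using K0(1) Z C unfolding KZ[symmetric] by (simp add: mat_mult_assoc)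
    also have "\<dots> = X * K" using K(3) by simp
    also have "\<dots> = X * (K0 * Z)" unfolding KZ ..
    also have "\<dots> = (X * K0) * Z" using K0(1) Z X by (simp add: mat_mult_assoc)
    also have "\<dots> = K0 * (C * Z)" unfolding K0(3) using K0(1) Z C by (simp add: mat_mult_assoc)
    finally have "K0 * (Z * C) = K0 * (C * Z)" .
    then have "Z * C = C * Z"
      by (rule mat_mult_left_cancel[rotated 4]) (use K0 Z C in \<open>auto intro!: mult_carrier_mat[of _ n n]\<close>)
    moreover have "det K0 * det Z \<noteq> 0" using K(2) unfolding det_mult[OF K0(1) Z, symmetric] KZ .
    ultimately have "Z \<in> ?Z" using Z by auto
    then show "K \<in> ?R" using KZ by blast
  next
    fix K assume "K \<in> ?R"
    then obtain Z where Z: "Z \<in> carrier_mat n n" "Z * C = C * Z" "det Z \<noteq> 0" and K: "K = K0 * Z" by auto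
    have "X * K = (X * K0) * Z" unfolding K using X K0(1) Z(1) by (simp add: mat_mult_assoc)
    also have "\<dots> = K0 * (C * Z)" unfolding K0(3) using K0(1) Z(1) C by (simp add: mat_mult_assoc)
    also have "\<dots> = K * C" unfolding Z(2)[symmetric] K using K0(1) Z(1) C by (simp add: mat_mult_assoc)
    finally show "K \<in> ?L" unfolding K using K0 Z by (simp add: det_mult)
  qed
  moreover have "inj_on (\<lambda>Z. K0 * Z) ?Z"
    by (rule inj_onI) (use mat_mult_left_cancel[OF _ _ K0(1,2)] in auto)
  ultimately show ?thesis using card_invertible_commutant[OF C sep] by (simp add: card_image)
qed

theorem card_Sp_char_poly:
  fixes g :: "'a::{finite,field} poly"
  assumes m: "m > 0" and g: "monic g" "degree g = m"
    and sep: "coprime (recip_lift m g) (pderiv (recip_lift m g))"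
  shows "card {X \<in> Sp m. char_poly X = recip_lift m g} * poly_totient (recip_lift m g)
    = card (Sp m :: 'a mat set) * poly_totient g"
proof -
  let ?N = "m + m"
  obtain Y where Y: "Y \<in> carrier_mat m m" "char_poly Y = g"
    using exists_mat_with_char_poly[OF g m] by blast
  have sepY: "coprime (char_poly Y) (pderiv (char_poly Y))"
    unfolding Y(2) by (rule separable_recip_lift_imp_separable[OF g sep])
  obtain v where v: "cyclic_vec Y v" using separable_imp_cyclic_vec[OF Y(1) sepY] by blast
  define C where "C = recip_mat m Y"
  have C: "C \<in> carrier_mat ?N ?N" unfolding C_def using Y by simp
  have charC: "char_poly C = recip_lift m g" unfolding C_def char_poly_recip_mat[OF Y(1)] Y(2) ..
  define HH where "HH = {H \<in> carrier_mat m m. det H \<noteq> 0 \<and> Y\<^sup>T * H = H * Y}"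
  define P where "P H = four_block_mat (1\<^sub>m m) (0\<^sub>m m m) (0\<^sub>m m m) H" for H :: "'a mat"
  define A where "A = {X \<in> Sp m. char_poly X = recip_lift m g}"
  define KX where "KX X = {K \<in> carrier_mat ?N ?N. det K \<noteq> 0 \<and> X * K = K * C}" for X
  have J: "sympl_J m \<in> carrier_mat ?N ?N" by simp
  have Ac: "X \<in> carrier_mat ?N ?N" if "X \<in> A" for X using that unfolding A_def Sp_iff by blast
  have HHd: "H \<in> carrier_mat m m" "det H \<noteq> 0" "H * Y = Y\<^sup>T * H" "H\<^sup>T = H" if "H \<in> HH" for H
  proof -
    show H: "H \<in> carrier_mat m m" "det H \<noteq> 0" "H * Y = Y\<^sup>T * H" using that unfolding HH_def by auto
    show "H\<^sup>T = H" by (rule self_adjoint_symmetric[OF Y(1) v H(1,3)])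
  qed
  have PHH: "P H \<in> carrier_mat ?N ?N" "det (P H) \<noteq> 0" "(P H)\<^sup>T * sympl_J m * P H = hyperbolic_form m H"
    if "H \<in> HH" for H
    using hyperbolic_form_congruent[OF HHd(1,4)[OF that]] HHd(2)[OF that] unfolding P_def by simp_all
  have card_KX: "card (KX X) = poly_totient (recip_lift m g)" if "X \<in> A" for X
    using card_intertwiners[OF Ac[OF that] C] that charC sep unfolding KX_def A_def by simp
  \<comment> \<open>An invertible self-adjoint form is an intertwiner between \<open>Y\<close> and
    its transpose, so the same count applies.\<close>
  have card_HH: "card HH = poly_totient g"
    using card_intertwiners[of "Y\<^sup>T" m Y] Y sepY unfolding HH_def by simp
  have finA: "finite A" unfolding A_def by (rule finite_subset[OF _ finite_Sp[of m]]) blast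
  have finK: "finite (KX X)" for X
    unfolding KX_def by (rule finite_subset[OF _ finite_carrier_mat[of ?N ?N]]) blast
  have disj: "KX X \<inter> KX X' = {}" if "X \<in> A" "X' \<in> A" "X \<noteq> X'" for X X'
  proof (rule ccontr)
    assume "KX X \<inter> KX X' \<noteq> {}"
    then obtain K where K: "K \<in> carrier_mat ?N ?N" "det K \<noteq> 0" "X * K = K * C" "X' * K = K * C"
      unfolding KX_def by blast
    then have "X = X'" using mat_mult_right_cancel[OF Ac[OF that(1)] Ac[OF that(2)] K(1,2)] by simp
    then show False using that by simp
  qed
  \<comment> \<open>Count the $K$ conjugating $C$ into the symplectic group by the conjugate, then by the form $K^T J K$.\<close>
  have "card (\<Union>X\<in>A. KX X) = (\<Sum>X\<in>A. card (KX X))"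
    by (rule card_UN_disjoint) (use finA finK disj in auto)
  also have "\<dots> = card A * poly_totient (recip_lift m g)" using card_KX by simp
  finally have card1: "card (\<Union>X\<in>A. KX X) = card A * poly_totient (recip_lift m g)" .
  have PK: "(S * P H)\<^sup>T * sympl_J m * (S * P H) = hyperbolic_form m H" if S: "S \<in> Sp m" and H: "H \<in> HH" for S H
  proof -
    have Sc: "S \<in> carrier_mat ?N ?N" "S\<^sup>T * sympl_J m * S = sympl_J m" using S unfolding Sp_iff by auto
    show ?thesis unfolding congruence_mult[OF Sc(1) PHH(1)[OF H] J] Sc(2) by (rule PHH(3)[OF H])
  qed
  \<comment> \<open>H is read off from the pulled-back form K^T J K, and the quotient S of K by
    \<open>P H\<close> then preserves J.\<close>
  have "(\<Union>X\<in>A. KX X) = (\<lambda>(S, H). S * P H) ` (Sp m \<times> HH)"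
  proof (intro equalityI subsetI)
    fix K assume "K \<in> (\<Union>X\<in>A. KX X)"
    then obtain X where X: "X \<in> A" and K: "K \<in> carrier_mat ?N ?N" "det K \<noteq> 0" "X * K = K * C"
      unfolding KX_def by blast
    have "X \<in> Sp m" using X unfolding A_def by blast
    then have "C\<^sup>T * (K\<^sup>T * sympl_J m * K) * C = K\<^sup>T * sympl_J m * K"
      using Sp_conj_iff[OF K(1,2) Ac[OF X] C K(3)] by blast
    then obtain H where "H \<in> carrier_mat m m" "det H \<noteq> 0" "H * Y = Y\<^sup>T * H"
      and KH: "K\<^sup>T * sympl_J m * K = hyperbolic_form m H"
      using invariant_form_is_hyperbolic[OF Y(1) v K(1,2)] unfolding C_def by blast
    then have H: "H \<in> HH" unfolding HH_def by simp
    obtain L where L: "L \<in> carrier_mat ?N ?N" "P H * L = 1\<^sub>m ?N" "L * P H = 1\<^sub>m ?N"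
      using mat_inverse_exists[OF PHH(1,2)[OF H]] by blast
    define S where "S = K * L"
    have Sc: "S \<in> carrier_mat ?N ?N" unfolding S_def using K L by simp
    have "S * P H = K * (L * P H)" unfolding S_def using K(1) L(1) PHH(1)[OF H] by (simp add: mat_mult_assoc)
    then have SP: "S * P H = K" unfolding L(3) using K by simp
    have SJ: "S\<^sup>T * sympl_J m * S \<in> carrier_mat ?N ?N" using Sc by (auto intro!: mult_carrier_mat[of _ _ ?N])
    have "(P H)\<^sup>T * (S\<^sup>T * sympl_J m * S) * P H = (P H)\<^sup>T * sympl_J m * P H"
      unfolding congruence_mult[OF Sc PHH(1)[OF H] J, symmetric] SP KH PHH(3)[OF H] ..
    then have "S\<^sup>T * sympl_J m * S = sympl_J m" by (rule congruence_cancel[OF PHH(1,2)[OF H] SJ J])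
    then have "S \<in> Sp m" using Sc unfolding Sp_iff by blast
    then show "K \<in> (\<lambda>(S, H). S * P H) ` (Sp m \<times> HH)" using SP H by (intro image_eqI[of _ _ "(S, H)"]) auto
  next
    fix K assume "K \<in> (\<lambda>(S, H). S * P H) ` (Sp m \<times> HH)"
    then obtain S H where S: "S \<in> Sp m" and H: "H \<in> HH" and K: "K = S * P H" by auto
    have Sc: "S \<in> carrier_mat ?N ?N" using S unfolding Sp_iff by blast
    have Kc: "K \<in> carrier_mat ?N ?N" unfolding K using Sc PHH(1)[OF H] by simp
    have dK: "det K \<noteq> 0" unfolding K det_mult[OF Sc PHH(1)[OF H]] using Sp_det_nonzero[OF S] PHH(2)[OF H] by simp
    obtain L where L: "L \<in> carrier_mat ?N ?N" "K * L = 1\<^sub>m ?N" "L * K = 1\<^sub>m ?N"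
      using mat_inverse_exists[OF Kc dK] by blast
    define X where "X = K * C * L"
    have KC: "K * C \<in> carrier_mat ?N ?N" using Kc C by simp
    have Xc: "X \<in> carrier_mat ?N ?N" unfolding X_def using KC L(1) by simp
    have "X * K = K * C * (L * K)" unfolding X_def using Kc C L(1) by (simp add: mat_mult_assoc)
    then have XK: "X * K = K * C" unfolding L(3) right_mult_one_mat[OF KC] .
    have "similar_mat_wit X C K L"
      by (rule similar_mat_witI[OF L(2,3) X_def Xc C Kc L(1)])
    then have "char_poly X = char_poly C" by (intro char_poly_similar) (auto simp: similar_mat_def)
    moreover have "X \<in> Sp m"
      unfolding Sp_conj_iff[OF Kc dK Xc C XK] K PK[OF S H] C_def
      by (rule hyperbolic_form_invariant[OF Y(1) HHd(1,3)[OF H]])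
    ultimately have "X \<in> A" unfolding A_def using charC by simp
    then show "K \<in> (\<Union>X\<in>A. KX X)" using Kc dK XK unfolding KX_def by blast
  qed
  moreover have "inj_on (\<lambda>(S, H). S * P H) (Sp m \<times> HH)"
  proof (rule inj_onI, clarify)
    fix S H S' H' assume S: "S \<in> Sp m" "S' \<in> Sp m" and H: "H \<in> HH" "H' \<in> HH" and eq: "S * P H = S' * P H'"
    \<comment> \<open>The pulled-back form recovers H from the product; S follows by
      cancellation.\<close>
    have "hyperbolic_form m H = hyperbolic_form m H'" using PK[OF S(1) H(1)] PK[OF S(2) H(2)] eq by simp
    then have HH': "H = H'" unfolding hyperbolic_form_def
      using four_block_mat_inject[of "0\<^sub>m m m" H "- H" "0\<^sub>m m m" "0\<^sub>m m m" H' "- H'" "0\<^sub>m m m" m]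
        HHd(1)[OF H(1)] HHd(1)[OF H(2)] by simp
    have "S \<in> carrier_mat ?N ?N" "S' \<in> carrier_mat ?N ?N" using S unfolding Sp_iff by auto
    then have "S = S'" using mat_mult_right_cancel[OF _ _ PHH(1,2)[OF H(2)]] eq unfolding HH' by blast
    then show "S = S' \<and> H = H'" using HH' by simp
  qed
  ultimately have "card (\<Union>X\<in>A. KX X) = card (Sp m :: 'a mat set) * poly_totient g"
    by (simp add: card_image card_cartesian_product card_HH)
  then show ?thesis using card1 unfolding A_def by simp
qed

subsection \<open>Characteristic polynomials of separable symplectic matrices\<close>

text \<open>From X^T J X = J one gets X^T J (x - X) = (x X^T - 1) J. The determinants are det X
  times the characteristic polynomial on the left and its reversal on the right.\<close>

lemma coeff_char_poly_Sp:
  fixes X :: "'a::field mat"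
  assumes X: "X \<in> Sp m" and j: "j \<le> m + m"
  shows "coeff (char_poly X) (m + m - j) = det X * coeff (char_poly X) j"
proof -
  let ?N = "m + m" and ?x = "[:0, 1:] :: 'a poly" and ?C = "map_mat (\<lambda>c::'a. [:c:])"
  have lift: "comm_ring_hom (\<lambda>c::'a. [:c:])" by unfold_locales simp_all
  have Xc: "X \<in> carrier_mat ?N ?N" and XJ: "X\<^sup>T * sympl_J m * X = sympl_J m" using X unfolding Sp_iff by auto
  define L where "L = ?C X"
  define J where "J = ?C (sympl_J m)"
  have L: "L \<in> carrier_mat ?N ?N" unfolding L_def using Xc by simp
  have LT: "L\<^sup>T \<in> carrier_mat ?N ?N" using L by simp
  have J: "J \<in> carrier_mat ?N ?N" unfolding J_def by simp
  have LJ: "L\<^sup>T * J \<in> carrier_mat ?N ?N" using LT J by simp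
  have LJL: "L\<^sup>T * J * L = J"
  proof -
    have XT: "X\<^sup>T \<in> carrier_mat ?N ?N" using Xc by simp
    have "L\<^sup>T = ?C (X\<^sup>T)" unfolding L_def by (rule eq_matI) (use Xc in auto)
    then have "L\<^sup>T * J * L = ?C (X\<^sup>T * sympl_J m * X)"
      unfolding L_def J_def using map_poly_mult(1)[OF XT sympl_J_carrier]
        map_poly_mult(1)[OF mult_carrier_mat[OF XT sympl_J_carrier] Xc] by simp
    then show ?thesis unfolding XJ J_def .
  qed
  have lin: "(?x \<cdot>\<^sub>m U) * V = ?x \<cdot>\<^sub>m (U * V)" "U * (?x \<cdot>\<^sub>m V) = ?x \<cdot>\<^sub>m (U * V)"
    if "U \<in> carrier_mat ?N ?N" "V \<in> carrier_mat ?N ?N" for U V :: "'a poly mat"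
    using mult_smult_assoc_mat[OF that] mult_smult_distrib[OF that] by simp_all
  have one: "(1\<^sub>m ?N :: 'a poly mat) \<in> carrier_mat ?N ?N" by simp
  have Q: "char_poly_matrix X = ?x \<cdot>\<^sub>m 1\<^sub>m ?N - L"
    unfolding L_def char_poly_matrix_def by (rule eq_matI) (use Xc in auto)
  have Qc: "char_poly_matrix X \<in> carrier_mat ?N ?N" using Xc by simp
  have x1: "?x \<cdot>\<^sub>m 1\<^sub>m ?N \<in> carrier_mat ?N ?N" by simp
  have xL: "?x \<cdot>\<^sub>m L\<^sup>T \<in> carrier_mat ?N ?N" using LT by simp
  have "L\<^sup>T * J * char_poly_matrix X = L\<^sup>T * J * (?x \<cdot>\<^sub>m 1\<^sub>m ?N) - L\<^sup>T * J * L"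
    unfolding Q by (rule mult_minus_distrib_mat[OF LJ x1 L])
  also have "L\<^sup>T * J * (?x \<cdot>\<^sub>m 1\<^sub>m ?N) = ?x \<cdot>\<^sub>m (L\<^sup>T * J)"
    unfolding lin(2)[OF LJ one] right_mult_one_mat[OF LJ] ..
  also have "?x \<cdot>\<^sub>m (L\<^sup>T * J) = (?x \<cdot>\<^sub>m L\<^sup>T) * J" unfolding lin(1)[OF LT J] ..
  also have "(?x \<cdot>\<^sub>m L\<^sup>T) * J - L\<^sup>T * J * L = (?x \<cdot>\<^sub>m L\<^sup>T - 1\<^sub>m ?N) * J"
    unfolding LJL minus_mult_distrib_mat[OF xL one J] left_mult_one_mat[OF J] ..
  finally have key: "L\<^sup>T * J * char_poly_matrix X = (?x \<cdot>\<^sub>m L\<^sup>T - 1\<^sub>m ?N) * J" .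
  have detJ: "det J = 1"
    unfolding J_def comm_ring_hom.hom_det[OF lift] det_sympl_J by simp
  have detL: "det L = [:det X:]" unfolding L_def by (rule comm_ring_hom.hom_det[OF lift])
  have xL1: "?x \<cdot>\<^sub>m L\<^sup>T - 1\<^sub>m ?N \<in> carrier_mat ?N ?N" using xL by (auto intro: minus_carrier_mat)
  have "det (L\<^sup>T * J * char_poly_matrix X) = [:det X:] * char_poly X"
    unfolding det_mult[OF LJ Qc] det_mult[OF LT J] det_transpose[OF L] detL detJ char_poly_def by simp
  moreover have "det ((?x \<cdot>\<^sub>m L\<^sup>T - 1\<^sub>m ?N) * J) = det (?x \<cdot>\<^sub>m L\<^sup>T - 1\<^sub>m ?N)"
    unfolding det_mult[OF xL1 J] detJ by simp
  moreover have "?x \<cdot>\<^sub>m L\<^sup>T - 1\<^sub>m ?N = (- 1) \<cdot>\<^sub>m (1 \<cdot>\<^sub>m 1\<^sub>m ?N - ?x \<cdot>\<^sub>m L)\<^sup>T"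
    by (rule eq_matI) (use L in auto)
  moreover have "det ((- 1) \<cdot>\<^sub>m (1 \<cdot>\<^sub>m 1\<^sub>m ?N - ?x \<cdot>\<^sub>m L)\<^sup>T) = det (1 \<cdot>\<^sub>m 1\<^sub>m ?N - ?x \<cdot>\<^sub>m L)"
  proof -
    have c: "1 \<cdot>\<^sub>m 1\<^sub>m ?N - ?x \<cdot>\<^sub>m L \<in> carrier_mat ?N ?N" using L by (auto intro: minus_carrier_mat)
    \<comment> \<open>The even dimension absorbs the sign between x X^T - 1 and 1 - x X.\<close>
    have "(- 1 :: 'a poly) ^ (m + m) = 1" by (simp flip: mult_2)
    moreover have "dim_row L = m + m" using L by simp
    ultimately show ?thesis unfolding det_smult using c det_transpose[OF c] by simp
  qed
  ultimately have "[:det X:] * char_poly X = det (1 \<cdot>\<^sub>m 1\<^sub>m ?N - ?x \<cdot>\<^sub>m L)" using key by simp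
  also have "\<dots> = (\<Sum>i\<le>?N. [:coeff (char_poly X) i:] * 1 ^ i * ?x ^ (?N - i))"
    unfolding L_def by (rule det_homogenised_char_poly[OF Xc]) simp
  also have "\<dots> = (\<Sum>i\<le>?N. monom (coeff (char_poly X) i) (?N - i))"
    by (rule sum.cong) (simp_all add: monom_altdef)
  finally have "coeff ([:det X:] * char_poly X) j = coeff (\<Sum>i\<le>?N. monom (coeff (char_poly X) i) (?N - i)) j"
    by simp
  also have "\<dots> = (\<Sum>i\<le>?N. if i = ?N - j then coeff (char_poly X) i else 0)"
    unfolding coeff_sum by (rule sum.cong) (use j in auto)
  also have "\<dots> = coeff (char_poly X) (?N - j)" by simp
  finally show ?thesis by simp
qed

text \<open>A fixed vector $v = k(X) w$ with $w$ cyclic is orthogonal to the image of $X - 1$, and being isotropic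
  also to $w$ when $k(1) \ne 0$, hence to everything.\<close>
lemma separable_Sp_no_eigenvalue_1:
  fixes X :: "'a::{finite,field} mat"
  assumes X: "X \<in> Sp m" and sep: "coprime (char_poly X) (pderiv (char_poly X))"
  shows "poly (char_poly X) 1 \<noteq> 0"
proof
  let ?N = "m + m"
  have Xc: "X \<in> carrier_mat ?N ?N" and XJ: "X\<^sup>T * sympl_J m * X = sympl_J m" using X unfolding Sp_iff by auto
  have XT: "X\<^sup>T \<in> carrier_mat ?N ?N" using Xc by simp
  assume "poly (char_poly X) 1 = 0"
  then have "[:- 1, 1:] dvd char_poly X" by (simp add: poly_eq_0_iff_dvd)
  then obtain k where k: "char_poly X = [:- 1, 1:] * k" by (elim dvdE)
  have cop: "coprime [:- 1, 1:] k" using sep unfolding k separable_poly_mult_iff by blast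
  have k1: "poly k 1 \<noteq> 0"
  proof
    assume "poly k 1 = 0"
    then have "[:- 1, 1:] dvd k" by (simp add: poly_eq_0_iff_dvd)
    then have "is_unit [:- 1 :: 'a, 1:]" using coprime_common_divisor[OF cop dvd_refl] by blast
    then show False by (simp add: is_unit_iff_degree)
  qed
  obtain w where cyc: "cyclic_vec X w" using separable_imp_cyclic_vec[OF Xc sep] by blast
  note w = cyclic_vecD(1)[OF Xc cyc]
  define v where "v = mat_poly k X *\<^sub>v w"
  have v: "v \<in> carrier_vec ?N" unfolding v_def using Xc w by simp
  have f0: "char_poly X \<noteq> 0" using degree_monic_char_poly[OF Xc] by auto
  have "\<not> char_poly X dvd k"
  proof
    assume d: "char_poly X dvd k"
    have k0: "k \<noteq> 0" using f0 k by auto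
    then have "degree (char_poly X) = 1 + degree k" unfolding k by (subst degree_mult_eq) auto
    then show False using dvd_imp_degree_le[OF d k0] by simp
  qed
  then have v0: "v \<noteq> 0\<^sub>v ?N" unfolding v_def using cyclic_vecD(2)[OF Xc cyc] by blast
  have Xv: "X *\<^sub>v v = v"
  proof -
    have "char_poly X dvd [:0, 1:] * k - k" unfolding k by (simp add: algebra_simps)
    then have "mat_poly ([:0, 1:] * k) X *\<^sub>v w = mat_poly k X *\<^sub>v w" using cyclic_vec_eq_iff[OF Xc cyc] by blast
    then show ?thesis unfolding v_def mat_poly_act_mult[OF Xc w] mat_poly_var[OF Xc] .
  qed
  have Jv: "sympl_J m *\<^sub>v v \<in> carrier_vec ?N" by (rule mult_mat_vec_carrier[OF sympl_J_carrier v])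
  have inv: "(X *\<^sub>v s) \<bullet> (sympl_J m *\<^sub>v v) = s \<bullet> (sympl_J m *\<^sub>v v)" if s: "s \<in> carrier_vec ?N" for s
  proof -
    have "(X *\<^sub>v s) \<bullet> (sympl_J m *\<^sub>v v) = s \<bullet> (X\<^sup>T *\<^sub>v (sympl_J m *\<^sub>v v))"
      using transpose_vec_mult_scalar[OF XT Jv s] by simp
    also have "X\<^sup>T *\<^sub>v (sympl_J m *\<^sub>v v) = X\<^sup>T *\<^sub>v (sympl_J m *\<^sub>v (X *\<^sub>v v))" unfolding Xv ..
    also have "\<dots> = (X\<^sup>T * sympl_J m * X) *\<^sub>v v" using Xc v by (simp add: mat_vec_assoc)
    finally show ?thesis unfolding XJ .
  qed
  \<comment> \<open>\<open>X\<close> preserves the form and fixes v, so under pairing with v it acts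
    as 1, and r(X) acts as r(1).\<close>
  have form: "(mat_poly r X *\<^sub>v w) \<bullet> (sympl_J m *\<^sub>v v) = poly r 1 * (w \<bullet> (sympl_J m *\<^sub>v v))" for r
  proof (induction r)
    case 0
    then show ?case using Xc w Jv by (simp add: mult_zero_mat_vec[of _ ?N ?N])
  next
    case (pCons a r)
    let ?u = "mat_poly r X *\<^sub>v w"
    have u: "?u \<in> carrier_vec ?N" using Xc w by simp
    have "pCons a r = [:a:] + [:0, 1:] * r" by simp
    then have "mat_poly (pCons a r) X *\<^sub>v w = mat_poly [:a:] X *\<^sub>v w + X *\<^sub>v ?u"
      using mat_poly_act_add[OF Xc w] mat_poly_act_mult[OF Xc w] mat_poly_var[OF Xc] by metis
    also have "mat_poly [:a:] X *\<^sub>v w = a \<cdot>\<^sub>v w"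
      unfolding mat_poly_const[OF Xc] by (rule eq_vecI) (use w in auto)
    finally have "(mat_poly (pCons a r) X *\<^sub>v w) \<bullet> (sympl_J m *\<^sub>v v)
        = (a \<cdot>\<^sub>v w) \<bullet> (sympl_J m *\<^sub>v v) + (X *\<^sub>v ?u) \<bullet> (sympl_J m *\<^sub>v v)"
      using add_scalar_prod_distrib[of "a \<cdot>\<^sub>v w" ?N "X *\<^sub>v ?u"] Xc w u Jv by simp
    then show ?case unfolding inv[OF u] pCons.IH using w Jv by (simp add: algebra_simps)
  qed
  \<comment> \<open>For r = k the left side is v paired with itself, which is 0, while k(1) is
    nonzero.\<close>
  have "w \<bullet> (sympl_J m *\<^sub>v v) = 0"
    using form[of k] sympl_J_alternating[OF v] k1 unfolding v_def[symmetric] by simp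
  then have z: "u \<bullet> (sympl_J m *\<^sub>v v) = 0" if "u \<in> carrier_vec ?N" for u
    using form cyclic_vec_generates[OF Xc cyc that] by (metis mult_zero_right)
  have "sympl_J m *\<^sub>v v = 0\<^sub>v ?N"
  proof (rule eq_vecI)
    fix i assume "i < dim_vec (0\<^sub>v ?N :: 'a vec)"
    then have i: "i < ?N" by simp
    show "(sympl_J m *\<^sub>v v) $ i = 0\<^sub>v ?N $ i"
      using z[OF unit_vec_carrier[of ?N i]] scalar_prod_left_unit[OF Jv i] i by simp
  qed (use Jv in simp)
  then have "det (sympl_J m :: 'a mat) = 0" using det_0_iff_vec_prod_zero_field[OF sympl_J_carrier] v v0 by blast
  then show False by (simp add: det_sympl_J)
qed

text \<open>The determinant squares to 1. A value other than 1 would make the coefficients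
  antisymmetric and 1 a root, which \<open>separable_Sp_no_eigenvalue_1\<close> excludes; with
  determinant 1 they are palindromic.\<close>

theorem char_poly_separable_Sp:
  fixes X :: "'a::{finite,field} mat"
  assumes X: "X \<in> Sp m" and sep: "coprime (char_poly X) (pderiv (char_poly X))"
  obtains g where "monic g" "degree g = m" "char_poly X = recip_lift m g"
proof -
  let ?N = "m + m"
  have Xc: "X \<in> carrier_mat ?N ?N" and XJ: "X\<^sup>T * sympl_J m * X = sympl_J m" using X unfolding Sp_iff by auto
  have deg: "degree (char_poly X) = ?N" "monic (char_poly X)" using degree_monic_char_poly[OF Xc] by auto
  note co = coeff_char_poly_Sp[OF X]
  have XT: "X\<^sup>T \<in> carrier_mat ?N ?N" using Xc by simp
  have "det (X\<^sup>T * sympl_J m * X) = det X * det X"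
    unfolding det_mult[OF mult_carrier_mat[OF XT sympl_J_carrier] Xc] det_mult[OF XT sympl_J_carrier]
      det_transpose[OF Xc] det_sympl_J by simp
  then have dd: "det X * det X = 1" unfolding XJ det_sympl_J by simp
  have "det X = 1"
  proof (rule ccontr)
    assume n1: "det X \<noteq> 1"
    have "(det X - 1) * (det X + 1) = 0" using dd by (simp add: algebra_simps)
    then have dm: "det X = - 1" using n1 by (simp add: eq_neg_iff_add_eq_0)
    have "poly (char_poly X) 1 = (\<Sum>i\<le>?N. coeff (char_poly X) i)" by (simp add: poly_altdef deg)
    also have "\<dots> = (\<Sum>i\<le>?N. coeff (char_poly X) (?N - i))"
      by (rule sum.reindex_bij_witness[of _ "\<lambda>i. ?N - i" "\<lambda>i. ?N - i"]) auto
    also have "\<dots> = (\<Sum>i\<le>?N. - coeff (char_poly X) i)"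
      by (rule sum.cong) (use co dm in auto)
    also have "\<dots> = - poly (char_poly X) 1" by (simp add: poly_altdef deg sum_negf)
    finally have "(1 - det X) * poly (char_poly X) 1 = 0" unfolding dm by (simp add: eq_neg_iff_add_eq_0)
    then have "poly (char_poly X) 1 = 0" using n1 by simp
    then show False using separable_Sp_no_eigenvalue_1[OF X sep] by blast
  qed
  then have "palindromic (2 * m) (char_poly X)"
    unfolding palindromic_def mult_2 using co deg by (auto intro: coeff_eq_0)
  moreover have "degree (char_poly X) = 2 * m" using deg by simp
  ultimately obtain g where "monic g" "degree g = m" "char_poly X = recip_lift m g"
    using deg(2) by (elim monic_palindromic_imp_recip_lift)
  then show ?thesis by (rule that)
qed

subsection \<open>Powers in the symplectic group and residues modulo the characteristic polynomial\<close>

lemma pcompose_monom_one: "pcompose (monom 1 M) h = (h :: 'a::comm_ring_1 poly) ^ M"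
  by (induction M) (simp_all add: monom_0 monom_Suc pcompose_pCons)

lemma pcompose_power: "pcompose (p ^ k) h = (pcompose p (h :: 'a::comm_ring_1 poly)) ^ k"
  by (induction k) (simp_all add: pcompose_1 pcompose_mult)

lemma pcompose_cong:
  fixes a b :: "'a::field poly"
  assumes "[a = b] (mod d)" shows "[pcompose p a = pcompose p b] (mod d)"
proof (induction p)
  case (pCons c p)
  show ?case unfolding pcompose_pCons by (intro cong_add cong_mult cong_refl assms pCons.IH)
qed simp

lemma pcompose_cong_left:
  fixes p q :: "'a::field poly"
  assumes "[p = q] (mod e)" "d dvd pcompose e y" shows "[pcompose p y = pcompose q y] (mod d)"
proof -
  obtain k where "p - q = e * k" using assms(1) unfolding cong_iff_dvd_diff by (elim dvdE)
  then have "pcompose p y - pcompose q y = pcompose e y * pcompose k y"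
    by (simp add: pcompose_mult flip: pcompose_diff)
  then show ?thesis unfolding cong_iff_dvd_diff using assms(2) by simp
qed

lemma cong_inverse_unique:
  fixes u w w' d :: "'a::field poly"
  assumes "[u * w = 1] (mod d)" "[u * w' = 1] (mod d)" shows "[w = w'] (mod d)"
proof -
  have "[w * 1 = w * (u * w')] (mod d)" by (intro cong_mult cong_refl cong_sym[OF assms(2)])
  also have "w * (u * w') = (u * w) * w'" by (simp add: algebra_simps)
  also have "[(u * w) * w' = 1 * w'] (mod d)" by (intro cong_mult cong_refl assms(1))
  finally show ?thesis by simp
qed

section \<open>Inverting the variable modulo a polynomial\<close>

lemma reflect_poly_as_sum:
  fixes p :: "'a::comm_ring_1 poly"
  shows "reflect_poly p = (\<Sum>i\<le>degree p. monom (coeff p i) (degree p - i))"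
proof (rule poly_eqI)
  fix n
  have "coeff (\<Sum>i\<le>degree p. monom (coeff p i) (degree p - i)) n
    = (\<Sum>i\<le>degree p. if n \<le> degree p \<and> i = degree p - n then coeff p i else 0)"
    unfolding coeff_sum by (rule sum.cong) auto
  also have "\<dots> = coeff (reflect_poly p) n" by (auto simp: coeff_reflect_poly)
  finally show "coeff (reflect_poly p) n = coeff (\<Sum>i\<le>degree p. monom (coeff p i) (degree p - i)) n" ..
qed

text \<open>With w = 1/u modulo \<open>d\<close>, multiplying p(1/u) by u^n clears denominators and
  reverses the coefficients. The formal degree \<open>n\<close> is left free for Horner's
  induction.\<close>

lemma power_mult_pcompose_inverse:
  fixes u w d :: "'a::field poly"
  assumes uw: "[u * w = 1] (mod d)" and "degree p \<le> n"
  shows "[u ^ n * pcompose p w = pcompose (\<Sum>i\<le>n. monom (coeff p i) (n - i)) u] (mod d)"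
  using assms(2)
proof (induction p arbitrary: n)
  case (pCons c p)
  show ?case
  proof (cases n)
    case 0
    then have "p = 0" using pCons by (auto split: if_splits)
    then show ?thesis using 0 by (simp add: monom_0)
  next
    case (Suc k)
    have dk: "degree p \<le> k" using pCons.prems Suc by (cases "p = 0") auto
    have "u ^ n * pcompose (pCons c p) w = pcompose (monom c n) u + (u * w) * (u ^ k * pcompose p w)"
    proof -
      have "pcompose (monom c n) u = [:c:] * u ^ n"
        using pcompose_smult[of c "monom 1 n" u] by (simp add: smult_monom pcompose_monom_one)
      then show ?thesis unfolding pcompose_pCons Suc by (simp add: algebra_simps)
    qed
    also have "[\<dots> = pcompose (monom c n) u + 1 * pcompose (\<Sum>i\<le>k. monom (coeff p i) (k - i)) u] (mod d)"
      by (intro cong_add cong_mult cong_refl uw pCons.IH[OF dk])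
    also have "pcompose (monom c n) u + 1 * pcompose (\<Sum>i\<le>k. monom (coeff p i) (k - i)) u
      = pcompose (\<Sum>i\<le>n. monom (coeff (pCons c p) i) (n - i)) u"
      unfolding Suc sum.atMost_Suc_shift by (simp add: pcompose_add)
    finally show ?thesis .
  qed
qed simp

text \<open>The two values differ by a power of the unit u modulo \<open>d\<close>.\<close>

lemma dvd_pcompose_inverse_iff:
  fixes u w d :: "'a::field poly"
  assumes uw: "[u * w = 1] (mod d)"
  shows "d dvd pcompose p w \<longleftrightarrow> d dvd pcompose (reflect_poly p) u"
proof -
  let ?n = "degree p"
  have c: "[u ^ ?n * pcompose p w = pcompose (reflect_poly p) u] (mod d)"
    unfolding reflect_poly_as_sum by (rule power_mult_pcompose_inverse[OF uw order_refl])
  have c': "[w ^ ?n * (u ^ ?n * pcompose p w) = pcompose p w] (mod d)"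
  proof -
    have "w ^ ?n * (u ^ ?n * pcompose p w) = (u * w) ^ ?n * pcompose p w"
      by (simp add: power_mult_distrib mult_ac)
    also have "[\<dots> = 1 ^ ?n * pcompose p w] (mod d)" by (intro cong_mult cong_pow uw cong_refl)
    finally show ?thesis by simp
  qed
  have dvd_iff: "d dvd a \<longleftrightarrow> d dvd b" if "[a = b] (mod d)" for a b
    using that unfolding cong_def by (simp add: dvd_eq_mod_eq_0)
  have "d dvd u ^ ?n * pcompose p w \<longleftrightarrow> d dvd pcompose (reflect_poly p) u" by (rule dvd_iff[OF c])
  moreover have "d dvd w ^ ?n * (u ^ ?n * pcompose p w) \<longleftrightarrow> d dvd pcompose p w" by (rule dvd_iff[OF c'])
  ultimately show ?thesis using dvd_mult by blast
qed

lemma inverse_of_var_exists: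
  fixes f :: "'a::field poly"
  assumes "coeff f 0 \<noteq> 0"
  obtains y where "[[:0, 1:] * y = 1] (mod f)"
proof -
  obtain c f' where f: "f = pCons c f'" by (cases f)
  then have c: "c \<noteq> 0" using assms by simp
  \<comment> \<open>From f = c + x f' one reads off that -f'/c inverts x modulo f.\<close>
  define y where "y = Polynomial.smult (- inverse c) f'"
  have "[:0, 1:] * y - 1 = Polynomial.smult (- inverse c) f"
    unfolding y_def f using c by (simp add: one_pCons)
  then have "f dvd [:0, 1:] * y - 1" by (simp add: dvd_smult)
  then show ?thesis using that unfolding cong_iff_dvd_diff by blast
qed

text \<open>Here $y$ is $1/x$ modulo $f$; the last condition $h(1/x) h(x) = 1$ says that $h(X)$ is symplectic.\<close>
definition sympl_power_poly :: "nat \<Rightarrow> 'a::field poly \<Rightarrow> bool" where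
  "sympl_power_poly M f \<longleftrightarrow> (\<exists>h y. [[:0, 1:] * y = 1] (mod f) \<and> [h ^ M = [:0, 1:]] (mod f)
     \<and> [pcompose h y * h = 1] (mod f))"

lemma mat_poly_cong:
  fixes X :: "'a::field mat"
  assumes X: "X \<in> carrier_mat n n" and "[p = q] (mod char_poly X)"
  shows "mat_poly p X = mat_poly q X"
proof -
  obtain k where "p - q = k * char_poly X" using assms(2) unfolding cong_iff_dvd_diff dvd_def
    by (auto simp: mult.commute)
  then have "p = q + k * char_poly X" by (simp add: algebra_simps)
  then have "mat_poly p X = mat_poly q X + mat_poly k X * 0\<^sub>m n n"
    by (simp add: mat_poly_add[OF X] mat_poly_mult[OF X] cayley_hamilton_mat[OF X])
  then show ?thesis using X by simp
qed

lemma mat_poly_eq_imp_cong: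
  fixes X :: "'a::field mat"
  assumes X: "X \<in> carrier_mat n n" "cyclic_vec X v" and "mat_poly p X = mat_poly q X"
  shows "[p = q] (mod char_poly X)"
  unfolding cong_iff_dvd_diff using cyclic_vec_eq_iff[OF X, of p q] assms(3) by simp

text \<open>With respect to J the adjoint of a symplectic \<open>X\<close> is its inverse, so the
  adjoint of h(X) is h evaluated at that inverse.\<close>

lemma transpose_mat_poly_sympl_J:
  fixes X :: "'a::field mat"
  assumes X: "X \<in> Sp m" and y: "[[:0, 1:] * y = 1] (mod char_poly X)"
  shows "(mat_poly h X)\<^sup>T * sympl_J m = sympl_J m * mat_poly (pcompose h y) X"
proof -
  let ?N = "m + m"
  have Xc: "X \<in> carrier_mat ?N ?N" and XJ: "X\<^sup>T * sympl_J m * X = sympl_J m" using X unfolding Sp_iff by auto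
  have XT: "X\<^sup>T \<in> carrier_mat ?N ?N" using Xc by simp
  let ?Y = "mat_poly y X"
  have Y: "?Y \<in> carrier_mat ?N ?N" using Xc by simp
  have XY: "X * ?Y = 1\<^sub>m ?N"
    using mat_poly_cong[OF Xc y] unfolding mat_poly_mult[OF Xc] mat_poly_var[OF Xc] mat_poly_1[OF Xc] .
  have XTJ: "X\<^sup>T * sympl_J m \<in> carrier_mat ?N ?N" by (rule mult_carrier_mat[OF XT sympl_J_carrier])
  have "X\<^sup>T * sympl_J m = X\<^sup>T * sympl_J m * (X * ?Y)" unfolding XY right_mult_one_mat[OF XTJ] ..
  also have "\<dots> = (X\<^sup>T * sympl_J m * X) * ?Y" using XTJ Xc Y by (simp add: mat_mult_assoc)
  finally have "X\<^sup>T * sympl_J m = sympl_J m * ?Y" unfolding XJ .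
  then show ?thesis unfolding mat_poly_transpose[OF Xc] mat_poly_pcompose[OF Xc]
    by (rule mat_poly_intertwine[OF XT Y sympl_J_carrier])
qed

theorem Mth_power_Sp_iff:
  fixes X :: "'a::{finite,field} mat"
  assumes X: "X \<in> Sp m" and sep: "coprime (char_poly X) (pderiv (char_poly X))"
  shows "is_Mth_power_Sp M m X \<longleftrightarrow> sympl_power_poly M (char_poly X)"
proof -
  let ?N = "m + m" and ?f = "char_poly X"
  have Xc: "X \<in> carrier_mat ?N ?N" and XJ: "X\<^sup>T * sympl_J m * X = sympl_J m" using X unfolding Sp_iff by auto
  obtain v where v: "cyclic_vec X v" using separable_imp_cyclic_vec[OF Xc sep] by blast
  have form: "(mat_poly h X)\<^sup>T * sympl_J m * mat_poly h X = sympl_J m * mat_poly (pcompose h y * h) X"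
    if "[[:0, 1:] * y = 1] (mod ?f)" for h y
    unfolding transpose_mat_poly_sympl_J[OF X that] mat_poly_mult[OF Xc]
    using Xc by (intro mat_mult_assoc) (auto simp del: sympl_J_dim simp: carrier_matD[OF sympl_J_carrier])
  show ?thesis
  proof
    assume "sympl_power_poly M ?f"
    then obtain h y where y: "[[:0, 1:] * y = 1] (mod ?f)" and h: "[h ^ M = [:0, 1:]] (mod ?f)"
      and hh: "[pcompose h y * h = 1] (mod ?f)" unfolding sympl_power_poly_def by blast
    define Z where "Z = mat_poly h X"
    have "Z ^\<^sub>m M = X"
      using mat_poly_cong[OF Xc h] unfolding Z_def mat_poly_power[OF Xc] mat_poly_var[OF Xc] .
    moreover have "Z\<^sup>T * sympl_J m * Z = sympl_J m"
      unfolding Z_def form[OF y] mat_poly_cong[OF Xc hh] mat_poly_1[OF Xc] right_mult_one_mat[OF sympl_J_carrier] ..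
    then have "Z \<in> Sp m" unfolding Sp_iff Z_def using Xc by simp
    ultimately show "is_Mth_power_Sp M m X" unfolding is_Mth_power_Sp_def by blast
  next
    assume "is_Mth_power_Sp M m X"
    then obtain Z where Z: "Z \<in> Sp m" "Z ^\<^sub>m M = X" unfolding is_Mth_power_Sp_def by blast
    have Zc: "Z \<in> carrier_mat ?N ?N" "Z\<^sup>T * sympl_J m * Z = sympl_J m" using Z unfolding Sp_iff by auto
    have "mat_poly ([:0, 1:] ^ M) Z = X" unfolding mat_poly_power[OF Zc(1)] mat_poly_var[OF Zc(1)] Z(2) ..
    then have "Z * X = X * Z"
      using mat_poly_intertwine[OF Zc(1) Zc(1) Zc(1) refl, of "[:0, 1:] ^ M"] by simp
    then obtain h where h: "Z = mat_poly h X" using commutant_cyclic[OF Xc v Zc(1)] by blast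
    obtain g where g: "monic g" "degree g = m" "?f = recip_lift m g" using char_poly_separable_Sp[OF X sep] by blast
    have "coeff ?f 0 \<noteq> 0" unfolding g(3) coeff_0_recip_lift using g by simp
    then obtain y where y: "[[:0, 1:] * y = 1] (mod ?f)" using inverse_of_var_exists by blast
    have "mat_poly (h ^ M) X = mat_poly [:0, 1:] X"
      unfolding mat_poly_power[OF Xc] mat_poly_var[OF Xc] h[symmetric] Z(2) ..
    then have 1: "[h ^ M = [:0, 1:]] (mod ?f)" by (rule mat_poly_eq_imp_cong[OF Xc v])
    have "sympl_J m * mat_poly (pcompose h y * h) X = sympl_J m * mat_poly 1 X"
      using Zc(2) unfolding h form[OF y] mat_poly_1[OF Xc] right_mult_one_mat[OF sympl_J_carrier] .
    then have "mat_poly (pcompose h y * h) X = mat_poly 1 X"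
      by (rule mat_mult_left_cancel[OF mat_poly_carrier[OF Xc] mat_poly_carrier[OF Xc] sympl_J_carrier, rotated])
        (simp add: det_sympl_J)
    then have "[pcompose h y * h = 1] (mod ?f)" by (rule mat_poly_eq_imp_cong[OF Xc v])
    then show "sympl_power_poly M ?f" using 1 y unfolding sympl_power_poly_def by blast
  qed
qed

text \<open>Local solutions are glued by the Chinese remainder theorem. As the condition involves x
  -> 1/x, each factor has to be stable under this substitution, which is what divisibility of its
  reversal provides.\<close>

lemma sympl_power_poly_mult:
  fixes f g :: "'a::field poly"
  assumes cop: "coprime f g" and f: "coeff f 0 \<noteq> 0" "f dvd reflect_poly f"
    and g: "coeff g 0 \<noteq> 0" "g dvd reflect_poly g"
  shows "sympl_power_poly M (f * g) \<longleftrightarrow> sympl_power_poly M f \<and> sympl_power_poly M g"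
proof
  assume "sympl_power_poly M (f * g)"
  then show "sympl_power_poly M f \<and> sympl_power_poly M g"
    unfolding sympl_power_poly_def by (meson cong_dvd_modulus dvd_triv_left dvd_triv_right)
next
  assume "sympl_power_poly M f \<and> sympl_power_poly M g"
  then obtain h1 y1 h2 y2 where
    1: "[[:0, 1:] * y1 = 1] (mod f)" "[h1 ^ M = [:0, 1:]] (mod f)" "[pcompose h1 y1 * h1 = 1] (mod f)" and
    2: "[[:0, 1:] * y2 = 1] (mod g)" "[h2 ^ M = [:0, 1:]] (mod g)" "[pcompose h2 y2 * h2 = 1] (mod g)"
    unfolding sympl_power_poly_def by blast
  have "coeff (f * g) 0 \<noteq> 0" using f g by (simp add: coeff_mult)
  then obtain y where y: "[[:0, 1:] * y = 1] (mod (f * g))" using inverse_of_var_exists by blast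
  obtain h where h: "f dvd h - h1" "g dvd h - h2" using coprime_field_poly_crt[OF cop] by blast
  have local: "[[:0, 1:] * y = 1] (mod e)" "[h ^ M = [:0, 1:]] (mod e)" "[pcompose h y * h = 1] (mod e)"
    if e: "e dvd f * g" "e dvd reflect_poly e" and hk: "e dvd h - k"
      and k: "[[:0, 1:] * z = 1] (mod e)" "[k ^ M = [:0, 1:]] (mod e)" "[pcompose k z * k = 1] (mod e)" for e k z
  proof -
    show ye: "[[:0, 1:] * y = 1] (mod e)" using y e(1) by (rule cong_dvd_modulus)
    have hk': "[h = k] (mod e)" using hk by (simp add: cong_iff_dvd_diff)
    show "[h ^ M = [:0, 1:]] (mod e)" using cong_trans[OF cong_pow[OF hk'] k(2)] .
    \<comment> \<open>Substitution of y maps the ideal of \<open>e\<close> into itself, so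
      congruences modulo \<open>e\<close> survive it.\<close>
    have "e dvd pcompose e y" using dvd_pcompose_inverse_iff[OF ye, of e] e(2) by simp
    then have "[pcompose h y = pcompose k y] (mod e)" by (rule pcompose_cong_left[OF hk'])
    moreover have "[pcompose k y = pcompose k z] (mod e)"
      by (rule pcompose_cong[OF cong_inverse_unique[OF ye k(1)]])
    ultimately have "[pcompose h y = pcompose k z] (mod e)" by (rule cong_trans)
    from cong_trans[OF cong_mult[OF this hk'] k(3)] show "[pcompose h y * h = 1] (mod e)" .
  qed
  have both: "[a = b] (mod (f * g))" if "[a = b] (mod f)" "[a = b] (mod g)" for a b
    using that coprime_field_poly_divides_mult[OF cop] unfolding cong_iff_dvd_diff by blast
  note lf = local[OF dvd_triv_left f(2) h(1) 1] and lg = local[OF dvd_triv_right g(2) h(2) 2]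
  show "sympl_power_poly M (f * g)"
    unfolding sympl_power_poly_def using both[OF lf(2) lg(2)] both[OF lf(3) lg(3)] y by blast
qed

lemma reflect_poly_recip_lift:
  assumes "monic g" "degree g = m" shows "reflect_poly (recip_lift m g) = recip_lift m g"
proof (rule poly_eqI)
  fix i
  have deg: "degree (recip_lift m g) = 2 * m" using degree_monic_recip_lift[OF assms] by simp
  show "coeff (reflect_poly (recip_lift m g)) i = coeff (recip_lift m g) i"
    using palindromic_recip_lift[of m g] unfolding coeff_reflect_poly deg palindromic_def by auto
qed

lemma sympl_power_poly_recip_lift_prod:
  assumes "finite A" "\<And>a. a \<in> A \<Longrightarrow> monic a" "\<And>a b. a \<in> A \<Longrightarrow> b \<in> A \<Longrightarrow> a \<noteq> b \<Longrightarrow> coprime a b"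
  shows "sympl_power_poly M (\<Prod>a\<in>A. recip_lift (degree a) a) \<longleftrightarrow>
    (\<forall>a\<in>A. sympl_power_poly M (recip_lift (degree a) a))"
  using assms
proof (induction A rule: finite_induct)
  case empty
  show ?case by (auto simp: sympl_power_poly_def)
next
  case (insert x A)
  have x: "monic x" and A: "\<And>a. a \<in> A \<Longrightarrow> monic a" using insert.prems(1) by simp_all
  have mA: "monic (\<Prod>a\<in>A. a)" using A by (intro monic_prod) auto
  have "coprime (\<Prod>a\<in>A. a) x"
    using insert.hyps insert.prems(2) by (intro coprime_field_poly_prod) auto
  then have cop: "coprime x (\<Prod>a\<in>A. a)" by (simp add: coprime_commute)
  have pr: "(\<Prod>a\<in>A. recip_lift (degree a) a) = recip_lift (degree (\<Prod>a\<in>A. a)) (\<Prod>a\<in>A. a)"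
    using recip_lift_prod[OF insert.hyps(1) A] by simp
  have self: "coeff (recip_lift (degree b) b) 0 \<noteq> 0" "recip_lift (degree b) b dvd reflect_poly (recip_lift (degree b) b)"
    if "monic b" for b :: "'a poly"
    using that by (simp_all add: coeff_0_recip_lift reflect_poly_recip_lift)
  have "sympl_power_poly M (recip_lift (degree x) x * (\<Prod>a\<in>A. recip_lift (degree a) a))
    \<longleftrightarrow> sympl_power_poly M (recip_lift (degree x) x) \<and> sympl_power_poly M (\<Prod>a\<in>A. recip_lift (degree a) a)"
    unfolding pr by (rule sympl_power_poly_mult[OF recip_lift_coprime[OF cop x refl refl] self[OF x] self[OF mA]])
  then show ?case using insert by simp
qed

subsection \<open>Power polynomials over a finite field\<close>

text \<open>\<open>h\<close> generates the residue field of \<open>a\<close> because x is a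
  polynomial in it. Its minimal polynomial p exists by pigeonhole, and comparing cardinalities of
  the two residue fields gives the degree.\<close>

lemma residue_generator_min_poly:
  fixes a h k :: "'a::{finite,field} poly"
  assumes a: "irreducible a" and gen: "[pcompose k h = [:0, 1:]] (mod a)"
  obtains p where "monic p" "irreducible p" "degree p = degree a" "\<And>r. a dvd pcompose r h \<longleftrightarrow> p dvd r"
proof -
  let ?n = "degree a" and ?q = "card (UNIV :: 'a set)"
  have a0: "a \<noteq> 0" using a by auto
  have "card {0 :: 'a, 1} \<le> ?q" by (rule card_mono) auto
  then have q: "?q > 1" by simp
  define F where "F r = pcompose r h mod a" for r
  have Fin: "F r \<in> deg_lt ?n" for r unfolding F_def by (rule mod_in_deg_lt[OF a0])
  have Feq: "F r = F s \<longleftrightarrow> a dvd pcompose (r - s) h" for r s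
    unfolding F_def pcompose_diff by (simp add: mod_eq_dvd_iff)
  \<comment> \<open>There are q^(n+1) polynomials of degree at most n but only q^n residues, so two
    of them agree at \<open>h\<close>.\<close>
  have "card (F ` deg_lt (Suc ?n)) \<le> card (deg_lt ?n :: 'a poly set)"
    by (rule card_mono) (use Fin in auto)
  then have "card (F ` deg_lt (Suc ?n)) < card (deg_lt (Suc ?n) :: 'a poly set)"
    unfolding card_deg_lt using q by (simp add: power_strict_increasing_iff order.strict_trans1)
  then have "\<not> inj_on F (deg_lt (Suc ?n))" using pigeonhole by blast
  then obtain r s where "F r = F s" "r \<noteq> s" unfolding inj_on_def by blast
  then have "a dvd pcompose (r - s) h \<and> r - s \<noteq> 0" using Feq by simp
  then obtain p0 where p0: "a dvd pcompose p0 h" "p0 \<noteq> 0"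
    and minimal: "\<And>r. a dvd pcompose r h \<Longrightarrow> r \<noteq> 0 \<Longrightarrow> degree p0 \<le> degree r"
    using ex_has_least_nat[of "\<lambda>r. a dvd pcompose r h \<and> r \<noteq> 0" _ degree] by blast
  define p where "p = Polynomial.smult (inverse (lead_coeff p0)) p0"
  have mon: "monic p" unfolding p_def using p0(2) by simp
  have p1: "p \<noteq> 0" "degree p = degree p0" unfolding p_def using p0(2) by simp_all
  have pa: "a dvd pcompose p h" unfolding p_def pcompose_smult using p0(1) by (rule dvd_smult)
  have iff: "a dvd pcompose r h \<longleftrightarrow> p dvd r" for r
  proof
    assume "p dvd r"
    then obtain t where "r = p * t" by (elim dvdE)
    then show "a dvd pcompose r h" using pa by (simp add: pcompose_mult)
  next
    assume r: "a dvd pcompose r h"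
    have "r mod p = r - (r div p) * p" by (simp add: minus_div_mult_eq_mod)
    then have m: "a dvd pcompose (r mod p) h" using r pa by (simp add: pcompose_diff pcompose_mult)
    have "r mod p = 0"
    proof (rule ccontr)
      assume nz: "r mod p \<noteq> 0"
      then show False using minimal[OF m nz] degree_mod_less'[OF p1(1) nz] p1(2) by simp
    qed
    then show "p dvd r" by (simp add: dvd_eq_mod_eq_0)
  qed
  have irr: "irreducible p"
  proof (rule irreducibleI)
    show "p \<noteq> 0" by (rule p1(1))
    show "\<not> is_unit p"
    proof
      assume "is_unit p"
      then have "p dvd 1" .
      then have "a dvd pcompose 1 h" using iff by blast
      then show False using irreducible_not_unit[OF a] by (simp add: pcompose_1)
    qed
    fix b c assume bc: "p = b * c"
    then have nz: "b \<noteq> 0" "c \<noteq> 0" using p1(1) by auto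
    then have deg: "degree p = degree b + degree c" using bc by (simp add: degree_mult_eq)
    have "a dvd pcompose b h * pcompose c h" using pa unfolding bc pcompose_mult .
    then have "a dvd pcompose b h \<or> a dvd pcompose c h" using irreducible_field_poly_dvd_mult[OF a] by blast
    then have "p dvd b \<or> p dvd c" using iff by blast
    then have "degree p \<le> degree b \<or> degree p \<le> degree c" using nz dvd_imp_degree_le by blast
    then have "degree c = 0 \<or> degree b = 0" using deg by linarith
    then show "is_unit b \<or> is_unit c" using nz by (auto simp: is_unit_iff_degree)
  qed
  have inj: "inj_on F (deg_lt (degree p))"
  proof (rule inj_onI)
    fix r s assume rs: "r \<in> deg_lt (degree p)" "s \<in> deg_lt (degree p)" "F r = F s"
    then have "p dvd r - s" using Feq iff by blast
    then show "r = s" using rs deg_lt_congD by blast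
  qed
  \<comment> \<open>Surjectivity: every t is t(k(h)) modulo \<open>a\<close>, and t(k) may be
    reduced modulo \<open>p\<close>.\<close>
  have "F ` deg_lt (degree p) = deg_lt ?n"
  proof (intro equalityI subsetI)
    fix t :: "'a poly" assume t: "t \<in> deg_lt ?n"
    let ?r = "pcompose t k mod p"
    have "[pcompose t (pcompose k h) = pcompose t [:0, 1:]] (mod a)" by (rule pcompose_cong[OF gen])
    then have 1: "[pcompose (pcompose t k) h = t] (mod a)" unfolding pcompose_assoc pcompose_idR .
    have "p dvd pcompose t k - ?r" by (simp add: minus_mod_eq_mult_div)
    then have "a dvd pcompose (pcompose t k) h - pcompose ?r h" using iff unfolding pcompose_diff[symmetric] by blast
    then have "[pcompose (pcompose t k) h = pcompose ?r h] (mod a)" by (simp add: cong_iff_dvd_diff)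
    then have "[pcompose ?r h = t] (mod a)" using 1 cong_sym cong_trans by blast
    then have Ft: "F ?r = t mod a" unfolding F_def cong_def .
    have "a dvd t mod a - t" by (simp add: mod_eq_dvd_iff[symmetric])
    then have "F ?r = t" unfolding Ft by (rule deg_lt_congD[OF mod_in_deg_lt[OF a0] t])
    moreover have "?r \<in> deg_lt (degree p)" by (rule mod_in_deg_lt[OF p1(1)])
    ultimately show "t \<in> F ` deg_lt (degree p)" by (intro image_eqI[of _ _ ?r]) simp_all
  qed (use Fin in auto)
  then have "card (deg_lt (degree p) :: 'a poly set) = card (deg_lt ?n :: 'a poly set)"
    using card_image[OF inj] by simp
  then have "degree p = ?n" unfolding card_deg_lt using q by (simp add: power_inject_exp)
  then show ?thesis using that[OF mon irr _ iff] by blast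
qed

text \<open>Substituting \<open>h\<close> maps the residue field of \<open>a\<close> to that of
  \<open>b\<close>; it is injective as a map of fields, and equal degrees make it bijective.\<close>

lemma same_degree_residue_iso:
  fixes a b h :: "'a::{finite,field} poly"
  assumes a: "irreducible a" and b: "irreducible b" and deg: "degree b = degree a" and dvd: "b dvd pcompose a h"
  shows "b dvd pcompose p h \<longleftrightarrow> a dvd p" and "\<exists>r. [pcompose r h = [:0, 1:]] (mod b)"
proof -
  show iff: "b dvd pcompose p h \<longleftrightarrow> a dvd p" for p
  proof
    assume "a dvd p"
    then obtain t where "p = a * t" by (elim dvdE)
    then show "b dvd pcompose p h" using dvd by (simp add: pcompose_mult)
  next
    assume p: "b dvd pcompose p h"
    show "a dvd p"
    proof (rule ccontr)
      assume "\<not> a dvd p"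
      then have "coprime a p" by (rule irreducible_field_poly_coprime[OF a])
      then obtain s t where st: "s * a + t * p = 1" using coprime_field_poly_iff_bezout by blast
      have "b dvd pcompose s h * pcompose a h + pcompose t h * pcompose p h" using dvd p by simp
      also have "\<dots> = pcompose (s * a + t * p) h" by (simp add: pcompose_add pcompose_mult)
      finally show False unfolding st pcompose_1 using irreducible_not_unit[OF b] by blast
    qed
  qed
  have b0: "b \<noteq> 0" using b by auto
  define F where "F r = pcompose r h mod b" for r
  have inj: "inj_on F (deg_lt (degree a))"
  proof (rule inj_onI)
    fix r s assume rs: "r \<in> deg_lt (degree a)" "s \<in> deg_lt (degree a)" "F r = F s"
    then have "b dvd pcompose (r - s) h" unfolding F_def pcompose_diff by (simp add: mod_eq_dvd_iff)
    then have "a dvd r - s" using iff by blast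
    then show "r = s" using rs deg_lt_congD by blast
  qed
  have "F ` deg_lt (degree a) = deg_lt (degree b)"
  proof (rule card_subset_eq)
    show "F ` deg_lt (degree a) \<subseteq> deg_lt (degree b)" unfolding F_def using mod_in_deg_lt[OF b0] by blast
    show "card (F ` deg_lt (degree a)) = card (deg_lt (degree b) :: 'a poly set)"
      unfolding card_image[OF inj] card_deg_lt deg ..
  qed simp
  then have "[:0, 1:] mod b \<in> F ` deg_lt (degree a)" using mod_in_deg_lt[OF b0] by simp
  then obtain r where "F r = [:0, 1:] mod b" by auto
  then show "\<exists>r. [pcompose r h = [:0, 1:]] (mod b)" unfolding F_def cong_def by blast
qed

text \<open>An M-th root of x modulo \<open>a\<close> generates the residue field, since x is a
  polynomial in it; its minimal polynomial is the desired factor, because \<open>a\<close> vanishes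
  at its M-th power.\<close>

lemma irreducible_dvd_pcompose_monom:
  fixes a :: "'a::{finite,field} poly"
  assumes a: "irreducible a" and h: "[h ^ M = [:0, 1:]] (mod a)"
  obtains p where "monic p" "irreducible p" "degree p = degree a" "p dvd pcompose a (monom 1 M)"
    "\<And>r. a dvd pcompose r h \<longleftrightarrow> p dvd r"
proof -
  have "[pcompose (monom 1 M) h = [:0, 1:]] (mod a)" using h unfolding pcompose_monom_one .
  then obtain p where p: "monic p" "irreducible p" "degree p = degree a" "\<And>r. a dvd pcompose r h \<longleftrightarrow> p dvd r"
    using residue_generator_min_poly[OF a] by metis
  have "[pcompose a (h ^ M) = pcompose a [:0, 1:]] (mod a)" by (rule pcompose_cong[OF h])
  then have "a dvd pcompose a (h ^ M)" unfolding pcompose_idR cong_def by (simp add: dvd_eq_mod_eq_0)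
  then have "a dvd pcompose (pcompose a (monom 1 M)) h" unfolding pcompose_assoc[symmetric] pcompose_monom_one .
  then have "p dvd pcompose a (monom 1 M)" using p(4) by blast
  then show ?thesis using that[OF p(1-3) _ p(4)] by blast
qed

text \<open>Modulo \<open>b\<close>, x is an M-th root of x^M, a root of \<open>a\<close>. Equal
  degrees make x^M a generator, so x = r(x^M), and taking M-th powers across the isomorphism gives
  an M-th root of x modulo \<open>a\<close>.\<close>

lemma power_residue_if_dvd_pcompose_monom:
  fixes a b :: "'a::{finite,field} poly"
  assumes a: "irreducible a" and b: "irreducible b" and deg: "degree b = degree a"
    and dvd: "b dvd pcompose a (monom 1 M)"
  obtains r where "[r ^ M = [:0, 1:]] (mod a)" "[pcompose r (monom 1 M) = [:0, 1:]] (mod b)"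
proof -
  obtain r where r: "[pcompose r (monom 1 M) = [:0, 1:]] (mod b)" using same_degree_residue_iso(2)[OF assms] by blast
  have "[(pcompose r (monom 1 M)) ^ M = [:0, 1:] ^ M] (mod b)" by (rule cong_pow[OF r])
  then have "b dvd pcompose (r ^ M - [:0, 1:]) (monom 1 M)"
    by (simp add: cong_iff_dvd_diff pcompose_diff pcompose_power pcompose_pCons monom_altdef)
  then have "[r ^ M = [:0, 1:]] (mod a)" unfolding same_degree_residue_iso(1)[OF assms] cong_iff_dvd_diff .
  then show ?thesis using that r by blast
qed

section \<open>Symplectic roots at self-reciprocal polynomials and at reciprocal pairs\<close>

lemma irreducible_coeff_0:
  fixes p :: "'a::field poly"
  assumes "irreducible p" "coeff p 0 = 0" shows "p dvd [:0, 1:]"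
proof -
  have "[:0, 1:] dvd p" using assms(2) poly_eq_0_iff_dvd[of p 0] by (simp add: poly_0_coeff_0)
  moreover have "\<not> is_unit ([:0, 1:] :: 'a poly)" by (simp add: is_unit_iff_degree)
  ultimately show ?thesis using irreducibleD'[OF assms(1)] by blast
qed

lemma monic_recip_poly:
  fixes p :: "'a::field poly"
  assumes "coeff p 0 \<noteq> 0"
  shows "degree (recip_poly p) = degree p" "monic (recip_poly p)"
  unfolding recip_poly_def using assms by (simp_all add: coeff_reflect_poly)

lemma recip_poly_dvd_iff:
  fixes p :: "'a::field poly"
  assumes "coeff p 0 \<noteq> 0"
  shows "d dvd recip_poly p \<longleftrightarrow> d dvd reflect_poly p" "recip_poly p dvd d \<longleftrightarrow> reflect_poly p dvd d"
  unfolding recip_poly_def using assms by (simp_all add: dvd_smult_iff smult_dvd_iff)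

text \<open>Let p be the minimal polynomial of the root h. The symplectic condition reads h(1/x) =
  1/h, and inversion preserves the ideal of \<open>f\<close>, so 1/h is again a root of p and p is
  self-reciprocal. Conversely, inverting x = r(x^M) modulo a SRIM factor gives r(x^(-M)) = 1/x; the
  product of the two pulls back to r(1/x) r = 1 modulo \<open>f\<close>.\<close>

theorem sympl_power_poly_SRIM_iff:
  fixes f :: "'a::{finite,field} poly"
  assumes f: "SRIM f" and ev: "even (degree f)"
  shows "sympl_power_poly M f \<longleftrightarrow> M_star_power_SRIM M f"
proof -
  have fi: "irreducible f" and f0: "coeff f 0 \<noteq> 0" and fr: "f = recip_poly f" using f unfolding SRIM_def by auto
  have self: "b dvd pcompose b z" if "SRIM b" "[[:0, 1:] * z = 1] (mod b)" for b z :: "'a poly"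
  proof -
    have "coeff b 0 \<noteq> 0" "b = recip_poly b" using that(1) unfolding SRIM_def by auto
    then have "b dvd reflect_poly b" using recip_poly_dvd_iff(1)[of b b] by simp
    then show ?thesis using dvd_pcompose_inverse_iff[OF that(2), of b] by simp
  qed
  show ?thesis
  proof
    assume "sympl_power_poly M f"
    then obtain h y where y: "[[:0, 1:] * y = 1] (mod f)" and h: "[h ^ M = [:0, 1:]] (mod f)"
      and hh: "[pcompose h y * h = 1] (mod f)" unfolding sympl_power_poly_def by blast
    obtain p where p: "monic p" "irreducible p" "degree p = degree f" "p dvd pcompose f (monom 1 M)"
      and iff: "\<And>r. f dvd pcompose r h \<longleftrightarrow> p dvd r"
      using irreducible_dvd_pcompose_monom[OF fi h] by blast
    \<comment> \<open>A vanishing constant term would mean h = 0 modulo \<open>f\<close>, although h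
      is a unit there.\<close>
    have p0: "coeff p 0 \<noteq> 0"
    proof
      assume "coeff p 0 = 0"
      then have "p dvd [:0, 1:]" by (rule irreducible_coeff_0[OF p(2)])
      then have "f dvd pcompose [:0, 1:] h" using iff by blast
      then have "f dvd pcompose h y * h" by (simp add: pcompose_pCons)
      then have "f dvd 1" using hh unfolding cong_def by (simp add: dvd_eq_mod_eq_0)
      then show False using irreducible_not_unit[OF fi] by blast
    qed
    have "f dvd pcompose p h" unfolding iff by (rule dvd_refl)
    then obtain t where "pcompose p h = f * t" by (elim dvdE)
    then have "pcompose p (pcompose h y) = pcompose f y * pcompose t y"
      unfolding pcompose_assoc by (simp add: pcompose_mult)
    then have "f dvd pcompose p (pcompose h y)" using self[OF f y] by simp
    moreover have "[h * pcompose h y = 1] (mod f)" using hh by (simp add: mult.commute)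
    ultimately have "f dvd pcompose (reflect_poly p) h" using dvd_pcompose_inverse_iff by blast
    then have "p dvd recip_poly p" using iff recip_poly_dvd_iff(1)[OF p0] by blast
    then have "p = recip_poly p" using monic_dvd_same_degree[OF p(1)] monic_recip_poly[OF p0] by simp
    then have "SRIM p" unfolding SRIM_def using p p0 by blast
    then show "M_star_power_SRIM M f" unfolding M_star_power_SRIM_def using f ev p by blast
  next
    assume "M_star_power_SRIM M f"
    then obtain b where b: "SRIM b" "degree b = degree f" "b dvd pcompose f (monom 1 M)"
      unfolding M_star_power_SRIM_def by blast
    have bi: "irreducible b" "coeff b 0 \<noteq> 0" using b(1) unfolding SRIM_def by auto
    obtain r where r: "[r ^ M = [:0, 1:]] (mod f)" "[pcompose r (monom 1 M) = [:0, 1:]] (mod b)"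
      using power_residue_if_dvd_pcompose_monom[OF fi bi(1) b(2,3)] by blast
    obtain y where y: "[[:0, 1:] * y = 1] (mod f)" using inverse_of_var_exists[OF f0] by blast
    obtain z where z: "[[:0, 1:] * z = 1] (mod b)" using inverse_of_var_exists[OF bi(2)] by blast
    let ?x = "[:0, 1:] :: 'a poly" and ?P = "monom (1 :: 'a) M"
    have P: "?P = ?x ^ M" by (simp add: monom_altdef)
    \<comment> \<open>Both sides invert x^M modulo \<open>b\<close>.\<close>
    have yz: "[pcompose y ?P = z ^ M] (mod b)"
    proof (rule cong_inverse_unique)
      have "[pcompose (?x * y) ?P = pcompose 1 ?P] (mod b)" by (rule pcompose_cong_left[OF y b(3)])
      then show "[?P * pcompose y ?P = 1] (mod b)" by (simp add: pcompose_mult pcompose_1 pcompose_pCons)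
      have "[(?x * z) ^ M = 1 ^ M] (mod b)" by (rule cong_pow[OF z])
      then show "[?P * z ^ M = 1] (mod b)" unfolding P power_mult_distrib by simp
    qed
    have "[pcompose (pcompose r y) ?P = pcompose r (z ^ M)] (mod b)"
      unfolding pcompose_assoc[symmetric] by (rule pcompose_cong[OF yz])
    also have "pcompose r (z ^ M) = pcompose (pcompose r ?P) z"
      unfolding pcompose_assoc[symmetric] pcompose_monom_one ..
    also have "[pcompose (pcompose r ?P) z = pcompose ?x z] (mod b)"
      by (rule pcompose_cong_left[OF r(2) self[OF b(1) z]])
    finally have ry: "[pcompose (pcompose r y) ?P = z] (mod b)" by (simp add: pcompose_pCons)
    have "[pcompose (pcompose r y) ?P * pcompose r ?P = z * ?x] (mod b)" by (rule cong_mult[OF ry r(2)])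
    also have "z * ?x = ?x * z" by (rule mult.commute)
    also have "[?x * z = 1] (mod b)" by (rule z)
    finally have "b dvd pcompose (pcompose r y * r - 1) ?P"
      unfolding cong_iff_dvd_diff pcompose_diff pcompose_mult pcompose_1 .
    then have "[pcompose r y * r = 1] (mod f)"
      unfolding same_degree_residue_iso(1)[OF fi bi(1) b(2,3)] cong_iff_dvd_diff .
    then show "sympl_power_poly M f" unfolding sympl_power_poly_def using r(1) y by blast
  qed
qed

text \<open>Inversion exchanges the residue fields of \<open>\<phi>\<close> and its reciprocal. So
  an arbitrary root r can be used at \<open>\<phi>\<close>, and the condition prescribes the root at
  the other factor: 1/r transported by inversion.\<close>

theorem sympl_power_poly_pair_iff:
  fixes \<phi> :: "'a::{finite,field} poly"
  assumes \<phi>: "monic \<phi>" "irreducible \<phi>" "coeff \<phi> 0 \<noteq> 0" and cop: "coprime \<phi> (recip_poly \<phi>)" and M: "M > 0"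
  shows "sympl_power_poly M (\<phi> * recip_poly \<phi>) \<longleftrightarrow> M_power_poly M \<phi>"
proof
  assume "sympl_power_poly M (\<phi> * recip_poly \<phi>)"
  then obtain h where "[h ^ M = [:0, 1:]] (mod (\<phi> * recip_poly \<phi>))" unfolding sympl_power_poly_def by blast
  then have "[h ^ M = [:0, 1:]] (mod \<phi>)" by (rule cong_dvd_modulus) simp
  then obtain p where "monic p" "irreducible p" "degree p = degree \<phi>" "p dvd pcompose \<phi> (monom 1 M)"
    using irreducible_dvd_pcompose_monom[OF \<phi>(2)] by metis
  moreover have "\<phi> \<noteq> [:0, 1:]" using \<phi>(3) by auto
  ultimately show "M_power_poly M \<phi>" unfolding M_power_poly_def using \<phi> by blast
next
  assume "M_power_poly M \<phi>"
  then obtain b where b: "irreducible b" "degree b = degree \<phi>" "b dvd pcompose \<phi> (monom 1 M)"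
    unfolding M_power_poly_def by blast
  let ?x = "[:0, 1:] :: 'a poly" and ?\<psi> = "recip_poly \<phi>" and ?f = "\<phi> * recip_poly \<phi>"
  obtain r where r: "[r ^ M = ?x] (mod \<phi>)" using power_residue_if_dvd_pcompose_monom[OF \<phi>(2) b] by blast
  have rc: "coeff ?\<psi> 0 \<noteq> 0" unfolding recip_poly_def using \<phi> by simp
  then have "coeff ?f 0 \<noteq> 0" using \<phi>(3) by (simp add: coeff_mult)
  then obtain y where y: "[?x * y = 1] (mod ?f)" using inverse_of_var_exists by blast
  have y1: "[?x * y = 1] (mod \<phi>)" by (rule cong_dvd_modulus[OF y]) simp
  have y2: "[?x * y = 1] (mod ?\<psi>)" by (rule cong_dvd_modulus[OF y]) simp
  have "?\<psi> dvd reflect_poly \<phi>" using recip_poly_dvd_iff(1)[OF \<phi>(3), of ?\<psi>] by simp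
  then have d1: "?\<psi> dvd pcompose \<phi> y" using dvd_pcompose_inverse_iff[OF y2, of \<phi>] by simp
  have "\<phi> dvd reflect_poly ?\<psi>"
    unfolding recip_poly_def reflect_poly_smult using \<phi>(3) by (simp add: dvd_smult)
  then have d2: "\<phi> dvd pcompose ?\<psi> y" using dvd_pcompose_inverse_iff[OF y1, of ?\<psi>] by simp
  \<comment> \<open>This is 1/(1/x) = x. Substituting y is legitimate modulo the product because it
    maps the ideal of each factor into that of the other.\<close>
  have yy: "[pcompose y y = ?x] (mod ?f)"
  proof (rule cong_inverse_unique)
    have "?\<psi> * \<phi> dvd pcompose \<phi> y * pcompose ?\<psi> y" by (rule mult_dvd_mono[OF d1 d2])
    then have "?f dvd pcompose ?f y" unfolding pcompose_mult by (simp add: mult.commute)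
    then have "[pcompose (?x * y) y = pcompose 1 y] (mod ?f)" by (rule pcompose_cong_left[OF y])
    then show "[y * pcompose y y = 1] (mod ?f)" by (simp add: pcompose_mult pcompose_1 pcompose_pCons)
    show "[y * ?x = 1] (mod ?f)" using y by (simp add: mult.commute)
  qed
  have yy1: "[pcompose y y = ?x] (mod \<phi>)" by (rule cong_dvd_modulus[OF yy]) simp
  have yy2: "[pcompose y y = ?x] (mod ?\<psi>)" by (rule cong_dvd_modulus[OF yy]) simp
  \<comment> \<open>The inverse of r modulo \<open>\<phi>\<close>, as r^M = x turns 1/r into
    r^(M-1)/x.\<close>
  define s where "s = r ^ (M - 1) * y"
  have rs: "[r * s = 1] (mod \<phi>)"
  proof -
    have "r * s = r ^ M * y" unfolding s_def using M by (simp add: power_eq_if)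
    also have "[\<dots> = ?x * y] (mod \<phi>)" by (rule cong_mult[OF r cong_refl])
    also have "[?x * y = 1] (mod \<phi>)" by (rule y1)
    finally show ?thesis .
  qed
  have sM: "[s ^ M = y] (mod \<phi>)"
  proof (rule cong_inverse_unique[OF _ y1])
    have "[?x * s ^ M = r ^ M * s ^ M] (mod \<phi>)" by (rule cong_mult[OF cong_sym[OF r] cong_refl])
    also have "r ^ M * s ^ M = (r * s) ^ M" by (simp add: power_mult_distrib)
    also have "[(r * s) ^ M = 1 ^ M] (mod \<phi>)" by (rule cong_pow[OF rs])
    finally show "[?x * s ^ M = 1] (mod \<phi>)" by simp
  qed
  obtain h where "\<phi> dvd h - r" "?\<psi> dvd h - pcompose s y" using coprime_field_poly_crt[OF cop] by blast
  then have h1: "[h = r] (mod \<phi>)" and h2: "[h = pcompose s y] (mod ?\<psi>)" by (simp_all add: cong_iff_dvd_diff)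
  have both: "[a = c] (mod ?f)" if "[a = c] (mod \<phi>)" "[a = c] (mod ?\<psi>)" for a c
    using that coprime_field_poly_divides_mult[OF cop] unfolding cong_iff_dvd_diff by blast
  have "[h ^ M = ?x] (mod ?f)"
  proof (rule both)
    show "[h ^ M = ?x] (mod \<phi>)" by (rule cong_trans[OF cong_pow[OF h1] r])
    have "[h ^ M = pcompose s y ^ M] (mod ?\<psi>)" by (rule cong_pow[OF h2])
    also have "pcompose s y ^ M = pcompose (s ^ M) y" by (simp add: pcompose_power)
    also have "[pcompose (s ^ M) y = pcompose y y] (mod ?\<psi>)" by (rule pcompose_cong_left[OF sM d1])
    also have "[pcompose y y = ?x] (mod ?\<psi>)" by (rule yy2)
    finally show "[h ^ M = ?x] (mod ?\<psi>)" .
  qed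
  moreover have "[pcompose h y * h = 1] (mod ?f)"
  proof (rule both)
    have "[pcompose h y = pcompose (pcompose s y) y] (mod \<phi>)" by (rule pcompose_cong_left[OF h2 d2])
    also have "pcompose (pcompose s y) y = pcompose s (pcompose y y)" by (simp add: pcompose_assoc)
    also have "[pcompose s (pcompose y y) = pcompose s ?x] (mod \<phi>)" by (rule pcompose_cong[OF yy1])
    finally have "[pcompose h y = s] (mod \<phi>)" unfolding pcompose_idR .
    then have "[pcompose h y * h = s * r] (mod \<phi>)" by (rule cong_mult[OF _ h1])
    also have "s * r = r * s" by (rule mult.commute)
    also have "[r * s = 1] (mod \<phi>)" by (rule rs)
    finally show "[pcompose h y * h = 1] (mod \<phi>)" .
    have "[pcompose h y = pcompose r y] (mod ?\<psi>)" by (rule pcompose_cong_left[OF h1 d1])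
    then have "[pcompose h y * h = pcompose r y * pcompose s y] (mod ?\<psi>)" by (rule cong_mult[OF _ h2])
    also have "pcompose r y * pcompose s y = pcompose (r * s) y" by (simp add: pcompose_mult)
    also have "[pcompose (r * s) y = pcompose 1 y] (mod ?\<psi>)" by (rule pcompose_cong_left[OF rs d1])
    finally show "[pcompose h y * h = 1] (mod ?\<psi>)" by (simp add: pcompose_1)
  qed
  ultimately show "sympl_power_poly M ?f" unfolding sympl_power_poly_def using y by blast
qed

subsection \<open>Irreducible factors of $x^d a(x + 1/x)$\<close>

abbreviation recip_lift_deg :: "'a::field poly \<Rightarrow> 'a poly" where
  "recip_lift_deg a \<equiv> recip_lift (degree a) a"

lemma distinct_monic_irreducible_coprime:
  fixes a b :: "'a::field poly"
  assumes "monic a" "irreducible a" "monic b" "irreducible b" "a \<noteq> b"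
  shows "coprime a b"
  using irreducible_field_poly_coprime[OF assms(2)] monic_irreducible_dvd_eq[OF assms(1,3,2,4)] assms(5) by blast

lemma reflect_dvd_reflect: "(p :: 'a::field poly) dvd q \<Longrightarrow> reflect_poly p dvd reflect_poly q"
  by (auto simp: reflect_poly_mult elim!: dvdE)

lemma reflect_fixed_imp_recip_lift:
  fixes p :: "'a::field poly"
  assumes "reflect_poly p = p" "monic p" "degree p = 2 * n"
  obtains b where "monic b" "degree b = n" "p = recip_lift n b"
proof -
  have c: "coeff p i = (if i > 2 * n then 0 else coeff p (2 * n - i))" for i
    using coeff_reflect_poly[of p i] assms(1,3) by simp
  have "palindromic (2 * n) p" unfolding palindromic_def
  proof (intro conjI allI impI)
    fix i assume "i \<le> 2 * n"
    then show "coeff p (2 * n - i) = coeff p i" using c[of i] by simp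
  next
    fix i assume "i > 2 * n"
    then show "coeff p i = 0" using c[of i] by simp
  qed
  then show ?thesis using assms(2,3) that by (rule monic_palindromic_imp_recip_lift)
qed

lemma reflect_poly_eq_smult_recip_poly:
  fixes p :: "'a::field poly"
  assumes "coeff p 0 \<noteq> 0" shows "reflect_poly p = Polynomial.smult (coeff p 0) (recip_poly p)"
  unfolding recip_poly_def using assms by simp

lemma reflect_recip_poly:
  fixes p :: "'a::field poly"
  assumes "coeff p 0 \<noteq> 0" shows "reflect_poly (recip_poly p) = Polynomial.smult (inverse (coeff p 0)) p"
  unfolding recip_poly_def using assms by (simp add: reflect_poly_smult)

lemma coeff_0_recip_poly:
  fixes p :: "'a::field poly"
  assumes "monic p" shows "coeff (recip_poly p) 0 = inverse (coeff p 0)"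
  unfolding recip_poly_def using assms by (simp add: coeff_reflect_poly)

lemma recip_recip_poly:
  fixes p :: "'a::field poly"
  assumes "monic p" "coeff p 0 \<noteq> 0" shows "recip_poly (recip_poly p) = p"
  unfolding recip_poly_def[of "recip_poly p"] coeff_0_recip_poly[OF assms(1)] reflect_recip_poly[OF assms(2)]
  using assms(2) by simp

lemma reflect_mult_recip_poly:
  fixes p :: "'a::field poly"
  assumes "coeff p 0 \<noteq> 0" shows "reflect_poly (p * recip_poly p) = p * recip_poly p"
  unfolding reflect_poly_mult reflect_poly_eq_smult_recip_poly[OF assms] reflect_recip_poly[OF assms]
  using assms by simp

text \<open>The reversal of an irreducible factor of \<open>recip_poly p\<close> divides
  \<open>p\<close>, hence has full degree, so that factor is already everything.\<close>

lemma irreducible_recip_poly: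
  fixes p :: "'a::field poly"
  assumes "monic p" "irreducible p" "coeff p 0 \<noteq> 0"
  shows "irreducible (recip_poly p)"
proof -
  have deg: "degree (recip_poly p) = degree p" "monic (recip_poly p)" using monic_recip_poly[OF assms(3)] by auto
  then have "degree (recip_poly p) > 0" using irreducible_field_poly_degree_pos[OF assms(2)] by simp
  then obtain b where b: "monic b" "irreducible b" "b dvd recip_poly p" by (rule monic_irreducible_factor_exists)
  have b0: "coeff b 0 \<noteq> 0"
  proof
    assume "coeff b 0 = 0"
    then have "coeff (recip_poly p) 0 = 0" using b(3) by (auto elim!: dvdE simp: coeff_mult)
    then show False using coeff_0_recip_poly[OF assms(1)] assms(3) by simp
  qed
  have "reflect_poly b dvd reflect_poly (recip_poly p)" using b(3) by (rule reflect_dvd_reflect)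
  then have "reflect_poly b dvd p"
    unfolding reflect_recip_poly[OF assms(3)] using assms(3) by (simp add: dvd_smult_iff)
  moreover have nu: "\<not> is_unit (reflect_poly b)"
    using irreducible_field_poly_degree_pos[OF b(2)] b0 by (simp add: is_unit_iff_degree)
  ultimately have "p dvd reflect_poly b" using irreducibleD'[OF assms(2)] by blast
  moreover have "reflect_poly b \<noteq> 0" using b(1) by auto
  ultimately have "degree p \<le> degree b" using dvd_imp_degree_le[of p "reflect_poly b"] b0 by simp
  then have "b = recip_poly p" using monic_dvd_same_degree[OF b(1) deg(2) b(3)] deg(1) by simp
  then show ?thesis using b(2) by simp
qed

lemma recip_lift_deg_facts:
  fixes a :: "'a::field poly"
  assumes "monic a"
  shows "degree (recip_lift_deg a) = 2 * degree a" "monic (recip_lift_deg a)" "coeff (recip_lift_deg a) 0 = 1"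
    "reflect_poly (recip_lift_deg a) = recip_lift_deg a" "recip_poly (recip_lift_deg a) = recip_lift_deg a"
    "recip_lift_deg a \<noteq> 0"
proof -
  show "degree (recip_lift_deg a) = 2 * degree a" "monic (recip_lift_deg a)"
    using degree_monic_recip_lift[OF assms refl] by auto
  show c: "coeff (recip_lift_deg a) 0 = 1" using assms by (simp add: coeff_0_recip_lift)
  show r: "reflect_poly (recip_lift_deg a) = recip_lift_deg a" by (rule reflect_poly_recip_lift[OF assms refl])
  show "recip_poly (recip_lift_deg a) = recip_lift_deg a" unfolding recip_poly_def c r by simp
  show "recip_lift_deg a \<noteq> 0" using c by auto
qed

lemma recip_lift_deg_not_unit:
  fixes a :: "'a::field poly"
  assumes "monic a" "irreducible a" shows "\<not> is_unit (recip_lift_deg a)"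
  using recip_lift_deg_facts(1)[OF assms(1)] irreducible_field_poly_degree_pos[OF assms(2)]
  by (simp add: is_unit_iff_degree)

lemma common_factor_imp_recip_lift_dvd:
  fixes a b c :: "'a::field poly"
  assumes a: "monic a" "irreducible a" and b: "b \<noteq> 0"
    and c: "\<not> is_unit c" "c dvd recip_lift_deg a" "c dvd recip_lift_deg b"
  shows "recip_lift_deg a dvd recip_lift_deg b"
proof (rule recip_lift_dvd[OF _ b])
  show "a dvd b"
  proof (rule ccontr)
    assume "\<not> a dvd b"
    then have "coprime a b" by (rule irreducible_field_poly_coprime[OF a(2)])
    then have "coprime (recip_lift_deg a) (recip_lift_deg b)" by (rule recip_lift_coprime[OF _ a(1) refl refl])
    then show False using coprime_common_divisor[OF _ c(2,3)] c(1) by blast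
  qed
qed

lemma coeff_0_nonzero_of_dvd:
  fixes p q :: "'a::field poly"
  assumes "p dvd q" "coeff q 0 \<noteq> 0" shows "coeff p 0 \<noteq> 0"
  using assms by (auto elim!: dvdE simp: coeff_mult)

text \<open>Let \<open>\<phi>\<close> be an irreducible factor of the lift. The product with its
  reciprocal is palindromic, so it is the lift of some b; sharing \<open>\<phi>\<close> with it, the
  lift of the irreducible \<open>a\<close> must divide that product.\<close>

lemma reducible_recip_lift_deg:
  fixes a :: "'a::field poly"
  assumes a: "monic a" "irreducible a" and sep: "coprime (recip_lift_deg a) (pderiv (recip_lift_deg a))"
    and red: "\<not> irreducible (recip_lift_deg a)"
  obtains \<phi> where "monic \<phi>" "irreducible \<phi>" "coeff \<phi> 0 \<noteq> 0" "\<phi> \<noteq> recip_poly \<phi>" "degree \<phi> = degree a"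
    "recip_lift_deg a = \<phi> * recip_poly \<phi>"
proof -
  let ?f = "recip_lift_deg a"
  note f = recip_lift_deg_facts[OF a(1)]
  have "degree ?f > 0" using f(1) irreducible_field_poly_degree_pos[OF a(2)] by simp
  then obtain \<phi> where \<phi>: "monic \<phi>" "irreducible \<phi>" "\<phi> dvd ?f" by (rule monic_irreducible_factor_exists)
  have \<phi>0: "coeff \<phi> 0 \<noteq> 0" using coeff_0_nonzero_of_dvd[OF \<phi>(3)] f(3) by simp
  note r = monic_recip_poly[OF \<phi>0]
  have ri: "irreducible (recip_poly \<phi>)" by (rule irreducible_recip_poly[OF \<phi>(1,2) \<phi>0])
  have "reflect_poly \<phi> dvd ?f" using reflect_dvd_reflect[OF \<phi>(3)] f(4) by simp
  then have rd: "recip_poly \<phi> dvd ?f" using recip_poly_dvd_iff(2)[OF \<phi>0] by blast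
  have nz: "\<phi> \<noteq> 0" "recip_poly \<phi> \<noteq> 0" using \<phi>(1) r(2) by auto
  have degp: "degree (\<phi> * recip_poly \<phi>) = 2 * degree \<phi>" using nz r(1) by (simp add: degree_mult_eq)
  have monp: "monic (\<phi> * recip_poly \<phi>)" using \<phi>(1) r(2) by (rule monic_mult)
  obtain b where b: "monic b" "degree b = degree \<phi>" "\<phi> * recip_poly \<phi> = recip_lift (degree \<phi>) b"
    using reflect_fixed_imp_recip_lift[OF reflect_mult_recip_poly[OF \<phi>0] monp degp] by blast
  have b3: "\<phi> * recip_poly \<phi> = recip_lift_deg b" using b by simp
  have "?f dvd recip_lift_deg b"
  proof (rule common_factor_imp_recip_lift_dvd[OF a])
    show "b \<noteq> 0" using b(1) by auto
    show "\<not> is_unit \<phi>" by (rule irreducible_not_unit[OF \<phi>(2)])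
    show "\<phi> dvd recip_lift_deg b" unfolding b3[symmetric] by simp
  qed (rule \<phi>(3))
  then have fd: "?f dvd \<phi> * recip_poly \<phi>" unfolding b3 .
  \<comment> \<open>Otherwise the lift divides the square of \<open>\<phi>\<close>, and separability
    leaves only \<open>\<phi>\<close> up to a unit, which is irreducible.\<close>
  have ne: "\<phi> \<noteq> recip_poly \<phi>"
  proof
    assume eq: "\<phi> = recip_poly \<phi>"
    obtain k where k: "?f = \<phi> * k" using \<phi>(3) by (elim dvdE)
    have "\<phi> * k dvd \<phi> * \<phi>" using fd eq k by simp
    then have "k dvd \<phi>" using nz(1) by simp
    then have "is_unit k \<or> \<phi> dvd k" using irreducibleD'[OF \<phi>(2)] by blast
    moreover have "\<not> \<phi> dvd k"
    proof
      assume "\<phi> dvd k"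
      moreover have "coprime \<phi> k" using sep unfolding k separable_poly_mult_iff by blast
      ultimately have "is_unit \<phi>" using coprime_common_divisor[of \<phi> k \<phi>] by simp
      then show False using irreducible_not_unit[OF \<phi>(2)] by blast
    qed
    ultimately have "is_unit k" by blast
    then have "irreducible ?f" unfolding k using \<phi>(2) irreducible_mult_unit_right[of k \<phi>] by simp
    then show False using red by blast
  qed
  then have "coprime \<phi> (recip_poly \<phi>)"
    by (rule distinct_monic_irreducible_coprime[OF \<phi>(1,2) r(2) ri])
  then have "\<phi> * recip_poly \<phi> dvd ?f" using \<phi>(3) rd by (rule coprime_field_poly_divides_mult)
  then have eq: "\<phi> * recip_poly \<phi> = ?f"
    using monic_dvd_same_degree[OF monp f(2)] dvd_imp_degree_le[OF fd] nz by simp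
  have "2 * degree \<phi> = 2 * degree a" using degp f(1) unfolding eq by simp
  then show ?thesis using that[OF \<phi>(1,2) \<phi>0 ne _ eq[symmetric]] by simp
qed

text \<open>The product is palindromic, hence the lift of some b. The lift of an irreducible factor
  a of b contains \<open>\<phi>\<close> or its reciprocal and, being palindromic, both; degrees then
  force a = b.\<close>

lemma pair_is_recip_lift_deg:
  fixes \<phi> :: "'a::{finite,field} poly"
  assumes \<phi>: "monic \<phi>" "irreducible \<phi>" "coeff \<phi> 0 \<noteq> 0" "\<phi> \<noteq> recip_poly \<phi>"
  obtains a where "monic a" "irreducible a" "degree a = degree \<phi>" "recip_lift_deg a = \<phi> * recip_poly \<phi>"
    "coprime (recip_lift_deg a) (pderiv (recip_lift_deg a))" "\<not> irreducible (recip_lift_deg a)"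
proof -
  note r = monic_recip_poly[OF \<phi>(3)]
  have ri: "irreducible (recip_poly \<phi>)" by (rule irreducible_recip_poly[OF \<phi>(1-3)])
  have cop: "coprime \<phi> (recip_poly \<phi>)"
    by (rule distinct_monic_irreducible_coprime[OF \<phi>(1,2) r(2) ri \<phi>(4)])
  have nz: "\<phi> \<noteq> 0" "recip_poly \<phi> \<noteq> 0" using \<phi>(1) r(2) by auto
  have degp: "degree (\<phi> * recip_poly \<phi>) = 2 * degree \<phi>" using nz r(1) by (simp add: degree_mult_eq)
  have monp: "monic (\<phi> * recip_poly \<phi>)" using \<phi>(1) r(2) by (rule monic_mult)
  obtain b where b: "monic b" "degree b = degree \<phi>" "\<phi> * recip_poly \<phi> = recip_lift (degree \<phi>) b"
    using reflect_fixed_imp_recip_lift[OF reflect_mult_recip_poly[OF \<phi>(3)] monp degp] by blast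
  have b3: "recip_lift_deg b = \<phi> * recip_poly \<phi>" using b by simp
  have b0: "b \<noteq> 0" using b(1) by auto
  have "degree b > 0" using b(2) irreducible_field_poly_degree_pos[OF \<phi>(2)] by simp
  then obtain a where a: "monic a" "irreducible a" "a dvd b" by (rule monic_irreducible_factor_exists)
  note fa = recip_lift_deg_facts[OF a(1)]
  have Td: "recip_lift_deg a dvd \<phi> * recip_poly \<phi>" using recip_lift_dvd[OF a(3) b0] b3 by simp
  have "degree (recip_lift_deg a) > 0" using fa(1) irreducible_field_poly_degree_pos[OF a(2)] by simp
  then obtain c where c: "monic c" "irreducible c" "c dvd recip_lift_deg a" by (rule monic_irreducible_factor_exists)
  have "c dvd \<phi> * recip_poly \<phi>" using c(3) Td dvd_trans by blast
  then have "c dvd \<phi> \<or> c dvd recip_poly \<phi>" using irreducible_field_poly_dvd_mult[OF c(2)] by blast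
  then have "c = \<phi> \<or> c = recip_poly \<phi>"
    using monic_irreducible_dvd_eq[OF c(1) \<phi>(1) c(2) \<phi>(2)] monic_irreducible_dvd_eq[OF c(1) r(2) c(2) ri] by blast
  moreover have "reflect_poly c dvd recip_lift_deg a" using reflect_dvd_reflect[OF c(3)] fa(4) by simp
  ultimately have "\<phi> dvd recip_lift_deg a \<and> recip_poly \<phi> dvd recip_lift_deg a"
  proof (elim disjE)
    assume c\<phi>: "c = \<phi>"
    then show ?thesis using c(3) \<open>reflect_poly c dvd recip_lift_deg a\<close> recip_poly_dvd_iff(2)[OF \<phi>(3)] by blast
  next
    assume cr: "c = recip_poly \<phi>"
    have "reflect_poly c = Polynomial.smult (inverse (coeff \<phi> 0)) \<phi>" unfolding cr by (rule reflect_recip_poly[OF \<phi>(3)])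
    then have "\<phi> dvd recip_lift_deg a" using \<open>reflect_poly c dvd recip_lift_deg a\<close> \<phi>(3) by (simp add: smult_dvd_iff)
    then show ?thesis using c(3) cr by simp
  qed
  then have "\<phi> * recip_poly \<phi> dvd recip_lift_deg a" using coprime_field_poly_divides_mult[OF cop] by blast
  then have "degree (\<phi> * recip_poly \<phi>) \<le> degree (recip_lift_deg a)" by (rule dvd_imp_degree_le[OF _ fa(6)])
  then have "degree b \<le> degree a" unfolding degp fa(1) b(2) by simp
  then have ab: "a = b" by (rule monic_dvd_same_degree[OF a(1) b(1) a(3)])
  have sep: "coprime (recip_lift_deg a) (pderiv (recip_lift_deg a))"
    unfolding ab b3 separable_poly_mult_iff
    using irreducible_separable_finite_field[OF \<phi>(2)] irreducible_separable_finite_field[OF ri] cop by blast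
  have "\<not> irreducible (recip_lift_deg a)"
    using irreducibleD[of "\<phi> * recip_poly \<phi>" \<phi> "recip_poly \<phi>"] irreducible_not_unit[OF \<phi>(2)] irreducible_not_unit[OF ri]
    unfolding ab b3 by blast
  then show ?thesis using that[OF a(1,2)] sep b3 b(2) ab by blast
qed

text \<open>If the constant term c were not 1, summing the coefficients would give f(1) = c f(1) and
  make 1 a root, impossible for an irreducible of degree at least 2. So \<open>f\<close> is
  palindromic, the lift of some b; any irreducible factor of b has a lift dividing \<open>f\<close>
  and hence is b.\<close>

lemma SRIM_is_recip_lift_deg:
  fixes f :: "'a::field poly"
  assumes f: "SRIM f" and deg: "degree f = 2 * d" and d: "d > 0"
  obtains a where "monic a" "irreducible a" "degree a = d" "recip_lift_deg a = f"
proof -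
  have fi: "monic f" "irreducible f" "coeff f 0 \<noteq> 0" "f = recip_poly f" using f unfolding SRIM_def by auto
  let ?c = "coeff f 0"
  have co: "coeff f i = inverse ?c * (if i > 2 * d then 0 else coeff f (2 * d - i))" for i
  proof -
    have "coeff f i = coeff (recip_poly f) i" using fi(4) by simp
    then show ?thesis unfolding recip_poly_def by (simp add: coeff_reflect_poly deg)
  qed
  have ci: "inverse ?c = ?c" using co[of 0] fi(1) deg by simp
  have c1: "?c = 1"
  proof (rule ccontr)
    assume n1: "?c \<noteq> 1"
    have "poly f 1 = (\<Sum>i\<le>2 * d. coeff f i)" by (simp add: poly_altdef deg)
    also have "\<dots> = (\<Sum>i\<le>2 * d. ?c * coeff f (2 * d - i))"
    proof (rule sum.cong)
      fix i assume "i \<in> {..2 * d}"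
      then have "\<not> i > 2 * d" by simp
      then show "coeff f i = ?c * coeff f (2 * d - i)" using co[of i] unfolding ci by simp
    qed simp
    also have "\<dots> = ?c * (\<Sum>i\<le>2 * d. coeff f (2 * d - i))" by (simp add: sum_distrib_left)
    also have "(\<Sum>i\<le>2 * d. coeff f (2 * d - i)) = (\<Sum>i\<le>2 * d. coeff f i)"
      by (rule sum.reindex_bij_witness[of _ "\<lambda>i. 2 * d - i" "\<lambda>i. 2 * d - i"]) auto
    also have "\<dots> = poly f 1" by (simp add: poly_altdef deg)
    finally have "poly f 1 = 0" using n1 by simp
    then have dv: "[:- 1, 1:] dvd f" by (simp add: poly_eq_0_iff_dvd)
    have "\<not> is_unit ([:- 1, 1:] :: 'a poly)" by (simp add: is_unit_iff_degree)
    then have "f dvd [:- 1, 1:]" using irreducibleD'[OF fi(2) dv] by blast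
    then have "degree f \<le> degree ([:- 1, 1:] :: 'a poly)" by (rule dvd_imp_degree_le) simp
    then show False using deg d by simp
  qed
  then have "reflect_poly f = f" using fi(4) unfolding recip_poly_def by simp
  then obtain b where b: "monic b" "degree b = d" "f = recip_lift d b"
    using reflect_fixed_imp_recip_lift[OF _ fi(1) deg] by blast
  have b3: "recip_lift_deg b = f" using b by simp
  have b0: "b \<noteq> 0" using b(1) by auto
  have "degree b > 0" using b(2) d by simp
  then obtain a where a: "monic a" "irreducible a" "a dvd b" by (rule monic_irreducible_factor_exists)
  have "recip_lift_deg a dvd f" using recip_lift_dvd[OF a(3) b0] b3 by simp
  then have "f dvd recip_lift_deg a" using irreducibleD'[OF fi(2)] recip_lift_deg_not_unit[OF a(1,2)] by blast
  then have "degree f \<le> degree (recip_lift_deg a)" by (rule dvd_imp_degree_le[OF _ recip_lift_deg_facts(6)[OF a(1)]])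
  then have "degree b \<le> degree a" unfolding recip_lift_deg_facts(1)[OF a(1)] deg b(2) by simp
  then have "a = b" by (rule monic_dvd_same_degree[OF a(1) b(1) a(3)])
  then show ?thesis using that[OF a(1,2)] b(2) b3 by simp
qed

subsection \<open>The generating function\<close>

text \<open>The possible irreducible factors of g. Separability of the lift rules out x - 2 and x +
  2, whose lifts are squares.\<close>

definition power_atom :: "nat \<Rightarrow> 'a::field poly \<Rightarrow> bool" where
  "power_atom M a \<longleftrightarrow> monic a \<and> irreducible a \<and> coprime (recip_lift_deg a) (pderiv (recip_lift_deg a))
     \<and> sympl_power_poly M (recip_lift_deg a)"

text \<open>The proportion of symplectic matrices with characteristic polynomial \<open>recip_lift_deg a\<close>.\<close>
definition char_poly_weight :: "'a::field poly \<Rightarrow> real" where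
  "char_poly_weight a = real (poly_totient a) / real (poly_totient (recip_lift_deg a))"

lemma power_atomD:
  assumes "power_atom M a"
  shows "monic a" "irreducible a" "coprime (recip_lift_deg a) (pderiv (recip_lift_deg a))"
    "sympl_power_poly M (recip_lift_deg a)" "degree a > 0"
  using assms irreducible_field_poly_degree_pos unfolding power_atom_def by auto

lemma finite_poly_degree_le: "finite {p :: 'a::{finite,zero} poly. P p \<and> degree p \<le> n}"
  by (rule finite_subset[OF _ finite_deg_lt[of "Suc n"]]) (auto simp: deg_lt_iff)

lemma card_field_power_gt_1:
  assumes "d > 0" shows "card (UNIV :: 'a::{finite,field} set) ^ d > 1"
proof -
  have "card {0 :: 'a, 1} \<le> card (UNIV :: 'a set)" by (rule card_mono) auto
  then have "card (UNIV :: 'a set) > 1" by simp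
  then show ?thesis using assms by (rule one_less_power)
qed

lemma card_irreducible_atoms:
  assumes d: "d > 0"
  shows "card {a :: 'a::{finite,field} poly. power_atom M a \<and> degree a = d \<and> irreducible (recip_lift_deg a)}
    = N_star TYPE('a) M d"
proof -
  let ?A = "{a :: 'a poly. power_atom M a \<and> degree a = d \<and> irreducible (recip_lift_deg a)}"
  have img: "recip_lift_deg ` ?A = {f :: 'a poly. M_star_power_SRIM M f \<and> degree f = 2 * d}"
  proof (intro equalityI subsetI)
    fix f assume "f \<in> recip_lift_deg ` ?A"
    then obtain a where a: "power_atom M a" "degree a = d" "irreducible f" and f: "f = recip_lift_deg a" by blast
    note F = recip_lift_deg_facts[OF power_atomD(1)[OF a(1)], folded f]
    have "SRIM f" unfolding SRIM_def using F a(3) by simp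
    moreover have "even (degree f)" using F(1) by simp
    ultimately have "M_star_power_SRIM M f"
      using sympl_power_poly_SRIM_iff power_atomD(4)[OF a(1)] f by blast
    then show "f \<in> {f. M_star_power_SRIM M f \<and> degree f = 2 * d}" using F(1) a(2) by simp
  next
    fix f :: "'a poly" assume "f \<in> {f. M_star_power_SRIM M f \<and> degree f = 2 * d}"
    then have f: "M_star_power_SRIM M f" "degree f = 2 * d" by auto
    have S: "SRIM f" "even (degree f)" using f(1) unfolding M_star_power_SRIM_def by auto
    have fi: "irreducible f" using S(1) unfolding SRIM_def by blast
    obtain a where a: "monic a" "irreducible a" "degree a = d" "recip_lift_deg a = f"
      using SRIM_is_recip_lift_deg[OF S(1) f(2) d] by blast
    have "power_atom M a" unfolding power_atom_def a(4)
      using a irreducible_separable_finite_field[OF fi] sympl_power_poly_SRIM_iff[OF S] f(1) by blast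
    then have "a \<in> ?A" using a fi by simp
    then show "f \<in> recip_lift_deg ` ?A" using a(4) by blast
  qed
  have "inj_on recip_lift_deg ?A"
  proof (rule inj_onI)
    fix a b assume "a \<in> ?A" "b \<in> ?A" "recip_lift_deg a = recip_lift_deg b"
    then show "a = b" using recip_lift_inj[of a d b] by simp
  qed
  then show ?thesis unfolding N_star_def img[symmetric] by (rule card_image[symmetric])
qed

text \<open>Pairs and atoms are compared inside the polynomials, through the product of a pair and
  through \<open>recip_lift_deg\<close>: both maps are injective and have the same image. For pairs,
  injectivity is unique factorisation.\<close>

lemma card_reducible_atoms:
  assumes d: "d > 0" and M: "M > 0"
  shows "card {a :: 'a::{finite,field} poly. power_atom M a \<and> degree a = d \<and> \<not> irreducible (recip_lift_deg a)}
    = R_star TYPE('a) M d"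
proof -
  let ?A = "{a :: 'a poly. power_atom M a \<and> degree a = d \<and> \<not> irreducible (recip_lift_deg a)}"
  let ?P = "{{\<phi>, recip_poly \<phi>} | \<phi> :: 'a poly. M_power_poly M \<phi> \<and> degree \<phi> = d \<and> \<phi> \<noteq> recip_poly \<phi>}"
  have M_powerD: "monic \<phi>" "irreducible \<phi>" "coeff \<phi> 0 \<noteq> 0" if "M_power_poly M \<phi>" for \<phi> :: "'a poly"
  proof -
    show \<phi>: "monic \<phi>" "irreducible \<phi>" using that unfolding M_power_poly_def by auto
    show "coeff \<phi> 0 \<noteq> 0"
    proof
      assume "coeff \<phi> 0 = 0"
      then have "\<phi> dvd [:0, 1:]" by (rule irreducible_coeff_0[OF \<phi>(2)])
      moreover have "irreducible ([:0, 1:] :: 'a poly)" by (rule irreducible_linear_field_poly) simp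
      ultimately have "\<phi> = [:0, 1:]" using monic_irreducible_dvd_eq[OF \<phi>(1) _ \<phi>(2)] by simp
      then show False using that unfolding M_power_poly_def by blast
    qed
  qed
  have img: "(\<lambda>P. \<Prod>p\<in>P. p) ` ?P = recip_lift_deg ` ?A"
  proof (intro equalityI subsetI)
    fix f assume "f \<in> (\<lambda>P. \<Prod>p\<in>P. p) ` ?P"
    then obtain \<phi> where \<phi>: "M_power_poly M \<phi>" "degree \<phi> = d" "\<phi> \<noteq> recip_poly \<phi>"
      and f0: "f = (\<Prod>p\<in>{\<phi>, recip_poly \<phi>}. p)" by blast
    have f: "f = \<phi> * recip_poly \<phi>" unfolding f0 using \<phi>(3) by simp
    note m = M_powerD[OF \<phi>(1)]
    obtain a where a: "monic a" "irreducible a" "degree a = degree \<phi>" "recip_lift_deg a = \<phi> * recip_poly \<phi>"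
      "coprime (recip_lift_deg a) (pderiv (recip_lift_deg a))" "\<not> irreducible (recip_lift_deg a)"
      using pair_is_recip_lift_deg[OF m \<phi>(3)] by blast
    have "coprime \<phi> (recip_poly \<phi>)" using a(5) unfolding a(4) separable_poly_mult_iff by blast
    then have "sympl_power_poly M (recip_lift_deg a)"
      unfolding a(4) using sympl_power_poly_pair_iff[OF m _ M] \<phi>(1) by blast
    then have "a \<in> ?A" unfolding power_atom_def using a \<phi>(2) by simp
    then show "f \<in> recip_lift_deg ` ?A" using a(4) f by (intro image_eqI[of _ _ a]) simp_all
  next
    fix f assume "f \<in> recip_lift_deg ` ?A"
    then obtain a where a: "power_atom M a" "degree a = d" "\<not> irreducible (recip_lift_deg a)"
      and f: "f = recip_lift_deg a" by blast
    note p = power_atomD[OF a(1)]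
    obtain \<phi> where \<phi>: "monic \<phi>" "irreducible \<phi>" "coeff \<phi> 0 \<noteq> 0" "\<phi> \<noteq> recip_poly \<phi>" "degree \<phi> = degree a"
      "recip_lift_deg a = \<phi> * recip_poly \<phi>"
      using reducible_recip_lift_deg[OF p(1-3) a(3)] by blast
    have "coprime \<phi> (recip_poly \<phi>)" using p(3) unfolding \<phi>(6) separable_poly_mult_iff by blast
    then have "M_power_poly M \<phi>"
      using sympl_power_poly_pair_iff[OF \<phi>(1-3) _ M] p(4) unfolding \<phi>(6) by blast
    then have "{\<phi>, recip_poly \<phi>} \<in> ?P" using \<phi> a(2) by blast
    moreover have "f = (\<Prod>p\<in>{\<phi>, recip_poly \<phi>}. p)" using f \<phi> by simp
    ultimately show "f \<in> (\<lambda>P. \<Prod>p\<in>P. p) ` ?P" by (rule rev_image_eqI)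
  qed
  have "inj_on (\<lambda>P. \<Prod>p\<in>P. p) ?P"
  proof (rule inj_onI)
    fix P Q assume "P \<in> ?P" "Q \<in> ?P" and eq: "(\<Prod>p\<in>P. p) = (\<Prod>p\<in>Q. p)"
    then obtain \<phi> \<psi> where \<phi>: "M_power_poly M \<phi>" "\<phi> \<noteq> recip_poly \<phi>" and P: "P = {\<phi>, recip_poly \<phi>}"
      and \<psi>: "M_power_poly M \<psi>" "\<psi> \<noteq> recip_poly \<psi>" and Q: "Q = {\<psi>, recip_poly \<psi>}" by blast
    note m = M_powerD[OF \<phi>(1)] and n = M_powerD[OF \<psi>(1)]
    have "\<phi> * recip_poly \<phi> = \<psi> * recip_poly \<psi>" using eq \<phi>(2) \<psi>(2) unfolding P Q by simp
    then have "\<psi> dvd \<phi> * recip_poly \<phi>" by simp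
    then have "\<psi> dvd \<phi> \<or> \<psi> dvd recip_poly \<phi>" using irreducible_field_poly_dvd_mult[OF n(2)] by blast
    then have "\<psi> = \<phi> \<or> \<psi> = recip_poly \<phi>"
      using monic_irreducible_dvd_eq[OF n(1) m(1) n(2) m(2)]
        monic_irreducible_dvd_eq[OF n(1) monic_recip_poly(2)[OF m(3)] n(2) irreducible_recip_poly[OF m]] by blast
    then show "P = Q" unfolding P Q using recip_recip_poly[OF m(1,3)] by auto
  qed
  then have card_P: "card ?P = card (recip_lift_deg ` ?A)" unfolding img[symmetric] by (rule card_image[symmetric])
  have "inj_on recip_lift_deg ?A"
  proof (rule inj_onI)
    fix a b assume "a \<in> ?A" "b \<in> ?A" "recip_lift_deg a = recip_lift_deg b"
    then show "a = b" using recip_lift_inj[of a d b] by simp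
  qed
  then show ?thesis unfolding R_star_def card_P by (rule card_image[symmetric])
qed

lemma char_poly_weight_irreducible:
  fixes a :: "'a::{finite,field} poly"
  assumes "monic a" "irreducible a" "irreducible (recip_lift_deg a)"
  shows "char_poly_weight a = 1 / (real (card (UNIV :: 'a set)) ^ degree a + 1)"
proof -
  let ?Q = "card (UNIV :: 'a set) ^ degree a"
  have Q: "?Q > 1" by (rule card_field_power_gt_1[OF irreducible_field_poly_degree_pos[OF assms(2)]])
  then have "real ?Q > real 1" by (simp only: of_nat_less_iff)
  then have Qr: "real ?Q > 1" by (simp only: of_nat_1)
  have "poly_totient (recip_lift_deg a) = ?Q ^ 2 - 1"
    unfolding poly_totient_irreducible[OF assms(3)] recip_lift_deg_facts(1)[OF assms(1)]
    by (simp add: power_mult mult.commute)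
  moreover have "?Q ^ 2 \<ge> 1" using Q by simp
  ultimately have "real (poly_totient (recip_lift_deg a)) = (real ?Q - 1) * (real ?Q + 1)"
    by (simp add: of_nat_diff power2_eq_square algebra_simps del: of_nat_power)
  moreover have "real (poly_totient a) = real ?Q - 1"
    unfolding poly_totient_irreducible[OF assms(2)] using Q by (simp add: of_nat_diff del: of_nat_power)
  ultimately have "char_poly_weight a = 1 / (real ?Q + 1)" unfolding char_poly_weight_def using Qr by simp
  then show ?thesis by simp
qed

lemma char_poly_weight_reducible:
  fixes a :: "'a::{finite,field} poly"
  assumes a: "monic a" "irreducible a" "coprime (recip_lift_deg a) (pderiv (recip_lift_deg a))"
    "\<not> irreducible (recip_lift_deg a)"
  shows "char_poly_weight a = 1 / (real (card (UNIV :: 'a set)) ^ degree a - 1)"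
proof -
  let ?Q = "card (UNIV :: 'a set) ^ degree a"
  have Q: "?Q > 1" by (rule card_field_power_gt_1[OF irreducible_field_poly_degree_pos[OF a(2)]])
  then have "real ?Q > real 1" by (simp only: of_nat_less_iff)
  then have Qr: "real ?Q > 1" by (simp only: of_nat_1)
  obtain \<phi> where \<phi>: "monic \<phi>" "irreducible \<phi>" "coeff \<phi> 0 \<noteq> 0" "\<phi> \<noteq> recip_poly \<phi>" "degree \<phi> = degree a"
    "recip_lift_deg a = \<phi> * recip_poly \<phi>" using reducible_recip_lift_deg[OF a] by blast
  have cop: "coprime \<phi> (recip_poly \<phi>)" using a(3) unfolding \<phi>(6) separable_poly_mult_iff by blast
  have nz: "\<phi> \<noteq> 0" "recip_poly \<phi> \<noteq> 0" using \<phi>(1) monic_recip_poly(2)[OF \<phi>(3)] by auto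
  have "poly_totient (recip_lift_deg a) = (?Q - 1) * (?Q - 1)"
    unfolding \<phi>(6) poly_totient_mult[OF cop nz] poly_totient_irreducible[OF \<phi>(2)]
      poly_totient_irreducible[OF irreducible_recip_poly[OF \<phi>(1-3)]] monic_recip_poly(1)[OF \<phi>(3)] \<phi>(5) ..
  then have "real (poly_totient (recip_lift_deg a)) = (real ?Q - 1) * (real ?Q - 1)"
    using Q by (simp add: of_nat_diff del: of_nat_power)
  moreover have "real (poly_totient a) = real ?Q - 1"
    unfolding poly_totient_irreducible[OF a(2)] using Q by (simp add: of_nat_diff del: of_nat_power)
  ultimately have "char_poly_weight a = 1 / (real ?Q - 1)" unfolding char_poly_weight_def using Qr by simp
  then show ?thesis by simp
qed

section \<open>Decomposition into atoms\<close>

lemma degree_prod_monic: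
  fixes A :: "'a::field poly set"
  assumes "\<And>a. a \<in> A \<Longrightarrow> monic a"
  shows "degree (\<Prod>a\<in>A. a) = (\<Sum>a\<in>A. degree a)"
  using assms
proof (induction A rule: infinite_finite_induct)
  case (insert x A)
  have "monic (\<Prod>a\<in>A. a)" using insert.prems by (intro monic_prod) auto
  then have "(\<Prod>a\<in>A. a) \<noteq> 0" by auto
  moreover have "x \<noteq> 0" using insert.prems[of x] by auto
  ultimately show ?case using insert by (simp add: degree_mult_eq)
qed simp_all

lemma char_poly_weight_prod:
  fixes A :: "'a::{finite,field} poly set"
  assumes fin: "finite A" and A: "\<And>a. a \<in> A \<Longrightarrow> monic a \<and> irreducible a"
  shows "char_poly_weight (\<Prod>a\<in>A. a) = (\<Prod>a\<in>A. char_poly_weight a)"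
proof -
  have cop: "coprime a b" if "a \<in> A" "b \<in> A" "a \<noteq> b" for a b
    using distinct_monic_irreducible_coprime[of a b] A that by blast
  have "poly_totient (\<Prod>a\<in>A. a) = (\<Prod>a\<in>A. poly_totient a)"
    by (rule poly_totient_prod[OF fin cop]) (use A in auto)
  moreover have "poly_totient (\<Prod>a\<in>A. recip_lift_deg a) = (\<Prod>a\<in>A. poly_totient (recip_lift_deg a))"
  proof (rule poly_totient_prod[OF fin])
    fix a b assume ab: "a \<in> A" "b \<in> A" "a \<noteq> b"
    show "coprime (recip_lift_deg a) (recip_lift_deg b)"
      by (rule recip_lift_coprime[OF cop[OF ab] _ refl refl]) (use A ab in blast)
  qed (use A recip_lift_deg_facts(6) in blast)
  moreover have "recip_lift_deg (\<Prod>a\<in>A. a) = (\<Prod>a\<in>A. recip_lift_deg a)"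
    by (rule recip_lift_prod[OF fin]) (use A in blast)
  ultimately show ?thesis unfolding char_poly_weight_def by (simp add: prod_dividef)
qed

lemma prod_power_atoms:
  fixes A :: "'a::{finite,field} poly set"
  assumes fin: "finite A" and A: "\<And>a. a \<in> A \<Longrightarrow> monic a \<and> irreducible a"
  defines "g \<equiv> \<Prod>a\<in>A. a"
  shows "coprime (recip_lift_deg g) (pderiv (recip_lift_deg g)) \<and> sympl_power_poly M (recip_lift_deg g)
    \<longleftrightarrow> (\<forall>a\<in>A. power_atom M a)"
proof -
  have cop: "coprime a b" if "a \<in> A" "b \<in> A" "a \<noteq> b" for a b
    using distinct_monic_irreducible_coprime[of a b] A that by blast
  have pr: "recip_lift_deg g = (\<Prod>a\<in>A. recip_lift_deg a)"
    unfolding g_def by (rule recip_lift_prod[OF fin]) (use A in blast)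
  have "coprime (recip_lift_deg g) (pderiv (recip_lift_deg g))
    \<longleftrightarrow> (\<forall>a\<in>A. coprime (recip_lift_deg a) (pderiv (recip_lift_deg a)))"
    unfolding pr
  proof (rule separable_poly_prod_iff[OF fin])
    fix a b assume ab: "a \<in> A" "b \<in> A" "a \<noteq> b"
    show "coprime (recip_lift_deg a) (recip_lift_deg b)"
      by (rule recip_lift_coprime[OF cop[OF ab] _ refl refl]) (use A ab in blast)
  qed
  moreover have "sympl_power_poly M (recip_lift_deg g) \<longleftrightarrow> (\<forall>a\<in>A. sympl_power_poly M (recip_lift_deg a))"
    unfolding pr by (rule sympl_power_poly_recip_lift_prod[OF fin _ cop]) (use A in blast)
  ultimately show ?thesis unfolding power_atom_def using A by blast
qed

text \<open>An irreducible factor of the cofactor k would already occur in the product,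
  contradicting separability, so k is constant.\<close>

lemma separable_monic_eq_prod_irreducible:
  fixes g :: "'a::{finite,field} poly"
  assumes g: "monic g" "coprime g (pderiv g)"
  defines "A \<equiv> {a. monic a \<and> irreducible a \<and> a dvd g}"
  shows "finite A" "(\<Prod>a\<in>A. a) = g"
proof -
  have g0: "g \<noteq> 0" using g(1) by auto
  show fin: "finite A"
  proof (rule finite_subset[OF _ finite_poly_degree_le[of "\<lambda>_. True" "degree g"]])
    show "A \<subseteq> {p. True \<and> degree p \<le> degree g}" unfolding A_def using dvd_imp_degree_le g0 by blast
  qed
  have A: "monic a" "irreducible a" "a dvd g" if "a \<in> A" for a using that unfolding A_def by auto
  have sub: "(\<Prod>a\<in>B. a) dvd g" if "B \<subseteq> A" for B
    using finite_subset[OF that fin] that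
  proof (induction B rule: finite_induct)
    case (insert x B)
    have "coprime (\<Prod>a\<in>B. a) x"
    proof (rule coprime_field_poly_prod)
      fix a assume "a \<in> B"
      then show "coprime a x" using insert A by (intro distinct_monic_irreducible_coprime) auto
    qed
    then have "(\<Prod>a\<in>B. a) * x dvd g"
      by (rule coprime_field_poly_divides_mult) (use insert A in auto)
    then show ?case using insert.hyps by (simp add: mult.commute)
  qed simp
  obtain k where k: "g = (\<Prod>a\<in>A. a) * k" using sub[OF subset_refl] by (elim dvdE)
  have monA: "monic (\<Prod>a\<in>A. a)" using A(1) by (intro monic_prod) auto
  have k0: "k \<noteq> 0" using g0 k by auto
  have "degree k = 0"
  proof (rule ccontr)
    assume "degree k \<noteq> 0"
    then have "degree k > 0" by simp
    then obtain c where c: "monic c" "irreducible c" "c dvd k" by (rule monic_irreducible_factor_exists)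
    then have "c \<in> A" unfolding A_def using k by simp
    then have "c dvd (\<Prod>a\<in>A. a)" using fin by (rule dvd_prodI[rotated])
    moreover have "coprime (\<Prod>a\<in>A. a) k" using g(2) unfolding k separable_poly_mult_iff by blast
    ultimately have "is_unit c" using c(3) coprime_common_divisor by blast
    then show False using irreducible_not_unit[OF c(2)] by blast
  qed
  moreover have "degree g = degree (\<Prod>a\<in>A. a) + degree k"
    using degree_mult_eq[of "\<Prod>a\<in>A. a" k] g0 k by fastforce
  ultimately have "degree g = degree (\<Prod>a\<in>A. a)" by simp
  then show "(\<Prod>a\<in>A. a) = g" using monic_dvd_same_degree[OF monA g(1)] k by simp
qed

text \<open>The bound on single degrees follows from the total for finite sets; it keeps out
  infinite sets, whose sum of degrees would be 0 by convention.\<close>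

lemma bij_betw_prod_atoms:
  "bij_betw (\<lambda>A. \<Prod>a\<in>A. a)
     {A. A \<subseteq> {a :: 'a::{finite,field} poly. power_atom M a \<and> degree a \<le> m} \<and> (\<Sum>a\<in>A. degree a) = m}
     {g. monic g \<and> degree g = m \<and> coprime (recip_lift_deg g) (pderiv (recip_lift_deg g))
       \<and> sympl_power_poly M (recip_lift_deg g)}"
  (is "bij_betw ?f ?A ?G")
  unfolding bij_betw_def
proof
  have A: "finite A" "\<And>a. a \<in> A \<Longrightarrow> monic a \<and> irreducible a" "\<forall>a\<in>A. power_atom M a" "(\<Sum>a\<in>A. degree a) = m"
    if "A \<in> ?A" for A
    using that finite_subset[OF _ finite_poly_degree_le[of "power_atom M" m]] power_atomD(1,2) by blast+
  have factors: "A = {a. monic a \<and> irreducible a \<and> a dvd (\<Prod>a\<in>A. a)}" if "A \<in> ?A" for A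
  proof (intro equalityI subsetI)
    fix a assume "a \<in> A"
    then show "a \<in> {a. monic a \<and> irreducible a \<and> a dvd (\<Prod>a\<in>A. a)}"
      using A(2)[OF that] dvd_prodI[OF A(1)[OF that], of a "\<lambda>a. a"] by simp
  next
    fix a assume "a \<in> {a. monic a \<and> irreducible a \<and> a dvd (\<Prod>a\<in>A. a)}"
    then have a: "monic a" "irreducible a" "a dvd (\<Prod>a\<in>A. a)" by auto
    show "a \<in> A"
    proof (rule ccontr)
      assume "a \<notin> A"
      have "coprime (\<Prod>a\<in>A. a) a"
      proof (rule coprime_field_poly_prod)
        fix b assume b: "b \<in> A"
        then have "b \<noteq> a" using \<open>a \<notin> A\<close> by blast
        then show "coprime b a" using distinct_monic_irreducible_coprime[of b a] A(2)[OF that b] a by blast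
      qed
      then have "is_unit a" using coprime_common_divisor[OF _ a(3) dvd_refl] by blast
      then show False using irreducible_not_unit[OF a(2)] by blast
    qed
  qed
  show "inj_on ?f ?A"
  proof (rule inj_onI)
    fix A B assume "A \<in> ?A" "B \<in> ?A" "?f A = ?f B"
    then show "A = B" using factors[of A] factors[of B] by simp
  qed
  show "?f ` ?A = ?G"
  proof (intro equalityI subsetI)
    fix g assume "g \<in> ?f ` ?A"
    then obtain B where B: "B \<in> ?A" and g: "g = ?f B" by blast
    have mon: "\<And>a. a \<in> B \<Longrightarrow> monic a" using A(2)[OF B] by blast
    have "monic g" unfolding g using mon by (intro monic_prod) auto
    moreover have "degree (\<Prod>a\<in>B. a) = (\<Sum>a\<in>B. degree a)" by (rule degree_prod_monic) (rule mon)
    then have "degree g = m" unfolding g using A(4)[OF B] by simp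
    ultimately show "g \<in> ?G" using prod_power_atoms[OF A(1,2)[OF B], of M] A(3)[OF B] unfolding g by blast
  next
    fix g assume "g \<in> ?G"
    then have g: "monic g" "degree g = m" "coprime (recip_lift_deg g) (pderiv (recip_lift_deg g))"
      "sympl_power_poly M (recip_lift_deg g)" by auto
    have g0: "g \<noteq> 0" using g(1) by auto
    define B where "B = {a. monic a \<and> irreducible a \<and> a dvd g}"
    have sep: "coprime g (pderiv g)" by (rule separable_recip_lift_imp_separable[OF g(1) refl g(3)])
    note B = separable_monic_eq_prod_irreducible[OF g(1) sep, folded B_def]
    have BB: "monic a \<and> irreducible a" if "a \<in> B" for a using that unfolding B_def by blast
    have "\<forall>a\<in>B. power_atom M a" using prod_power_atoms[OF B(1) BB, of M] g(3,4) unfolding B(2) by blast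
    moreover have "\<forall>a\<in>B. degree a \<le> m" unfolding B_def using dvd_imp_degree_le g0 g(2) by blast
    moreover have "(\<Sum>a\<in>B. degree a) = m" using degree_prod_monic[of B] BB B(2) g(2) by simp
    ultimately have "B \<in> ?A" by blast
    then show "g \<in> ?f ` ?A" by (intro image_eqI[of _ _ B]) (simp_all add: B(2))
  qed
qed

theorem s_Sp_eq_sum:
  assumes m: "m > 0"
  shows "s_Sp TYPE('a::{finite,field}) M m
    = (\<Sum>A | A \<subseteq> {a :: 'a poly. power_atom M a \<and> degree a \<le> m} \<and> (\<Sum>a\<in>A. degree a) = m.
        \<Prod>a\<in>A. char_poly_weight a)"
proof -
  define G where "G = {g :: 'a poly. monic g \<and> degree g = m \<and> coprime (recip_lift_deg g) (pderiv (recip_lift_deg g))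
       \<and> sympl_power_poly M (recip_lift_deg g)}"
  define C where "C g = {X \<in> Sp m. char_poly X = recip_lift_deg g}" for g :: "'a poly"
  have Gd: "monic g" "degree g = m" "coprime (recip_lift_deg g) (pderiv (recip_lift_deg g))"
    "sympl_power_poly M (recip_lift_deg g)" if "g \<in> G" for g using that unfolding G_def by auto
  have "{X \<in> (Sp m :: 'a mat set). separable_mat X \<and> is_Mth_power_Sp M m X} = (\<Union>g\<in>G. C g)"
  proof (intro equalityI subsetI)
    fix X :: "'a mat" assume "X \<in> {X \<in> Sp m. separable_mat X \<and> is_Mth_power_Sp M m X}"
    then have X: "X \<in> Sp m" "coprime (char_poly X) (pderiv (char_poly X))" "is_Mth_power_Sp M m X"
      unfolding separable_mat_def by auto
    obtain g where g: "monic g" "degree g = m" "char_poly X = recip_lift m g"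
      using char_poly_separable_Sp[OF X(1,2)] by blast
    have "g \<in> G" unfolding G_def using g X(2,3) Mth_power_Sp_iff[OF X(1,2)] by simp
    then show "X \<in> (\<Union>g\<in>G. C g)" unfolding C_def using X(1) g by blast
  next
    fix X assume "X \<in> (\<Union>g\<in>G. C g)"
    then obtain g where g: "g \<in> G" and X: "X \<in> Sp m" "char_poly X = recip_lift_deg g" unfolding C_def by blast
    have sep: "coprime (char_poly X) (pderiv (char_poly X))" unfolding X(2) by (rule Gd(3)[OF g])
    have "is_Mth_power_Sp M m X" unfolding Mth_power_Sp_iff[OF X(1) sep] X(2) by (rule Gd(4)[OF g])
    then show "X \<in> {X \<in> Sp m. separable_mat X \<and> is_Mth_power_Sp M m X}"
      using X(1) sep unfolding separable_mat_def by blast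
  qed
  moreover have "card (\<Union>g\<in>G. C g) = (\<Sum>g\<in>G. card (C g))"
  proof (rule card_UN_disjoint)
    show "finite G" unfolding G_def
      by (rule finite_subset[OF _ finite_poly_degree_le[of "\<lambda>_. True" m]]) auto
    have "finite (C g)" for g unfolding C_def by (rule finite_subset[OF _ finite_Sp[of m]]) blast
    then show "\<forall>g\<in>G. finite (C g)" by blast
    show "\<forall>g\<in>G. \<forall>h\<in>G. g \<noteq> h \<longrightarrow> C g \<inter> C h = {}"
    proof (intro ballI impI)
      fix g h assume gh: "g \<in> G" "h \<in> G" "g \<noteq> h"
      have "recip_lift_deg g \<noteq> recip_lift_deg h" using recip_lift_inj[of g m h] Gd(2) gh by auto
      then show "C g \<inter> C h = {}" unfolding C_def by auto
    qed
  qed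
  ultimately have "s_Sp TYPE('a) M m = (\<Sum>g\<in>G. real (card (C g))) / real (card (Sp m :: 'a mat set))"
    unfolding s_Sp_def by simp
  also have "\<dots> = (\<Sum>g\<in>G. real (card (C g)) / real (card (Sp m :: 'a mat set)))" by (rule sum_divide_distrib)
  also have "\<dots> = (\<Sum>g\<in>G. char_poly_weight g)"
  proof (rule sum.cong)
    fix g assume g: "g \<in> G"
    have sep: "coprime (recip_lift m g) (pderiv (recip_lift m g))" using Gd(2,3)[OF g] by simp
    have "card (C g) * poly_totient (recip_lift_deg g) = card (Sp m :: 'a mat set) * poly_totient g"
      using card_Sp_char_poly[OF m Gd(1,2)[OF g] sep] Gd(2)[OF g] unfolding C_def by simp
    then have "real (card (C g)) * real (poly_totient (recip_lift_deg g)) = real (card (Sp m :: 'a mat set)) * real (poly_totient g)"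
      by (metis of_nat_mult)
    moreover have "real (poly_totient (recip_lift_deg g)) > 0"
      using poly_totient_pos[OF recip_lift_deg_facts(6)[OF Gd(1)[OF g]]] by simp
    moreover have "real (card (Sp m :: 'a mat set)) > 0"
    proof -
      have "(1\<^sub>m (m + m) :: 'a mat) \<in> Sp m" unfolding Sp_iff
        using left_mult_one_mat[OF sympl_J_carrier] right_mult_one_mat[OF sympl_J_carrier] by simp
      then show ?thesis using finite_Sp[of m] by (auto simp: card_gt_0_iff)
    qed
    ultimately show "real (card (C g)) / real (card (Sp m :: 'a mat set)) = char_poly_weight g"
      unfolding char_poly_weight_def by (simp add: field_simps)
  qed simp
  also have "\<dots> = (\<Sum>A | A \<subseteq> {a :: 'a poly. power_atom M a \<and> degree a \<le> m} \<and> (\<Sum>a\<in>A. degree a) = m.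
      char_poly_weight (\<Prod>a\<in>A. a))"
    unfolding G_def by (rule sum.reindex_bij_betw[OF bij_betw_prod_atoms, symmetric])
  also have "\<dots> = (\<Sum>A | A \<subseteq> {a :: 'a poly. power_atom M a \<and> degree a \<le> m} \<and> (\<Sum>a\<in>A. degree a) = m.
      \<Prod>a\<in>A. char_poly_weight a)"
  proof (rule sum.cong)
    fix A assume "A \<in> {A. A \<subseteq> {a :: 'a poly. power_atom M a \<and> degree a \<le> m} \<and> (\<Sum>a\<in>A. degree a) = m}"
    then have A: "A \<subseteq> {a :: 'a poly. power_atom M a \<and> degree a \<le> m}" by blast
    show "char_poly_weight (\<Prod>a\<in>A. a) = (\<Prod>a\<in>A. char_poly_weight a)"
      by (rule char_poly_weight_prod[OF finite_subset[OF A finite_poly_degree_le]]) (use A power_atomD(1,2) in blast)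
  qed simp
  finally show ?thesis .
qed

section \<open>Coefficients of the product\<close>

lemma fps_nth_prod_one_plus_monomial:
  fixes w :: "'b \<Rightarrow> real" and k :: "'b \<Rightarrow> nat"
  assumes "finite G"
  shows "fps_nth (\<Prod>a\<in>G. 1 + fps_const (w a) * fps_X ^ k a) m
    = (\<Sum>A | A \<subseteq> G \<and> (\<Sum>a\<in>A. k a) = m. \<Prod>a\<in>A. w a)"
proof -
  have t: "(\<Prod>a\<in>A. fps_const (w a) * fps_X ^ k a) = fps_const (\<Prod>a\<in>A. w a) * fps_X ^ (\<Sum>a\<in>A. k a)" for A
    by (induction A rule: infinite_finite_induct) (simp_all add: power_add mult_ac flip: fps_const_mult)
  have "(\<Prod>a\<in>G. 1 + fps_const (w a) * fps_X ^ k a) = (\<Prod>a\<in>G. fps_const (w a) * fps_X ^ k a + 1)"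
    by (simp add: add.commute)
  also have "\<dots> = (\<Sum>A\<in>Pow G. fps_const (\<Prod>a\<in>A. w a) * fps_X ^ (\<Sum>a\<in>A. k a))"
    unfolding prod_add[OF assms] t by simp
  finally have "fps_nth (\<Prod>a\<in>G. 1 + fps_const (w a) * fps_X ^ k a) m
    = (\<Sum>A\<in>Pow G. if (\<Sum>a\<in>A. k a) = m then \<Prod>a\<in>A. w a else 0)"
    by (auto simp: fps_sum_nth intro!: sum.cong)
  also have "\<dots> = (\<Sum>A | A \<in> Pow G \<and> (\<Sum>a\<in>A. k a) = m. \<Prod>a\<in>A. w a)"
    by (rule sum.inter_filter[symmetric]) (use assms in simp)
  finally show ?thesis by simp
qed

lemma prod_over_degrees_eq_prod_atoms:
  assumes M: "M > 0"
  shows "(\<Prod>d\<in>{1..n}.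
      (1 + fps_const (1 / (real (card (UNIV :: 'a::{finite,field} set)) ^ d + 1)) * fps_X ^ d) ^ N_star TYPE('a) M d
    * (1 + fps_const (1 / (real (card (UNIV :: 'a set)) ^ d - 1)) * fps_X ^ d) ^ R_star TYPE('a) M d)
    = (\<Prod>a\<in>{a :: 'a poly. power_atom M a \<and> degree a \<le> n}. 1 + fps_const (char_poly_weight a) * fps_X ^ degree a)"
proof -
  let ?t = "\<lambda>a :: 'a poly. 1 + fps_const (char_poly_weight a) * fps_X ^ degree a"
  define D where "D d = {a :: 'a poly. power_atom M a \<and> degree a = d}" for d
  have fin: "finite (D d)" for d
    unfolding D_def by (rule finite_subset[OF _ finite_poly_degree_le[of "power_atom M" d]]) auto
  \<comment> \<open>Degree 0 is absent since atoms have positive degree.\<close>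
  have "{a :: 'a poly. power_atom M a \<and> degree a \<le> n} = (\<Union>d\<in>{1..n}. D d)"
    unfolding D_def using power_atomD(5) by fastforce
  then have "(\<Prod>a\<in>{a :: 'a poly. power_atom M a \<and> degree a \<le> n}. ?t a) = (\<Prod>a\<in>(\<Union>d\<in>{1..n}. D d). ?t a)" by simp
  also have "\<dots> = (\<Prod>d\<in>{1..n}. \<Prod>a\<in>D d. ?t a)"
  proof (rule prod.UNION_disjoint)
    show "\<forall>i\<in>{1..n}. \<forall>j\<in>{1..n}. i \<noteq> j \<longrightarrow> D i \<inter> D j = {}" unfolding D_def by blast
  qed (use fin in auto)
  also have "\<dots> = (\<Prod>d\<in>{1..n}.
      (1 + fps_const (1 / (real (card (UNIV :: 'a set)) ^ d + 1)) * fps_X ^ d) ^ N_star TYPE('a) M d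
    * (1 + fps_const (1 / (real (card (UNIV :: 'a set)) ^ d - 1)) * fps_X ^ d) ^ R_star TYPE('a) M d)"
  proof (rule prod.cong)
    fix d assume "d \<in> {1..n}"
    then have d: "d > 0" by simp
    define I where "I = {a :: 'a poly. power_atom M a \<and> degree a = d \<and> irreducible (recip_lift_deg a)}"
    define J where "J = {a :: 'a poly. power_atom M a \<and> degree a = d \<and> \<not> irreducible (recip_lift_deg a)}"
    have IJ: "D d = I \<union> J" "I \<inter> J = {}" unfolding D_def I_def J_def by auto
    then have f: "finite I" "finite J" using fin[of d] by auto
    have "(\<Prod>a\<in>D d. ?t a) = (\<Prod>a\<in>I. ?t a) * (\<Prod>a\<in>J. ?t a)"
      unfolding IJ(1) by (rule prod.union_disjoint[OF f IJ(2)])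
    also have "(\<Prod>a\<in>I. ?t a) = (\<Prod>a\<in>I. 1 + fps_const (1 / (real (card (UNIV :: 'a set)) ^ d + 1)) * fps_X ^ d)"
    proof (rule prod.cong)
      fix a assume "a \<in> I"
      then have a: "power_atom M a" "degree a = d" "irreducible (recip_lift_deg a)" unfolding I_def by auto
      show "?t a = 1 + fps_const (1 / (real (card (UNIV :: 'a set)) ^ d + 1)) * fps_X ^ d"
        unfolding char_poly_weight_irreducible[OF power_atomD(1,2)[OF a(1)] a(3)] a(2) ..
    qed simp
    also have "\<dots> = (1 + fps_const (1 / (real (card (UNIV :: 'a set)) ^ d + 1)) * fps_X ^ d) ^ N_star TYPE('a) M d"
      unfolding prod_constant I_def card_irreducible_atoms[OF d] ..
    also have "(\<Prod>a\<in>J. ?t a) = (\<Prod>a\<in>J. 1 + fps_const (1 / (real (card (UNIV :: 'a set)) ^ d - 1)) * fps_X ^ d)"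
    proof (rule prod.cong)
      fix a assume "a \<in> J"
      then have a: "power_atom M a" "degree a = d" "\<not> irreducible (recip_lift_deg a)" unfolding J_def by auto
      show "?t a = 1 + fps_const (1 / (real (card (UNIV :: 'a set)) ^ d - 1)) * fps_X ^ d"
        unfolding char_poly_weight_reducible[OF power_atomD(1-3)[OF a(1)] a(3)] a(2) ..
    qed simp
    also have "\<dots> = (1 + fps_const (1 / (real (card (UNIV :: 'a set)) ^ d - 1)) * fps_X ^ d) ^ R_star TYPE('a) M d"
      unfolding prod_constant J_def card_reducible_atoms[OF d M] ..
    finally show "(\<Prod>a\<in>D d. ?t a) =
        (1 + fps_const (1 / (real (card (UNIV :: 'a set)) ^ d + 1)) * fps_X ^ d) ^ N_star TYPE('a) M d
      * (1 + fps_const (1 / (real (card (UNIV :: 'a set)) ^ d - 1)) * fps_X ^ d) ^ R_star TYPE('a) M d" .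
  qed simp
  finally show ?thesis ..
qed

text \<open>No member can exceed the total degree. Hence coefficient m of the partial products is
  stationary from n = m on.\<close>

lemma subsets_of_total_degree:
  assumes "m \<le> n"
  shows "{A. A \<subseteq> {a :: 'a::{finite,field} poly. power_atom M a \<and> degree a \<le> n} \<and> (\<Sum>a\<in>A. degree a) = m}
    = {A. A \<subseteq> {a. power_atom M a \<and> degree a \<le> m} \<and> (\<Sum>a\<in>A. degree a) = m}"
proof (intro equalityI subsetI)
  fix A assume "A \<in> {A. A \<subseteq> {a :: 'a poly. power_atom M a \<and> degree a \<le> n} \<and> (\<Sum>a\<in>A. degree a) = m}"
  then have A: "A \<subseteq> {a :: 'a poly. power_atom M a \<and> degree a \<le> n}" "(\<Sum>a\<in>A. degree a) = m" by auto
  have "finite A" by (rule finite_subset[OF A(1) finite_poly_degree_le])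
  then have "degree a \<le> m" if "a \<in> A" for a using member_le_sum[OF that, of degree] A(2) by simp
  then show "A \<in> {A. A \<subseteq> {a. power_atom M a \<and> degree a \<le> m} \<and> (\<Sum>a\<in>A. degree a) = m}" using A by blast
qed (use assms in auto)

theorem theorem5p5:
  fixes M :: nat
  assumes "M \<ge> 2" and "coprime M (card (UNIV :: 'a :: {finite, field} set))"
  shows "(\<lambda>n. \<Prod>d\<in>{1..n}.
            (1 + fps_const (1 / (real (card (UNIV :: 'a set)) ^ d + 1)) * fps_X ^ d) ^ N_star TYPE('a) M d
          * (1 + fps_const (1 / (real (card (UNIV :: 'a set)) ^ d - 1)) * fps_X ^ d) ^ R_star TYPE('a) M d)
         \<longlonglongrightarrow> S_Sp TYPE('a) M"
proof (rule tendsto_fpsI)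
  fix m
  have M: "M > 0" using assms(1) by simp
  \<comment> \<open>Convergence of formal power series is eventual constancy of each coefficient,
    and coefficient m settles at n = m.\<close>
  have "fps_nth (\<Prod>d\<in>{1..n}.
            (1 + fps_const (1 / (real (card (UNIV :: 'a set)) ^ d + 1)) * fps_X ^ d) ^ N_star TYPE('a) M d
          * (1 + fps_const (1 / (real (card (UNIV :: 'a set)) ^ d - 1)) * fps_X ^ d) ^ R_star TYPE('a) M d) m
      = fps_nth (S_Sp TYPE('a) M) m" if n: "n \<ge> m" for n
  proof -
    have "fps_nth (\<Prod>d\<in>{1..n}.
            (1 + fps_const (1 / (real (card (UNIV :: 'a set)) ^ d + 1)) * fps_X ^ d) ^ N_star TYPE('a) M d
          * (1 + fps_const (1 / (real (card (UNIV :: 'a set)) ^ d - 1)) * fps_X ^ d) ^ R_star TYPE('a) M d) m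
      = (\<Sum>A | A \<subseteq> {a :: 'a poly. power_atom M a \<and> degree a \<le> m} \<and> (\<Sum>a\<in>A. degree a) = m.
          \<Prod>a\<in>A. char_poly_weight a)"
      unfolding prod_over_degrees_eq_prod_atoms[OF M]
        fps_nth_prod_one_plus_monomial[OF finite_poly_degree_le] subsets_of_total_degree[OF n] ..
    also have "\<dots> = fps_nth (S_Sp TYPE('a) M) m"
    proof (cases "m = 0")
      case True
      \<comment> \<open>Only the empty product contributes in degree 0, matching the constant term 1
        that \<open>S_Sp\<close> prescribes.\<close>
      have "{A. A \<subseteq> {a :: 'a poly. power_atom M a \<and> degree a \<le> 0} \<and> (\<Sum>a\<in>A. degree a) = 0} = {{}}"
        using power_atomD(5) by fastforce
      then show ?thesis unfolding True by (simp add: S_Sp_def)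
    next
      case False
      then show ?thesis using s_Sp_eq_sum[of m M, where 'a = 'a] by (simp add: S_Sp_def)
    qed
    finally show ?thesis .
  qed
  then show "\<forall>\<^sub>F n in sequentially. fps_nth (\<Prod>d\<in>{1..n}.
            (1 + fps_const (1 / (real (card (UNIV :: 'a set)) ^ d + 1)) * fps_X ^ d) ^ N_star TYPE('a) M d
          * (1 + fps_const (1 / (real (card (UNIV :: 'a set)) ^ d - 1)) * fps_X ^ d) ^ R_star TYPE('a) M d) m
      = fps_nth (S_Sp TYPE('a) M) m"
    unfolding eventually_sequentially by blast
qed

end
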